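(* The quantum query complexity of trace distance estimation is $\Omega\big(\frac{\sqrt{r}}{\varepsilon}\big)$.
   Context: Trace distance estimation: given two unknown quantum states $\rho$ and $\sigma$ of rank $r$, estimate $\mathrm{T}(\rho,\sigma) = \frac{1}{2}\tr|\rho-\sigma|$ to within additive error $\varepsilon$ with success probability at least $2/3$. Query complexity is measured in the purified quantum query access model: for each state, e.g. $\rho$, the oracle is a unitary $U$ acting on subsystems $\mathsf{A}$ and $\mathsf{B}$ with $\rho = \tr_{\mathsf{B}}\big(U_{\mathsf{AB}}\, |0\rangle\langle 0|_{\mathsf{AB}}\, U_{\mathsf{AB}}^\dagger\big)$, and a query means one use of (controlled-)$U$ or (controlled-)$U^\dagger$. *)

theory Defs
  imports Complex_Main "Jordan_Normal_Form.Matrix" "Jordan_Normal_Form.DL_Rank"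
begin

definition cadj :: "complex mat \<Rightarrow> complex mat" where
  "cadj A = mat (dim_col A) (dim_row A) (\<lambda>(i,j). cnj (A $$ (j,i)))"

definition unitary_mat :: "nat \<Rightarrow> complex mat \<Rightarrow> bool" where
  "unitary_mat d U \<longleftrightarrow> U \<in> carrier_mat d d \<and> cadj U * U = 1\<^sub>m d \<and> U * cadj U = 1\<^sub>m d"

definition psd_mat :: "nat \<Rightarrow> complex mat \<Rightarrow> bool" where
  "psd_mat d A \<longleftrightarrow> A \<in> carrier_mat d d \<and> cadj A = A \<and>
     (\<forall>v \<in> carrier_vec d. 0 \<le> Re (\<Sum>i<d. cnj (v $ i) * (A *\<^sub>v v) $ i))"

definition mat_abs :: "complex mat \<Rightarrow> complex mat" where
  "mat_abs A = (THE B. psd_mat (dim_col A) B \<and> B * B = cadj A * A)"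

definition trace_norm :: "complex mat \<Rightarrow> real" where
  "trace_norm A = Re (\<Sum>i<dim_col A. mat_abs A $$ (i,i))"

definition trace_dist :: "complex mat \<Rightarrow> complex mat \<Rightarrow> real" where
  "trace_dist \<rho> \<sigma> = trace_norm (\<rho> - \<sigma>) / 2"

definition mat_rank :: "nat \<Rightarrow> complex mat \<Rightarrow> nat" where
  "mat_rank d A = vec_space.rank d A"

text \<open>System A has dimension n, system B dimension m; the basis vector |i>|j> of A\<otimes>B
  has index i*m+j.  Partial trace over B.\<close>
definition partial_trace_B :: "nat \<Rightarrow> nat \<Rightarrow> complex mat \<Rightarrow> complex mat" where
  "partial_trace_B n m M = mat n n (\<lambda>(i,i'). \<Sum>j<m. M $$ (i*m+j, i'*m+j))"

definition proj0 :: "nat \<Rightarrow> complex mat" where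
  "proj0 d = mat d d (\<lambda>(i,j). if i = 0 \<and> j = 0 then 1 else 0)"

definition oracle_state :: "nat \<Rightarrow> nat \<Rightarrow> complex mat \<Rightarrow> complex mat" where
  "oracle_state n m U = partial_trace_B n m (U * proj0 (n*m) * cadj U)"

text \<open>An algorithm acts on C^k \<otimes> (A\<otimes>B), dimension k*(n*m), index w*(n*m)+x.
  It applies unitaries W_0, query_0, W_1, ..., query_{T-1}, W_T to |0> and measures in
  the computational basis; outcome j is mapped to the estimate outp j.
  Query i applies the controlled oracle (controlled on the projector qctrl i of the work
  register; qctrl i = identity gives the uncontrolled query) where the oracle is
  U_rho or U_sigma (qtarget i) or its inverse (qdag i).\<close>
record qalg =
  wdim :: nat
  nq :: nat
  unis :: "nat \<Rightarrow> complex mat"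
  qtarget :: "nat \<Rightarrow> bool"
  qdag :: "nat \<Rightarrow> bool"
  qctrl :: "nat \<Rightarrow> complex mat"
  outp :: "nat \<Rightarrow> real"

definition valid_alg :: "nat \<Rightarrow> nat \<Rightarrow> qalg \<Rightarrow> bool" where
  "valid_alg n m A \<longleftrightarrow> 1 \<le> wdim A \<and>
     (\<forall>i \<le> nq A. unitary_mat (wdim A * (n*m)) (unis A i)) \<and>
     (\<forall>i < nq A. qctrl A i \<in> carrier_mat (wdim A) (wdim A) \<and>
                 cadj (qctrl A i) = qctrl A i \<and> qctrl A i * qctrl A i = qctrl A i)"

text \<open>Controlled operator P \<otimes> V + (I - P) \<otimes> I on C^k \<otimes> C^d.\<close>
definition ctrl_op :: "nat \<Rightarrow> nat \<Rightarrow> complex mat \<Rightarrow> complex mat \<Rightarrow> complex mat" where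
  "ctrl_op k d P V = mat (k*d) (k*d) (\<lambda>(a,b).
      P $$ (a div d, b div d) * V $$ (a mod d, b mod d)
    + ((if a div d = b div d then 1 else 0) - P $$ (a div d, b div d))
        * (if a mod d = b mod d then 1 else 0))"

definition query_op :: "nat \<Rightarrow> nat \<Rightarrow> qalg \<Rightarrow> complex mat \<Rightarrow> complex mat \<Rightarrow> nat \<Rightarrow> complex mat" where
  "query_op n m A U V i =
     (let Orc = (if qtarget A i then U else V);
          Orc' = (if qdag A i then cadj Orc else Orc)
      in ctrl_op (wdim A) (n*m) (qctrl A i) Orc')"

fun alg_state :: "nat \<Rightarrow> nat \<Rightarrow> qalg \<Rightarrow> complex mat \<Rightarrow> complex mat \<Rightarrow> nat \<Rightarrow> complex vec" where
  "alg_state n m A U V 0 = unis A 0 *\<^sub>v unit_vec (wdim A * (n*m)) 0"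
| "alg_state n m A U V (Suc i) = unis A (Suc i) *\<^sub>v (query_op n m A U V i *\<^sub>v alg_state n m A U V i)"

definition final_state :: "nat \<Rightarrow> nat \<Rightarrow> qalg \<Rightarrow> complex mat \<Rightarrow> complex mat \<Rightarrow> complex vec" where
  "final_state n m A U V = alg_state n m A U V (nq A)"

definition success_prob :: "nat \<Rightarrow> nat \<Rightarrow> qalg \<Rightarrow> complex mat \<Rightarrow> complex mat \<Rightarrow> real \<Rightarrow> real \<Rightarrow> real" where
  "success_prob n m A U V t \<epsilon> =
     (\<Sum>j \<in> {j. j < wdim A * (n*m) \<and> \<bar>outp A j - t\<bar> \<le> \<epsilon>}. (cmod (final_state n m A U V $ j))^2)"

definition solves_TDE :: "nat \<Rightarrow> nat \<Rightarrow> nat \<Rightarrow> real \<Rightarrow> qalg \<Rightarrow> bool" where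
  "solves_TDE n m r \<epsilon> A \<longleftrightarrow> valid_alg n m A \<and>
     (\<forall>U V. unitary_mat (n*m) U \<longrightarrow> unitary_mat (n*m) V \<longrightarrow>
        mat_rank n (oracle_state n m U) = r \<longrightarrow> mat_rank n (oracle_state n m V) = r \<longrightarrow>
        success_prob n m A U V (trace_dist (oracle_state n m U) (oracle_state n m V)) \<epsilon> \<ge> 2/3)"

end

theory Submission
  imports Defs "HOL-Analysis.L2_Norm" "HOL-Library.FuncSet" "HOL-Combinatorics.Permutations"
begin

text \<open>
  The oracle for a purification \<open>\<psi>\<close> is taken to be the reflection \<open>I - 2 |\<chi>><\<chi>|\<close> with
  \<open>\<chi> = (|0> - \<psi>)/\<surd>2\<close>.  Given \<open>K\<close> copies of \<open>\<chi>\<close>, the reflection about the symmetric subspace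
  of query register and copies does not depend on \<open>\<chi>\<close> and replaces a query up to error
  \<open>2/\<surd>(K+1)\<close>.  So \<open>Q\<close> queries are as good as \<open>K \<approx> Q\<^sup>2\<close> copies of a purification, and if the
  purification is randomised over a large system \<open>B\<close>, these are as good as \<open>K\<close> copies of the
  state \<open>\<rho>\<close> itself.  It remains to see that about \<open>r/\<epsilon>\<^sup>2\<close> copies are needed to tell the maximally
  mixed state \<open>I/r\<close> from \<open>\<rho> = (I + \<delta> X)/r\<close>, where \<open>\<delta> = 7 \<epsilon>\<close> and \<open>X\<close> exchanges the basis vectors of a
  random perfect matching with random signs.  Here the \<open>\<chi>\<^sup>2\<close>-divergence of the averaged tensor
  power is \<open>E (1 + \<delta>\<^sup>2 tr(X X')/r)^k - 1\<close>, and \<open>tr(X X')\<close>, twice the signed number of fixed points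
  of a random permutation, has a bounded moment generating function.  For \<open>r = 1\<close> two pure states
  at angle of order \<open>\<epsilon>\<close> suffice.
\<close>

section \<open>Inner products of functions on finite sets\<close>

text \<open>A reflection is its own inverse and is determined by the single vector \<chi>, so
  inverse queries need no separate treatment. It sends |0> to \<psi> because <\<chi>|0> = 1/sqrt 2
  and \<psi> is orthogonal to |0>.

  The obstacle is that copies of a purification carry more information than copies of \<rho>. An
  independent sign on every label of B removes the coherence between different sets of labels, and
  an independent cyclic shift in every cell of r labels makes the vector attached to a label uniform
  among the vectors of the ensemble. This works as long as no two copies show labels of the same
  cell, which many cells make unlikely; hence the demand that B be large, depending on r and
  \<epsilon>.

  Only the first oracle is randomised. The second is one fixed purification of I/r, and its queries
  are carried out exactly. An estimator must then tell distance 0 from distance above 2 \<epsilon>,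
  and the only object to be compared is one linear contraction applied to two averages of K-fold
  product states.\<close>

definition sqn :: "'a set \<Rightarrow> ('a \<Rightarrow> complex) \<Rightarrow> real" where
  "sqn S f = (\<Sum>x\<in>S. (cmod (f x))\<^sup>2)"

definition nrm :: "'a set \<Rightarrow> ('a \<Rightarrow> complex) \<Rightarrow> real" where
  "nrm S f = sqrt (sqn S f)"

definition ip :: "'a set \<Rightarrow> ('a \<Rightarrow> complex) \<Rightarrow> ('a \<Rightarrow> complex) \<Rightarrow> complex" where
  "ip S f g = (\<Sum>x\<in>S. cnj (f x) * g x)"

lemma sqn_nonneg: "0 \<le> sqn S f"
  by (simp add: sqn_def sum_nonneg)

lemma nrm_nonneg: "0 \<le> nrm S f"
  by (simp add: nrm_def sqn_nonneg)

lemma nrm_sq: "(nrm S f)\<^sup>2 = sqn S f"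
  by (simp add: nrm_def sqn_nonneg)

lemma nrm_L2: "nrm S f = L2_set (\<lambda>x. cmod (f x)) S"
  by (simp add: nrm_def sqn_def L2_set_def)

lemma sqn_cong: "(\<And>x. x \<in> S \<Longrightarrow> f x = g x) \<Longrightarrow> sqn S f = sqn S g"
  by (simp add: sqn_def)

lemma nrm_cong: "(\<And>x. x \<in> S \<Longrightarrow> f x = g x) \<Longrightarrow> nrm S f = nrm S g"
  by (simp add: nrm_def sqn_def)

lemma ip_cong:
  "(\<And>x. x \<in> S \<Longrightarrow> f x = f' x) \<Longrightarrow> (\<And>x. x \<in> S \<Longrightarrow> g x = g' x) \<Longrightarrow> ip S f g = ip S f' g'"
  by (simp add: ip_def)

lemma ip_self: "ip S f f = complex_of_real (sqn S f)"
  unfolding ip_def sqn_def of_real_sum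
  by (intro sum.cong refl) (metis complex_norm_square mult.commute)

lemma ip_commute: "ip S g f = cnj (ip S f g)"
  by (simp add: ip_def mult.commute)

lemma ip_add_right: "ip S f (\<lambda>x. g x + h x) = ip S f g + ip S f h"
  by (simp add: ip_def algebra_simps sum.distrib)

lemma ip_diff_right: "ip S f (\<lambda>x. g x - h x) = ip S f g - ip S f h"
  by (simp add: ip_def algebra_simps sum_subtractf)

lemma ip_diff_left: "ip S (\<lambda>x. g x - h x) f = ip S g f - ip S h f"
  by (simp add: ip_def algebra_simps sum_subtractf)

lemma ip_scale_right: "ip S f (\<lambda>x. c * g x) = c * ip S f g"
  by (simp add: ip_def sum_distrib_left algebra_simps)

lemma ip_scale_left: "ip S (\<lambda>x. c * f x) g = cnj c * ip S f g"
  by (simp add: ip_def sum_distrib_left algebra_simps)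

lemma ip_sum_right: "ip S f (\<lambda>x. \<Sum>i\<in>I. g i x) = (\<Sum>i\<in>I. ip S f (g i))"
  unfolding ip_def sum_distrib_left by (rule sum.swap)

lemma ip_sum_left: "ip S (\<lambda>x. \<Sum>i\<in>I. f i x) g = (\<Sum>i\<in>I. ip S (f i) g)"
  unfolding ip_def cnj_sum sum_distrib_right by (rule sum.swap)

lemma cmod_ip_le: "cmod (ip S f g) \<le> nrm S f * nrm S g"
proof -
  have "cmod (ip S f g) \<le> (\<Sum>x\<in>S. cmod (cnj (f x) * g x))"
    unfolding ip_def by (rule norm_sum)
  also have "\<dots> = (\<Sum>x\<in>S. \<bar>cmod (f x)\<bar> * \<bar>cmod (g x)\<bar>)"
    by (simp add: norm_mult)
  also have "\<dots> \<le> nrm S f * nrm S g"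
    unfolding nrm_L2 by (rule L2_set_mult_ineq)
  finally show ?thesis .
qed

lemma nrm_triangle: "nrm S (\<lambda>x. f x + g x) \<le> nrm S f + nrm S g"
proof -
  have "nrm S (\<lambda>x. f x + g x) \<le> L2_set (\<lambda>x. cmod (f x) + cmod (g x)) S"
    unfolding nrm_L2 by (intro L2_set_mono norm_triangle_ineq norm_ge_zero)
  also have "\<dots> \<le> nrm S f + nrm S g"
    unfolding nrm_L2 by (rule L2_set_triangle_ineq)
  finally show ?thesis .
qed

lemma nrm_scale: "nrm S (\<lambda>x. c * f x) = cmod c * nrm S f"
  by (simp add: nrm_L2 norm_mult L2_set_right_distrib)

lemma nrm_minus_commute: "nrm S (\<lambda>x. f x - g x) = nrm S (\<lambda>x. g x - f x)"
  by (simp add: nrm_def sqn_def norm_minus_commute)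

lemma nrm_diff_le: "nrm S f \<le> nrm S g + nrm S (\<lambda>x. f x - g x)"
  using nrm_triangle[of S g "\<lambda>x. f x - g x"] by simp

text \<open>Factor a^2 - b^2 = (a + b)(a - b). Acceptance probabilities are squared norms, so this
  converts closeness of states into closeness of probabilities.\<close>

lemma sqn_diff_le:
  assumes "nrm S f \<le> 1" "nrm S g \<le> 1"
  shows "\<bar>sqn S f - sqn S g\<bar> \<le> 2 * nrm S (\<lambda>x. f x - g x)"
proof -
  have 1: "\<bar>nrm S f - nrm S g\<bar> \<le> nrm S (\<lambda>x. f x - g x)"
    using nrm_diff_le[of S f g] nrm_diff_le[of S g f] nrm_minus_commute[of S f g] by linarith
  have "\<bar>sqn S f - sqn S g\<bar> = \<bar>nrm S f + nrm S g\<bar> * \<bar>nrm S f - nrm S g\<bar>"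
    by (simp add: nrm_sq[symmetric] power2_eq_square abs_mult[symmetric] algebra_simps)
  also have "\<dots> \<le> 2 * nrm S (\<lambda>x. f x - g x)"
    using assms nrm_nonneg[of S f] nrm_nonneg[of S g] 1 by (intro mult_mono) auto
  finally show ?thesis .
qed

lemma sqn_diff_expand:
  "complex_of_real (sqn S (\<lambda>x. f x - g x)) = ip S f f - ip S f g - ip S g f + ip S g g"
  by (simp add: ip_self[symmetric] ip_diff_left ip_diff_right)

section \<open>Linear maps and orthogonal projections on functions\<close>

definition lin :: "(('a \<Rightarrow> complex) \<Rightarrow> ('b \<Rightarrow> complex)) \<Rightarrow> bool" where
  "lin G \<longleftrightarrow> (\<forall>u v. G (\<lambda>y. u y + v y) = (\<lambda>s. G u s + G v s)) \<and>
     (\<forall>c u. G (\<lambda>y. c * u y) = (\<lambda>s. c * G u s))"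

lemma lin_zero:
  assumes "lin G" shows "G (\<lambda>y. 0) = (\<lambda>s. 0)"
proof -
  have "G (\<lambda>y. c * u y) = (\<lambda>s. c * G u s)" for c u
    using assms unfolding lin_def by blast
  from this[of 0 "\<lambda>y. 0"] show ?thesis by simp
qed

lemma lin_sum:
  assumes "lin G"
  shows "G (\<lambda>y. \<Sum>i\<in>I. c i * u i y) = (\<lambda>s. \<Sum>i\<in>I. c i * G (u i) s)"
proof (induction I rule: infinite_finite_induct)
  case (insert i I)
  have "G (\<lambda>y. c i * u i y + (\<Sum>i\<in>I. c i * u i y))
      = (\<lambda>s. c i * G (u i) s + (\<Sum>i\<in>I. c i * G (u i) s))"
    using assms insert.IH unfolding lin_def by metis
  with insert.hyps show ?case by simp
qed (simp_all add: lin_zero[OF assms])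

lemma lin_diff:
  assumes "lin G"
  shows "G (\<lambda>y. u y - v y) = (\<lambda>s. G u s - G v s)"
proof -
  have "G (\<lambda>y. u y + (-1) * v y) = (\<lambda>s. G u s + (-1) * G v s)"
    using assms unfolding lin_def by metis
  then show ?thesis by simp
qed

lemma lin_comp: "lin F \<Longrightarrow> lin G \<Longrightarrow> lin (\<lambda>u. F (G u))"
  by (simp add: lin_def)

lemma lin_id_minus:
  assumes "lin M" shows "lin (\<lambda>f s. f s - 2 * M f s)"
  using assms by (simp add: lin_def algebra_simps)

text \<open>Idempotence is asked on \<open>S\<close> only: off \<open>S\<close> the operators below
  read matrix entries beyond the dimension, whose values are unspecified. Self-adjointness is
  expressed through \<open>ip\<close>, which looks at \<open>S\<close> alone.\<close>

definition oproj :: "'a set \<Rightarrow> (('a \<Rightarrow> complex) \<Rightarrow> ('a \<Rightarrow> complex)) \<Rightarrow> bool" where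
  "oproj S M \<longleftrightarrow> (\<forall>f g. ip S (M f) g = ip S f (M g)) \<and> (\<forall>f. \<forall>s\<in>S. M (M f) s = M f s)"

lemma oproj_ip: "oproj S M \<Longrightarrow> ip S (M f) (M f) = ip S f (M f)"
  unfolding oproj_def by (metis (no_types, lifting) ip_cong)

lemma oproj_sqn: "oproj S M \<Longrightarrow> complex_of_real (sqn S (M f)) = ip S f (M f)"
  by (metis ip_self oproj_ip)

text \<open>Since <Mf, Mf> = <f, Mf>, the terms -4 <f, Mf> and 4 <Mf, Mf> cancel. Every query, exact
  or simulated, has the form I - 2M and therefore preserves norms.\<close>

lemma oproj_reflection:
  assumes "oproj S M"
  shows "sqn S (\<lambda>s. f s - 2 * M f s) = sqn S f"
proof -
  have a: "ip S (M f) f = ip S f (M f)"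
    using assms unfolding oproj_def by blast
  have "complex_of_real (sqn S (\<lambda>s. f s - 2 * M f s)) = ip S f f - 2 * ip S f (M f)
      - 2 * ip S (M f) f + 4 * ip S (M f) (M f)"
    by (simp add: sqn_diff_expand ip_scale_left ip_scale_right)
  also have "\<dots> = complex_of_real (sqn S f)"
    using a oproj_ip[OF assms, of f] by (simp add: ip_self)
  finally show ?thesis by (simp only: of_real_eq_iff)
qed

lemma oproj_contract:
  assumes "oproj S M"
  shows "nrm S (M f) \<le> nrm S f"
proof -
  have "complex_of_real (sqn S (\<lambda>s. f s - M f s)) = ip S f f - ip S f (M f)
      - ip S (M f) f + ip S (M f) (M f)"
    by (simp add: sqn_diff_expand)
  moreover have "ip S (M f) f = ip S f (M f)"
    using assms unfolding oproj_def by blast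
  ultimately have "complex_of_real (sqn S (\<lambda>s. f s - M f s)) = complex_of_real (sqn S f - sqn S (M f))"
    using oproj_ip[OF assms, of f] oproj_sqn[OF assms, of f] by (simp add: ip_self)
  then have "sqn S (\<lambda>s. f s - M f s) = sqn S f - sqn S (M f)"
    by (simp only: of_real_eq_iff)
  then have "sqn S (M f) \<le> sqn S f"
    using sqn_nonneg[of S "\<lambda>s. f s - M f s"] by linarith
  then show ?thesis by (simp add: nrm_def)
qed

text \<open>Commuting projections multiply to a projection. The case needed is a control projection
  on the work register times a projection on the other registers.\<close>

lemma oproj_comp:
  assumes "oproj S M" "oproj S N" "\<And>f. M (N f) = N (M f)"
  shows "oproj S (\<lambda>f. M (N f))"
  unfolding oproj_def
proof (intro conjI allI ballI)
  fix f g
  show "ip S (M (N f)) g = ip S f (M (N g))"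
    using assms unfolding oproj_def by metis
next
  fix f s assume "s \<in> S"
  then show "M (N (M (N f))) s = M (N f) s"
    using assms unfolding oproj_def by metis
qed

section \<open>The query register and the copies\<close>

text \<open>Register 0 is the query register and registers 1 to \<open>K\<close> hold the copies.
  Keeping them in one function lets permutations of registers act by composition.\<close>

definition regs :: "nat \<Rightarrow> nat \<Rightarrow> (nat \<Rightarrow> nat) set" where
  "regs d K = PiE {..K} (\<lambda>_. {..<d})"

definition copies :: "nat \<Rightarrow> nat \<Rightarrow> (nat \<Rightarrow> nat) set" where
  "copies d K = PiE {1..K} (\<lambda>_. {..<d})"

definition joint :: "nat \<Rightarrow> nat \<Rightarrow> nat \<Rightarrow> (nat \<times> (nat \<Rightarrow> nat)) set" where
  "joint k d K = {..<k} \<times> regs d K"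

lemma finite_regs [simp]: "finite (regs d K)"
  by (simp add: regs_def finite_PiE)

lemma finite_copies [simp]: "finite (copies d K)"
  by (simp add: copies_def finite_PiE)

lemma finite_joint [simp]: "finite (joint k d K)"
  by (simp add: joint_def)

lemma regs_0: "z \<in> regs d K \<Longrightarrow> z 0 < d"
  by (auto simp: regs_def)

lemma sum_regs:
  "(\<Sum>z\<in>regs d K. F z) = (\<Sum>y\<in>copies d K. \<Sum>x<d. F (y(0 := x)))"
proof -
  have *: "{..K} = insert 0 {1..K}" by auto
  have "(\<Sum>z\<in>regs d K. F z) = (\<Sum>(y, x)\<in>copies d K \<times> {..<d}. F (y(0 := x)))"
    by (rule sum.reindex_bij_witness[of _ "\<lambda>(y, x). y(0 := x)" "\<lambda>z. (z(0 := undefined), z 0)"])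
      (auto simp: regs_def copies_def PiE_def extensional_def * split: if_splits)
  then show ?thesis by (simp add: sum.cartesian_product)
qed

lemma ip_joint:
  "ip (joint k d K) f g = (\<Sum>w<k. \<Sum>z\<in>regs d K. cnj (f (w, z)) * g (w, z))"
  by (simp add: ip_def joint_def sum.cartesian_product case_prod_beta)

lemma sqn_joint:
  "sqn (joint k d K) f = (\<Sum>w<k. \<Sum>z\<in>regs d K. (cmod (f (w, z)))\<^sup>2)"
  by (simp add: sqn_def joint_def sum.cartesian_product case_prod_beta)

lemma sum_split_index:
  fixes f :: "nat \<Rightarrow> 'a :: comm_monoid_add"
  shows "(\<Sum>i<k*d. f i) = (\<Sum>w<k. \<Sum>x<d. f (w * d + x))"
proof -
  have "(\<Sum>i<k*d. f i) = (\<Sum>w<k. sum f {w * d ..< w * d + d})"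
    by (rule sum.nat_group[symmetric])
  also have "\<dots> = (\<Sum>w<k. \<Sum>x<d. f (w * d + x))"
  proof (rule sum.cong[OF refl])
    fix w
    show "sum f {w * d ..< w * d + d} = (\<Sum>x<d. f (w * d + x))"
      using sum.shift_bounds_nat_ivl[of f 0 "w * d" d] by (simp add: add.commute lessThan_atLeast0)
  qed
  finally show ?thesis .
qed

lemma pair_index_less: "w < k \<Longrightarrow> x < d \<Longrightarrow> w * d + x < k * (d::nat)"
proof -
  assume "w < k" "x < d"
  then have "w * d + x < (w + 1) * d" by simp
  also have "\<dots> \<le> k * d" using \<open>w < k\<close> by (intro mult_right_mono) auto
  finally show ?thesis .
qed

section \<open>Unitaries on work and query register\<close>

lemma cadj_index: "i < dim_col A \<Longrightarrow> j < dim_row A \<Longrightarrow> cadj A $$ (i, j) = cnj (A $$ (j, i))"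
  by (simp add: cadj_def)

lemma unitary_cols:
  assumes "unitary_mat D W" "a < D" "b < D"
  shows "(\<Sum>i<D. cnj (W $$ (i, a)) * W $$ (i, b)) = (if a = b then 1 else 0)"
proof -
  have W: "W \<in> carrier_mat D D" and eq: "cadj W * W = 1\<^sub>m D"
    using assms by (auto simp: unitary_mat_def)
  have "(cadj W * W) $$ (a, b) = (\<Sum>i<D. cnj (W $$ (i, a)) * W $$ (i, b))"
    using W assms by (auto simp: scalar_prod_def cadj_def lessThan_atLeast0 intro!: sum.cong)
  then show ?thesis using eq assms by simp
qed

lemma unitary_sqn:
  assumes "unitary_mat D W"
  shows "sqn {..<D} (\<lambda>i. \<Sum>j<D. W $$ (i, j) * c j) = sqn {..<D} c"
proof -
  have "complex_of_real (sqn {..<D} (\<lambda>i. \<Sum>j<D. W $$ (i, j) * c j))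
      = (\<Sum>a<D. \<Sum>b<D. cnj (c a) * c b * (\<Sum>i<D. cnj (W $$ (i, a)) * W $$ (i, b)))"
  proof -
    have "complex_of_real (sqn {..<D} (\<lambda>i. \<Sum>j<D. W $$ (i, j) * c j))
      = (\<Sum>a<D. \<Sum>b<D. ip {..<D} (\<lambda>i. W $$ (i, a) * c a) (\<lambda>i. W $$ (i, b) * c b))"
      by (simp add: ip_self[symmetric] ip_sum_left ip_sum_right)
    then show ?thesis by (simp add: ip_def sum_distrib_left algebra_simps)
  qed
  also have "\<dots> = (\<Sum>a<D. \<Sum>b<D. cnj (c a) * c b * (if a = b then 1 else 0))"
    using unitary_cols[OF assms] by (intro sum.cong refl) auto
  also have "\<dots> = complex_of_real (sqn {..<D} c)"
    by (simp add: ip_self[symmetric] ip_def if_distrib cong: if_cong)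
  finally show ?thesis by (simp only: of_real_eq_iff)
qed

text \<open>This is \<open>W\<close> tensored with the identity on the copies; the index
  \<open>w * d + z 0\<close> follows the layout of the algorithm's space, work register times oracle
  space.\<close>

definition lift_mat :: "nat \<Rightarrow> nat \<Rightarrow> complex mat \<Rightarrow> (nat \<times> (nat \<Rightarrow> nat) \<Rightarrow> complex)
    \<Rightarrow> (nat \<times> (nat \<Rightarrow> nat) \<Rightarrow> complex)" where
  "lift_mat k d W f = (\<lambda>(w, z). \<Sum>w'<k. \<Sum>x<d. W $$ (w * d + z 0, w' * d + x) * f (w', z(0 := x)))"

lemma lin_lift_mat: "lin (lift_mat k d W)"
  by (auto simp: lin_def lift_mat_def algebra_simps sum.distrib sum_distrib_left)

text \<open>For fixed contents \<open>y\<close> of the copies the lifted map is \<open>W\<close>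
  applied to the slice \<open>c y\<close>, so unitarity of \<open>W\<close> only has to be summed
  over \<open>y\<close>.\<close>

lemma lift_mat_sqn:
  assumes "unitary_mat (k * d) W"
  shows "sqn (joint k d K) (lift_mat k d W f) = sqn (joint k d K) f"
proof (cases "d = 0")
  case True
  then show ?thesis by (simp add: sqn_joint sum_regs)
next
  case False
  define c where "c y i = f (i div d, y(0 := i mod d))" for y :: "nat \<Rightarrow> nat" and i
  have c: "c y (w * d + x) = f (w, y(0 := x))" if "x < d" for y w x
    using that by (simp add: c_def)
  have *: "sqn (joint k d K) g = (\<Sum>y\<in>copies d K. \<Sum>w<k. \<Sum>x<d. (cmod (g (w, y(0 := x))))\<^sup>2)" for g
    unfolding sqn_joint sum_regs by (rule sum.swap)
  have "sqn (joint k d K) (lift_mat k d W f)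
      = (\<Sum>y\<in>copies d K. \<Sum>w<k. \<Sum>x<d.
          (cmod (\<Sum>w'<k. \<Sum>x'<d. W $$ (w * d + x, w' * d + x') * c y (w' * d + x')))\<^sup>2)"
    unfolding * by (simp add: lift_mat_def c)
  also have "\<dots> = (\<Sum>y\<in>copies d K. sqn {..<k*d} (\<lambda>i. \<Sum>j<k*d. W $$ (i, j) * c y j))"
    unfolding sqn_def sum_split_index ..
  also have "\<dots> = (\<Sum>y\<in>copies d K. sqn {..<k*d} (c y))"
    by (simp add: unitary_sqn[OF assms])
  also have "\<dots> = sqn (joint k d K) f"
    unfolding * by (simp add: c sqn_def sum_split_index)
  finally show ?thesis .
qed

section \<open>The three projections: control, known state, symmetric subspace\<close>

definition lift_ctrl :: "nat \<Rightarrow> complex mat \<Rightarrow> (nat \<times> 'z \<Rightarrow> complex) \<Rightarrow> (nat \<times> 'z \<Rightarrow> complex)" where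
  "lift_ctrl k P f = (\<lambda>(w, z). \<Sum>w'<k. P $$ (w, w') * f (w', z))"

definition lift_proj :: "nat \<Rightarrow> (nat \<Rightarrow> complex) \<Rightarrow> (nat \<times> (nat \<Rightarrow> nat) \<Rightarrow> complex)
    \<Rightarrow> (nat \<times> (nat \<Rightarrow> nat) \<Rightarrow> complex)" where
  "lift_proj d \<eta> f = (\<lambda>(w, z). \<eta> (z 0) * (\<Sum>x<d. cnj (\<eta> x) * f (w, z(0 := x))))"

text \<open>Projection onto the symmetric subspace of all \<open>K + 1\<close> registers, the query
  register included. No state enters its definition, which is why it can stand in for the projection
  onto an unknown one.\<close>

definition symm :: "nat \<Rightarrow> (nat \<times> (nat \<Rightarrow> nat) \<Rightarrow> complex) \<Rightarrow> (nat \<times> (nat \<Rightarrow> nat) \<Rightarrow> complex)" where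
  "symm K f = (\<lambda>(w, z). (\<Sum>p | p permutes {..K}. f (w, z \<circ> p)) / fact (Suc K))"

lemma lin_lift_ctrl: "lin (lift_ctrl k P)"
  by (auto simp: lin_def lift_ctrl_def algebra_simps sum.distrib sum_distrib_left)

lemma lin_lift_proj: "lin (lift_proj d \<eta>)"
  by (auto simp: lin_def lift_proj_def algebra_simps sum.distrib sum_distrib_left)

lemma lin_symm: "lin (symm K)"
  by (auto simp: lin_def symm_def algebra_simps sum.distrib sum_distrib_left add_divide_distrib)

lemma lift_ctrl_proj_commute: "lift_ctrl k P (lift_proj d \<eta> f) = lift_proj d \<eta> (lift_ctrl k P f)"
proof -
  have "(\<Sum>w'<k. P $$ (w, w') * (\<eta> (z 0) * (\<Sum>x<d. cnj (\<eta> x) * f (w', z(0 := x)))))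
      = \<eta> (z 0) * (\<Sum>x<d. cnj (\<eta> x) * (\<Sum>w'<k. P $$ (w, w') * f (w', z(0 := x))))" for w z
    unfolding sum_distrib_left by (subst sum.swap) (simp add: mult_ac)
  then show ?thesis by (auto simp: lift_ctrl_def lift_proj_def)
qed

lemma lift_ctrl_symm_commute: "lift_ctrl k P (symm K f) = symm K (lift_ctrl k P f)"
proof -
  have "(\<Sum>w'<k. P $$ (w, w') * ((\<Sum>p | p permutes {..K}. f (w', z \<circ> p)) / fact (Suc K)))
      = (\<Sum>p | p permutes {..K}. \<Sum>w'<k. P $$ (w, w') * f (w', z \<circ> p)) / fact (Suc K)" for w z
    unfolding sum_distrib_left sum_divide_distrib by (subst sum.swap) simp
  then show ?thesis by (simp add: lift_ctrl_def symm_def)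
qed

lemma oproj_lift_ctrl:
  assumes P: "P \<in> carrier_mat k k" "cadj P = P" "P * P = P"
  shows "oproj (joint k d K) (lift_ctrl k P)"
  unfolding oproj_def
proof (intro conjI allI ballI)
  have herm: "cnj (P $$ (i, j)) = P $$ (j, i)" if "i < k" "j < k" for i j
    using cadj_index[of j P i] that P by auto
  fix f g
  have "ip (joint k d K) (lift_ctrl k P f) g
      = (\<Sum>z\<in>regs d K. \<Sum>w<k. \<Sum>w'<k. cnj (P $$ (w, w')) * cnj (f (w', z)) * g (w, z))"
    unfolding ip_joint lift_ctrl_def by (subst sum.swap) (simp add: sum_distrib_right)
  also have "\<dots> = (\<Sum>z\<in>regs d K. \<Sum>w<k. \<Sum>w'<k. cnj (P $$ (w', w)) * cnj (f (w, z)) * g (w', z))"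
    by (intro sum.cong refl sum.swap)
  also have "\<dots> = ip (joint k d K) f (lift_ctrl k P g)"
    unfolding ip_joint
    by (subst sum.swap) (simp add: lift_ctrl_def sum_distrib_left herm mult_ac)
  finally show "ip (joint k d K) (lift_ctrl k P f) g = ip (joint k d K) f (lift_ctrl k P g)" .
next
  fix f s assume "s \<in> joint k d K"
  then obtain w z where s: "s = (w, z)" "w < k" by (auto simp: joint_def)
  have idem: "(\<Sum>w'<k. P $$ (w, w') * P $$ (w', w'')) = P $$ (w, w'')" if "w'' < k" for w''
  proof -
    have "(P * P) $$ (w, w'') = (\<Sum>w'<k. P $$ (w, w') * P $$ (w', w''))"
      using P(1) s that by (auto simp: scalar_prod_def lessThan_atLeast0 intro!: sum.cong)
    then show ?thesis using P(3) by simp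
  qed
  have "lift_ctrl k P (lift_ctrl k P f) s
      = (\<Sum>w''<k. (\<Sum>w'<k. P $$ (w, w') * P $$ (w', w'')) * f (w'', z))"
    unfolding s lift_ctrl_def
    by (simp add: sum_distrib_left sum_distrib_right mult.assoc) (rule sum.swap)
  then show "lift_ctrl k P (lift_ctrl k P f) s = lift_ctrl k P f s"
    by (simp add: idem s lift_ctrl_def)
qed

lemma unit_sum_cnj:
  assumes "sqn {..<d} \<eta> = 1"
  shows "(\<Sum>x<d. cnj (\<eta> x) * \<eta> x) = 1"
  using ip_self[of "{..<d}" \<eta>] assms by (simp add: ip_def)

lemma oproj_lift_proj:
  assumes "sqn {..<d} \<eta> = 1"
  shows "oproj (joint k d K) (lift_proj d \<eta>)"
  unfolding oproj_def
proof (intro conjI allI ballI)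
  fix f g
  have "ip (joint k d K) (lift_proj d \<eta> f) g = (\<Sum>w<k. \<Sum>y\<in>copies d K.
      (\<Sum>x<d. \<eta> x * cnj (f (w, y(0 := x)))) * (\<Sum>x<d. cnj (\<eta> x) * g (w, y(0 := x))))"
    unfolding ip_joint sum_regs lift_proj_def
    by (simp add: sum_distrib_left sum_distrib_right mult_ac)
  also have "\<dots> = ip (joint k d K) f (lift_proj d \<eta> g)"
    unfolding ip_joint sum_regs lift_proj_def
    by (simp add: sum_distrib_right mult_ac)
  finally show "ip (joint k d K) (lift_proj d \<eta> f) g = ip (joint k d K) f (lift_proj d \<eta> g)" .
next
  fix f s assume "s \<in> joint k d K"
  obtain w z where s: "s = (w, z)" by (cases s)
  have "lift_proj d \<eta> (lift_proj d \<eta> f) s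
      = \<eta> (z 0) * ((\<Sum>x<d. cnj (\<eta> x) * \<eta> x) * (\<Sum>x<d. cnj (\<eta> x) * f (w, z(0 := x))))"
    unfolding s lift_proj_def by (simp add: sum_distrib_right mult.assoc)
  then show "lift_proj d \<eta> (lift_proj d \<eta> f) s = lift_proj d \<eta> f s"
    unfolding unit_sum_cnj[OF assms] by (simp add: s lift_proj_def)
qed

lemma regs_comp: "p permutes {..K} \<Longrightarrow> z \<in> regs d K \<Longrightarrow> z \<circ> p \<in> regs d K"
  using permutes_in_image[of p "{..K}"] permutes_not_in[of p "{..K}"]
  by (auto simp: regs_def PiE_def extensional_def Pi_def)

lemma sum_regs_perm:
  assumes "p permutes {..K}"
  shows "(\<Sum>z\<in>regs d K. F (z \<circ> p)) = (\<Sum>z\<in>regs d K. F z)"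
proof (rule sum.reindex_bij_witness[of _ "\<lambda>z. z \<circ> inv_into UNIV p" "\<lambda>z. z \<circ> p"])
  fix z
  show "(z \<circ> p) \<circ> inv_into UNIV p = z" "(z \<circ> inv_into UNIV p) \<circ> p = z"
    using permutes_inv_o[OF assms] by (simp_all add: comp_assoc)
qed (auto intro: regs_comp assms permutes_inv)

text \<open>Averaging over a group: moving a permutation to the other side of the inner product
  inverts it, and both inversion and left translation merely reorder the sum over the group.\<close>

lemma oproj_symm: "oproj (joint k d K) (symm K)"
  unfolding oproj_def
proof (intro conjI allI ballI)
  fix f g :: "nat \<times> (nat \<Rightarrow> nat) \<Rightarrow> complex"
  let ?P = "{p. p permutes {..K}}"
  have inner: "(\<Sum>z\<in>regs d K. (\<Sum>p\<in>?P. cnj (f (w, z \<circ> p))) * g (w, z))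
      = (\<Sum>z\<in>regs d K. cnj (f (w, z)) * (\<Sum>p\<in>?P. g (w, z \<circ> p)))" for w
  proof -
    have "(\<Sum>z\<in>regs d K. (\<Sum>p\<in>?P. cnj (f (w, z \<circ> p))) * g (w, z))
        = (\<Sum>p\<in>?P. \<Sum>z\<in>regs d K. cnj (f (w, z \<circ> p)) * g (w, z))"
      unfolding sum_distrib_right by (rule sum.swap)
    also have "\<dots> = (\<Sum>p\<in>?P. \<Sum>z\<in>regs d K. cnj (f (w, z)) * g (w, z \<circ> inv_into UNIV p))"
    proof (rule sum.cong[OF refl])
      fix p assume "p \<in> ?P"
      then have p: "p permutes {..K}" by simp
      have "(\<Sum>z\<in>regs d K. cnj (f (w, z \<circ> p)) * g (w, z))
          = (\<Sum>z\<in>regs d K. (\<lambda>z. cnj (f (w, z)) * g (w, z \<circ> inv_into UNIV p)) (z \<circ> p))"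
        using permutes_inv_o(1)[OF p] by (simp add: comp_assoc)
      also have "\<dots> = (\<Sum>z\<in>regs d K. cnj (f (w, z)) * g (w, z \<circ> inv_into UNIV p))"
        by (rule sum_regs_perm[OF p])
      finally show "(\<Sum>z\<in>regs d K. cnj (f (w, z \<circ> p)) * g (w, z))
          = (\<Sum>z\<in>regs d K. cnj (f (w, z)) * g (w, z \<circ> inv_into UNIV p))" .
    qed
    also have "\<dots> = (\<Sum>p\<in>?P. \<Sum>z\<in>regs d K. cnj (f (w, z)) * g (w, z \<circ> p))"
      by (rule sum_permutations_inverse[symmetric])
    also have "\<dots> = (\<Sum>z\<in>regs d K. cnj (f (w, z)) * (\<Sum>p\<in>?P. g (w, z \<circ> p)))"
      unfolding sum_distrib_left by (rule sum.swap)
    finally show ?thesis .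
  qed
  have "ip (joint k d K) (symm K f) g
      = (\<Sum>w<k. \<Sum>z\<in>regs d K. (\<Sum>p\<in>?P. cnj (f (w, z \<circ> p))) * g (w, z)) / fact (Suc K)"
    unfolding ip_joint symm_def by (simp add: sum_divide_distrib sum_distrib_right)
  also have "\<dots> = (\<Sum>w<k. \<Sum>z\<in>regs d K. cnj (f (w, z)) * (\<Sum>p\<in>?P. g (w, z \<circ> p))) / fact (Suc K)"
    by (simp only: inner)
  also have "\<dots> = ip (joint k d K) f (symm K g)"
    unfolding ip_joint symm_def by (simp add: sum_divide_distrib sum_distrib_left)
  finally show "ip (joint k d K) (symm K f) g = ip (joint k d K) f (symm K g)" .
next
  fix f :: "nat \<times> (nat \<Rightarrow> nat) \<Rightarrow> complex" and s assume "s \<in> joint k d K"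
  let ?P = "{p. p permutes {..K}}"
  obtain w z where s: "s = (w, z)" by (cases s)
  have card: "card ?P = fact (Suc K)"
    using card_permutations[of "{..K}" "Suc K"] by simp
  have "(\<Sum>q\<in>?P. f (w, (z \<circ> p) \<circ> q)) = (\<Sum>q\<in>?P. f (w, z \<circ> q))" if "p \<in> ?P" for p
    using setum_permutations_compose_left[of p "{..K}" "\<lambda>q. f (w, z \<circ> q)"] that
    by (simp add: comp_assoc)
  then have "symm K (symm K f) s
      = (\<Sum>p\<in>?P. (\<Sum>q\<in>?P. f (w, z \<circ> q)) / fact (Suc K)) / fact (Suc K)"
    unfolding s symm_def by simp
  also have "\<dots> = symm K f s"
    by (simp add: s symm_def card del: fact_Suc)
  finally show "symm K (symm K f) s = symm K f s" .
qed

section \<open>A state together with copies: symmetrising against projecting\<close>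

definition tens :: "nat \<Rightarrow> nat \<Rightarrow> (nat \<Rightarrow> complex) \<Rightarrow> complex vec \<Rightarrow> nat \<times> (nat \<Rightarrow> nat) \<Rightarrow> complex" where
  "tens d K \<chi> s = (\<lambda>(w, z). s $ (w * d + z 0) * (\<Prod>l\<in>{1..K}. \<chi> (z l)))"

lemma sum_regs_prod:
  fixes F :: "nat \<Rightarrow> nat \<Rightarrow> complex"
  shows "(\<Sum>z\<in>regs d K. \<Prod>l\<in>{..K}. F l (z l)) = (\<Prod>l\<in>{..K}. \<Sum>x<d. F l x)"
  unfolding regs_def by (rule prod_sum_PiE[symmetric]) auto

lemma sqn_copies_prod:
  "sqn (copies d K) (\<lambda>y. \<Prod>l\<in>{1..K}. \<chi> (y l)) = (sqn {..<d} \<chi>) ^ K"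
proof -
  have "sqn (copies d K) (\<lambda>y. \<Prod>l\<in>{1..K}. \<chi> (y l))
      = (\<Sum>y\<in>PiE {1..K} (\<lambda>_. {..<d}). \<Prod>l\<in>{1..K}. (cmod (\<chi> (y l)))\<^sup>2)"
    by (simp add: sqn_def copies_def prod_norm[symmetric] prod_power_distrib)
  also have "\<dots> = (\<Prod>l\<in>{1..K}. sqn {..<d} \<chi>)"
    unfolding sqn_def by (rule prod_sum_PiE[symmetric]) auto
  finally show ?thesis by simp
qed

lemma tens_sqn:
  assumes "sqn {..<d} \<chi> = 1"
  shows "sqn (joint k d K) (tens d K \<chi> s) = sqn {..<k*d} (\<lambda>i. s $ i)"
proof -
  have "sqn (joint k d K) (tens d K \<chi> s) = (\<Sum>w<k. \<Sum>y\<in>copies d K. \<Sum>x<d.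
      (cmod (s $ (w * d + x)))\<^sup>2 * (cmod (\<Prod>l\<in>{1..K}. \<chi> (y l)))\<^sup>2)"
    unfolding sqn_joint sum_regs tens_def by (simp add: norm_mult power_mult_distrib)
  also have "\<dots> = (\<Sum>w<k. \<Sum>x<d. (cmod (s $ (w * d + x)))\<^sup>2) * sqn (copies d K) (\<lambda>y. \<Prod>l\<in>{1..K}. \<chi> (y l))"
    unfolding sqn_def sum_distrib_left sum_distrib_right by (subst sum.swap) (rule refl)
  also have "\<dots> = sqn {..<k*d} (\<lambda>i. s $ i)"
    unfolding sqn_copies_prod assms by (simp add: sqn_def sum_split_index)
  finally show ?thesis .
qed

text \<open>Split \<open>s\<close> into a part \<open>C\<close> along \<chi> and a part
  \<open>R\<close> orthogonal to \<chi> in the query register. Both projections fix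
  \<open>C\<close>, which is symmetric together with the copies, and the exact one annihilates
  \<open>R\<close>. In <R, symm R> only the permutations fixing register 0 survive, K! out of
  (K+1)!, so the symmetrised remainder has squared norm at most |s|^2/(K+1).\<close>

lemma symm_tens_close:
  assumes unit: "sqn {..<d} \<chi> = 1"
  shows "nrm (joint k d K) (\<lambda>p. symm K (tens d K \<chi> s) p - lift_proj d \<chi> (tens d K \<chi> s) p)
    \<le> nrm {..<k*d} (\<lambda>i. s $ i) / sqrt (real (Suc K))"
proof -
  let ?S = "joint k d K" and ?P = "{p. p permutes {..K}}"
  define c where "c w = (\<Sum>x<d. cnj (\<chi> x) * s $ (w * d + x))" for w
  define \<phi> where "\<phi> w x = s $ (w * d + x) - c w * \<chi> x" for w x
  define R where "R = (\<lambda>(w, z :: nat \<Rightarrow> nat). \<phi> w (z 0) * (\<Prod>l\<in>{1..K}. \<chi> (z l)))"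
  define C where "C = (\<lambda>(w, z :: nat \<Rightarrow> nat). c w * (\<Prod>l\<in>{..K}. \<chi> (z l)))"
  have split0: "(\<Prod>l\<in>{..K}. f l) = f 0 * (\<Prod>l\<in>{1..K}. f l)" for f :: "nat \<Rightarrow> complex"
  proof -
    have "{..K} = insert 0 {1..K}" by auto
    then show ?thesis by simp
  qed
  have orth: "(\<Sum>x<d. cnj (\<chi> x) * \<phi> w x) = 0" for w
  proof -
    have "(\<Sum>x<d. cnj (\<chi> x) * \<phi> w x) = c w - c w * (\<Sum>x<d. cnj (\<chi> x) * \<chi> x)"
      unfolding \<phi>_def right_diff_distrib sum_subtractf
      by (simp add: c_def[of w] sum_distrib_left mult.left_commute)
    then show ?thesis by (simp add: unit_sum_cnj[OF unit])
  qed
  have orth': "(\<Sum>x<d. cnj (\<phi> w x) * \<chi> x) = 0" for w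
  proof -
    have "(\<Sum>x<d. cnj (\<phi> w x) * \<chi> x) = cnj (\<Sum>x<d. cnj (\<chi> x) * \<phi> w x)"
      by (simp add: mult.commute)
    then show ?thesis by (simp add: orth)
  qed
  have tens_eq: "tens d K \<chi> s = (\<lambda>p. C p + R p)"
    by (auto simp: tens_def C_def R_def \<phi>_def split0 algebra_simps)
  have symC: "symm K C p = C p" for p
  proof -
    obtain w z where p: "p = (w, z)" by (cases p)
    have "(\<Prod>l\<in>{..K}. \<chi> ((z \<circ> q) l)) = (\<Prod>l\<in>{..K}. \<chi> (z l))" if "q \<in> ?P" for q
      using prod.permute[of q "{..K}" "\<lambda>l. \<chi> (z l)"] that by (simp add: comp_def)
    then have "symm K C p = (\<Sum>q\<in>?P. C p) / fact (Suc K)"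
      unfolding symm_def p C_def by simp
    also have "\<dots> = C p"
      using card_permutations[of "{..K}" "Suc K"] by (simp del: fact_Suc)
    finally show ?thesis .
  qed
  have "lift_proj d \<chi> (tens d K \<chi> s) p = C p" for p
  proof -
    obtain w z where p: "p = (w, z)" by (cases p)
    have upd: "(\<Prod>l\<in>{1..K}. \<chi> ((z(0 := x)) l)) = (\<Prod>l\<in>{1..K}. \<chi> (z l))" for x
      by (rule prod.cong) auto
    have "lift_proj d \<chi> (tens d K \<chi> s) p
        = \<chi> (z 0) * (\<Sum>x<d. cnj (\<chi> x) * (s $ (w * d + x) * (\<Prod>l\<in>{1..K}. \<chi> (z l))))"
      unfolding p lift_proj_def tens_def by (simp add: upd fun_upd_same del: fun_upd_apply One_nat_def)
    also have "\<dots> = \<chi> (z 0) * (c w * (\<Prod>l\<in>{1..K}. \<chi> (z l)))"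
      unfolding c_def sum_distrib_right by (simp add: mult.assoc)
    finally show ?thesis by (simp add: C_def p split0 mult_ac)
  qed
  moreover have "symm K (tens d K \<chi> s) = (\<lambda>p. symm K C p + symm K R p)"
    using lin_symm[of K] unfolding tens_eq lin_def by blast
  ultimately have "(\<lambda>p. symm K (tens d K \<chi> s) p - lift_proj d \<chi> (tens d K \<chi> s) p) = symm K R"
    by (simp add: symC)
  moreover have "complex_of_real (sqn ?S (symm K R))
      = complex_of_real ((\<Sum>w<k. sqn {..<d} (\<phi> w)) / real (Suc K))"
  proof -
    have perm: "(\<Sum>z\<in>regs d K. cnj (R (w, z)) * R (w, z \<circ> q))
        = (if q 0 = 0 then complex_of_real (sqn {..<d} (\<phi> w)) else 0)" if q: "q \<in> ?P" for q w
    proof -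
      \<comment> \<open>\<open>F t\<close> puts \<open>\<phi> w\<close> into register
        \<open>t\<close> and \<chi> into all others; permuting by \<open>q\<close> moves the
        exceptional register from 0 to \<open>q 0\<close>. If these differ, the factor of register 0
        is an inner product of \<open>\<phi> w\<close> with \<chi>, which is zero.\<close>
      define F where "F t l = (if l = t then \<phi> w else \<chi>)" for t l :: nat
      have prodF: "(\<Prod>l\<in>{..K}. F t l (z l)) = \<phi> w (z t) * (\<Prod>l\<in>{..K}-{t}. \<chi> (z l))"
        if "t \<le> K" for t and z :: "nat \<Rightarrow> nat"
      proof -
        have "(\<Prod>l\<in>{..K}. F t l (z l)) = F t t (z t) * (\<Prod>l\<in>{..K}-{t}. F t l (z l))"
          by (rule prod.remove) (use that in auto)
        also have "(\<Prod>l\<in>{..K}-{t}. F t l (z l)) = (\<Prod>l\<in>{..K}-{t}. \<chi> (z l))"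
          by (rule prod.cong) (auto simp: F_def)
        finally show ?thesis by (simp add: F_def)
      qed
      have q': "q permutes {..K}" using q by simp
      have q0: "q 0 \<le> K" using permutes_in_image[OF q', of 0] by simp
      have R1: "R (w, z) = (\<Prod>l\<in>{..K}. F 0 l (z l))" for z
      proof -
        have "{..K} - {0} = {1..K}" by auto
        then show ?thesis by (simp add: R_def prodF)
      qed
      have R2: "R (w, z \<circ> q) = (\<Prod>l\<in>{..K}. F (q 0) l (z l))" for z
      proof -
        have "bij_betw q {1..K} ({..K} - {q 0})"
        proof -
          have "bij_betw q ({..K} - {0}) ({..K} - {q 0})"
            using permutes_imp_bij[OF q'] by (intro bij_betw_DiffI) (auto simp: bij_betw_def)
          moreover have "{..K} - {0} = {1..K}" by auto
          ultimately show ?thesis by simp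
        qed
        then have "(\<Prod>l\<in>{1..K}. \<chi> (z (q l))) = (\<Prod>l\<in>{..K}-{q 0}. \<chi> (z l))"
          by (rule prod.reindex_bij_betw)
        then show ?thesis using q0 by (simp add: R_def prodF)
      qed
      have "(\<Sum>z\<in>regs d K. cnj (R (w, z)) * R (w, z \<circ> q))
          = (\<Prod>l\<in>{..K}. \<Sum>x<d. cnj (F 0 l x) * F (q 0) l x)"
        unfolding R2 unfolding R1 cnj_prod prod.distrib[symmetric] by (rule sum_regs_prod)
      also have "\<dots> = (if q 0 = 0 then complex_of_real (sqn {..<d} (\<phi> w)) else 0)"
      proof (cases "q 0 = 0")
        case True
        have "(\<Prod>l\<in>{1..K}. \<Sum>x<d. cnj (F 0 l x) * F 0 l x) = (\<Prod>l\<in>{1..K}. 1)"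
          by (rule prod.cong) (auto simp: F_def unit_sum_cnj[OF unit])
        then show ?thesis
          using ip_self[of "{..<d}" "\<phi> w"] True by (simp add: split0 F_def ip_def)
      next
        case False
        then show ?thesis by (simp add: split0 F_def orth')
      qed
      finally show ?thesis .
    qed
    have cardP0: "card {q \<in> ?P. q 0 = 0} = fact K"
    proof -
      have "{q \<in> ?P. q 0 = 0} = {q. q permutes {1..K}}"
      proof safe
        fix q assume q: "q permutes {..K}" "q 0 = 0"
        show "q permutes {1..K}"
        proof (rule permutes_superset[OF q(1)])
          fix x assume "x \<in> {..K} - {1..K}"
          then have "x = 0" by auto
          then show "q x = x" using q(2) by simp
        qed
      next
        fix q assume q: "q permutes {1..K}"
        then show "q permutes {..K}" by (rule permutes_subset) auto
        show "q 0 = 0" using q by (simp add: permutes_not_in)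
      qed
      then show ?thesis by (simp add: card_permutations)
    qed
    have "complex_of_real (sqn ?S (symm K R)) = ip ?S R (symm K R)"
      by (rule oproj_sqn[OF oproj_symm])
    also have "\<dots> = (\<Sum>w<k. \<Sum>z\<in>regs d K. \<Sum>q\<in>?P. cnj (R (w, z)) * R (w, z \<circ> q)) / fact (Suc K)"
      unfolding ip_joint symm_def by (simp add: sum_divide_distrib sum_distrib_left)
    also have "\<dots> = (\<Sum>w<k. \<Sum>q\<in>?P. \<Sum>z\<in>regs d K. cnj (R (w, z)) * R (w, z \<circ> q)) / fact (Suc K)"
      by (subst sum.swap) (rule refl)
    also have "\<dots> = (\<Sum>w<k. \<Sum>q\<in>?P. if q 0 = 0 then complex_of_real (sqn {..<d} (\<phi> w)) else 0)
        / fact (Suc K)"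
      by (simp add: perm)
    also have "\<dots> = (\<Sum>w<k. fact K * complex_of_real (sqn {..<d} (\<phi> w))) / fact (Suc K)"
      using cardP0 by (simp add: sum.If_cases finite_permutations Int_def del: fact_Suc)
    also have "\<dots> = complex_of_real ((\<Sum>w<k. sqn {..<d} (\<phi> w)) / real (Suc K))"
      by (simp add: sum_distrib_left[symmetric])
    finally show ?thesis .
  qed
  moreover have "sqn {..<d} (\<phi> w) \<le> (\<Sum>x<d. (cmod (s $ (w * d + x)))\<^sup>2)" for w
  proof -
    define sw where "sw x = s $ (w * d + x)" for x
    have "complex_of_real (sqn {..<d} sw) = ip {..<d} (\<lambda>x. c w * \<chi> x + \<phi> w x) (\<lambda>x. c w * \<chi> x + \<phi> w x)"
      by (simp add: ip_self[symmetric] \<phi>_def sw_def[abs_def])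
    also have "\<dots> = ip {..<d} (\<lambda>x. c w * \<chi> x) (\<lambda>x. c w * \<chi> x) + ip {..<d} (\<phi> w) (\<phi> w)"
    proof -
      have "ip {..<d} \<chi> (\<phi> w) = 0" "ip {..<d} (\<phi> w) \<chi> = 0"
        using orth orth' by (auto simp: ip_def)
      moreover have "ip {..<d} (\<lambda>x. c w * \<chi> x + \<phi> w x) h
          = ip {..<d} (\<lambda>x. c w * \<chi> x) h + ip {..<d} (\<phi> w) h" for h
        by (simp add: ip_def algebra_simps sum.distrib)
      ultimately show ?thesis
        by (simp add: ip_add_right ip_scale_right ip_scale_left)
    qed
    also have "\<dots> = complex_of_real (sqn {..<d} (\<lambda>x. c w * \<chi> x) + sqn {..<d} (\<phi> w))"
      by (simp add: ip_self)
    finally have "sqn {..<d} sw = sqn {..<d} (\<lambda>x. c w * \<chi> x) + sqn {..<d} (\<phi> w)"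
      by (simp only: of_real_eq_iff)
    then show ?thesis
      using sqn_nonneg[of "{..<d}" "\<lambda>x. c w * \<chi> x"] by (simp add: sqn_def[of _ sw] sw_def)
  qed
  then have "(\<Sum>w<k. sqn {..<d} (\<phi> w)) \<le> sqn {..<k*d} (\<lambda>i. s $ i)"
    unfolding sqn_def[of "{..<k*d}"] sum_split_index by (intro sum_mono) simp
  ultimately show ?thesis
    by (simp only: of_real_eq_iff nrm_def real_sqrt_divide[symmetric])
      (simp add: divide_right_mono)
qed

section \<open>Reflections as oracles\<close>

definition House :: "nat \<Rightarrow> (nat \<Rightarrow> complex) \<Rightarrow> complex mat" where
  "House d \<eta> = mat d d (\<lambda>(i, j). (if i = j then 1 else 0) - 2 * \<eta> i * cnj (\<eta> j))"

lemma House_carrier [simp]: "House d \<eta> \<in> carrier_mat d d"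
  "dim_row (House d \<eta>) = d" "dim_col (House d \<eta>) = d"
  by (simp_all add: House_def)

lemma cadj_House [simp]: "cadj (House d \<eta>) = House d \<eta>"
  by (rule eq_matI) (auto simp: cadj_def House_def)

lemma unitary_House:
  assumes "sqn {..<d} \<eta> = 1"
  shows "unitary_mat d (House d \<eta>)"
proof -
  have "House d \<eta> * House d \<eta> = 1\<^sub>m d"
  proof (rule eq_matI)
    fix i j assume ij: "i < dim_row (1\<^sub>m d :: complex mat)" "j < dim_col (1\<^sub>m d :: complex mat)"
    then have "(House d \<eta> * House d \<eta>) $$ (i, j)
        = (\<Sum>l<d. ((if i = l then 1 else 0) - 2 * \<eta> i * cnj (\<eta> l))
                  * ((if l = j then 1 else 0) - 2 * \<eta> l * cnj (\<eta> j)))"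
      by (auto simp: House_def scalar_prod_def lessThan_atLeast0 intro!: sum.cong)
    also have "\<dots> = (\<Sum>l<d. if i = l then (if l = j then 1 else 0) - 2 * \<eta> l * cnj (\<eta> j) else 0)
        - (\<Sum>l<d. if l = j then 2 * \<eta> i * cnj (\<eta> l) else 0)
        + 4 * \<eta> i * cnj (\<eta> j) * (\<Sum>l<d. cnj (\<eta> l) * \<eta> l)"
      unfolding sum_distrib_left sum_subtractf[symmetric] sum.distrib[symmetric]
      by (rule sum.cong) (auto simp: algebra_simps)
    also have "\<dots> = 1\<^sub>m d $$ (i, j)"
      using ij by (simp add: unit_sum_cnj[OF assms])
    finally show "(House d \<eta> * House d \<eta>) $$ (i, j) = 1\<^sub>m d $$ (i, j)" .
  qed auto
  then show ?thesis by (simp add: unitary_mat_def)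
qed

section \<open>Simulation of queries by copies\<close>

lemma tens_lift_mat:
  assumes W: "W \<in> carrier_mat (k * d) (k * d)" and s: "s \<in> carrier_vec (k * d)"
    and p: "p \<in> joint k d K"
  shows "tens d K \<chi> (W *\<^sub>v s) p = lift_mat k d W (tens d K \<chi> s) p"
proof -
  obtain w z where wz: "p = (w, z)" "w < k" "z \<in> regs d K"
    using p by (auto simp: joint_def)
  have upd: "(\<Prod>l\<in>{1..K}. \<chi> ((z(0 := x)) l)) = (\<Prod>l\<in>{1..K}. \<chi> (z l))" for x
    by (rule prod.cong) auto
  have i: "w * d + z 0 < k * d"
    using wz regs_0 by (intro pair_index_less) auto
  have "(W *\<^sub>v s) $ (w * d + z 0) = (\<Sum>j<k*d. W $$ (w * d + z 0, j) * s $ j)"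
    using W s i by (auto simp: scalar_prod_def lessThan_atLeast0 intro!: sum.cong)
  also have "\<dots> = (\<Sum>w'<k. \<Sum>x<d. W $$ (w * d + z 0, w' * d + x) * s $ (w' * d + x))"
    by (rule sum_split_index)
  finally show ?thesis
    unfolding wz tens_def lift_mat_def
    by (simp add: upd fun_upd_same sum_distrib_right mult.assoc del: fun_upd_apply One_nat_def)
qed

text \<open>With V = I - 2H, where H projects onto \<eta>, the operator P \<otimes> V + (I - P)
  \<otimes> I collapses to I - 2 (P \<otimes> H). A controlled reflection is thus again a
  reflection.\<close>

lemma House_query_index:
  assumes s: "s \<in> carrier_vec (k * d)" and P: "P \<in> carrier_mat k k" and w: "w < k" and x: "x < d"
  shows "(ctrl_op k d P (House d \<eta>) *\<^sub>v s) $ (w * d + x)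
    = s $ (w * d + x)
      - 2 * (\<Sum>w'<k. P $$ (w, w') * (\<eta> x * (\<Sum>x'<d. cnj (\<eta> x') * s $ (w' * d + x'))))"
proof -
  have i: "w * d + x < k * d" by (rule pair_index_less[OF w x])
  have "(ctrl_op k d P (House d \<eta>) *\<^sub>v s) $ (w * d + x)
      = (\<Sum>j<k*d. ctrl_op k d P (House d \<eta>) $$ (w * d + x, j) * s $ j)"
    using s i by (auto simp: ctrl_op_def scalar_prod_def lessThan_atLeast0 intro!: sum.cong)
  also have "\<dots> = (\<Sum>w'<k. \<Sum>x'<d. ctrl_op k d P (House d \<eta>) $$ (w * d + x, w' * d + x') * s $ (w' * d + x'))"
    by (rule sum_split_index)
  also have "\<dots> = (\<Sum>w'<k. \<Sum>x'<d. (if w = w' then if x = x' then s $ (w' * d + x') else 0 else 0)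
      - 2 * (P $$ (w, w') * (\<eta> x * (cnj (\<eta> x') * s $ (w' * d + x')))))"
  proof (intro sum.cong refl)
    fix w' x' assume "w' \<in> {..<k}" "x' \<in> {..<d}"
    then have j: "w' < k" "x' < d" "w' * d + x' < k * d" by (auto intro: pair_index_less)
    have e: "ctrl_op k d P (House d \<eta>) $$ (w * d + x, w' * d + x')
        = P $$ (w, w') * ((if x = x' then 1 else 0) - 2 * \<eta> x * cnj (\<eta> x'))
          + ((if w = w' then 1 else 0) - P $$ (w, w')) * (if x = x' then 1 else 0)"
      using i j w x by (simp add: ctrl_op_def House_def)
    show "ctrl_op k d P (House d \<eta>) $$ (w * d + x, w' * d + x') * s $ (w' * d + x')
        = (if w = w' then if x = x' then s $ (w' * d + x') else 0 else 0)
          - 2 * (P $$ (w, w') * (\<eta> x * (cnj (\<eta> x') * s $ (w' * d + x'))))"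
      unfolding e by (cases "x = x'"; cases "w = w'"; simp add: algebra_simps)
  qed
  also have "\<dots> = (\<Sum>w'<k. if w = w' then \<Sum>x'<d. if x = x' then s $ (w' * d + x') else 0 else 0)
      - 2 * (\<Sum>w'<k. P $$ (w, w') * (\<eta> x * (\<Sum>x'<d. cnj (\<eta> x') * s $ (w' * d + x'))))"
  proof -
    have "(\<Sum>x'<d. if w = w' then if x = x' then s $ (w' * d + x') else 0 else 0)
        = (if w = w' then \<Sum>x'<d. if x = x' then s $ (w' * d + x') else 0 else 0)" for w'
      by simp
    then show ?thesis unfolding sum_subtractf sum_distrib_left by simp
  qed
  also have "(\<Sum>w'<k. if w = w' then \<Sum>x'<d. if x = x' then s $ (w' * d + x') else 0 else 0)
      = s $ (w * d + x)"
    using w x by simp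
  finally show ?thesis .
qed

lemma tens_query:
  assumes s: "s \<in> carrier_vec (k * d)" and P: "P \<in> carrier_mat k k" and p: "p \<in> joint k d K"
  shows "tens d K \<chi> (ctrl_op k d P (House d \<eta>) *\<^sub>v s) p
    = tens d K \<chi> s p - 2 * lift_ctrl k P (lift_proj d \<eta> (tens d K \<chi> s)) p"
proof -
  obtain w z where wz: "p = (w, z)" "w < k" "z \<in> regs d K"
    using p by (auto simp: joint_def)
  have upd: "(\<Prod>l\<in>{1..K}. \<chi> ((z(0 := x)) l)) = (\<Prod>l\<in>{1..K}. \<chi> (z l))" for x
    by (rule prod.cong) auto
  let ?c = "\<Prod>l\<in>{1..K}. \<chi> (z l)"
  have e: "lift_ctrl k P (lift_proj d \<eta> (tens d K \<chi> s)) p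
      = (\<Sum>w'<k. P $$ (w, w') * (\<eta> (z 0) * (\<Sum>x'<d. cnj (\<eta> x') * s $ (w' * d + x')))) * ?c"
    unfolding wz tens_def lift_ctrl_def lift_proj_def
    by (simp add: upd fun_upd_same sum_distrib_left sum_distrib_right mult.assoc del: fun_upd_apply One_nat_def)
  show ?thesis
    unfolding e unfolding wz tens_def prod.case House_query_index[OF s P wz(2) regs_0[OF wz(3)]]
    by (simp add: algebra_simps)
qed

text \<open>The flag \<open>t\<close> marks a query to the first oracle, whose projection is
  replaced by \<open>symm K\<close>. A query to the second oracle is exact, with the known
  \<open>\<eta>\<close>. The state of the first oracle does not occur.\<close>

definition sim_query :: "nat \<Rightarrow> nat \<Rightarrow> nat \<Rightarrow> (nat \<Rightarrow> complex) \<Rightarrow> bool \<Rightarrow> complex mat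
    \<Rightarrow> (nat \<times> (nat \<Rightarrow> nat) \<Rightarrow> complex) \<Rightarrow> nat \<times> (nat \<Rightarrow> nat) \<Rightarrow> complex" where
  "sim_query k d K \<eta> t P f =
     (\<lambda>s. f s - 2 * lift_ctrl k P ((if t then symm K else lift_proj d \<eta>) f) s)"

fun sim :: "nat \<Rightarrow> nat \<Rightarrow> qalg \<Rightarrow> (nat \<Rightarrow> complex) \<Rightarrow> (nat \<times> (nat \<Rightarrow> nat) \<Rightarrow> complex) \<Rightarrow> nat
    \<Rightarrow> nat \<times> (nat \<Rightarrow> nat) \<Rightarrow> complex" where
  "sim d K A \<eta> f 0 = lift_mat (wdim A) d (unis A 0) f"
| "sim d K A \<eta> f (Suc i) = lift_mat (wdim A) d (unis A (Suc i))
     (sim_query (wdim A) d K \<eta> (qtarget A i) (qctrl A i) (sim d K A \<eta> f i))"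

lemma lin_sim_query: "lin (sim_query k d K \<eta> t P)"
proof -
  have "lin (\<lambda>f. lift_ctrl k P ((if t then symm K else lift_proj d \<eta>) f))"
    using lin_comp[where F = "lift_ctrl k P", OF lin_lift_ctrl lin_symm]
      lin_comp[where F = "lift_ctrl k P", OF lin_lift_ctrl lin_lift_proj] by (cases t) simp_all
  then show ?thesis unfolding sim_query_def by (rule lin_id_minus)
qed

lemma lin_sim: "lin (\<lambda>f. sim d K A \<eta> f i)"
proof (induction i)
  case 0
  show ?case by (simp add: lin_lift_mat)
next
  case (Suc i)
  show ?case
    unfolding sim.simps
    by (rule lin_comp[where F = "\<lambda>f. lift_mat (wdim A) d (unis A (Suc i))
          (sim_query (wdim A) d K \<eta> (qtarget A i) (qctrl A i) f)"
          and G = "\<lambda>f. sim d K A \<eta> f i", OF lin_comp[where F = "lift_mat (wdim A) d (unis A (Suc i))"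
          and G = "sim_query (wdim A) d K \<eta> (qtarget A i) (qctrl A i)", OF lin_lift_mat lin_sim_query] Suc])
qed

lemma sqn_sim_query:
  assumes "sqn {..<d} \<eta> = 1" "P \<in> carrier_mat k k" "cadj P = P" "P * P = P"
  shows "sqn (joint k d K) (sim_query k d K \<eta> t P f) = sqn (joint k d K) f"
proof -
  have "oproj (joint k d K) (\<lambda>f. lift_ctrl k P ((if t then symm K else lift_proj d \<eta>) f))"
  proof (rule oproj_comp[where M = "lift_ctrl k P" and N = "if t then symm K else lift_proj d \<eta>"])
    show "oproj (joint k d K) (lift_ctrl k P)" by (rule oproj_lift_ctrl[OF assms(2-4)])
    show "oproj (joint k d K) (if t then symm K else lift_proj d \<eta>)"
      by (cases t) (simp_all add: oproj_symm oproj_lift_proj[OF assms(1)])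
    show "lift_ctrl k P ((if t then symm K else lift_proj d \<eta>) f)
      = (if t then symm K else lift_proj d \<eta>) (lift_ctrl k P f)" for f
      by (cases t) (simp_all add: lift_ctrl_symm_commute lift_ctrl_proj_commute)
  qed
  from oproj_reflection[OF this] show ?thesis unfolding sim_query_def .
qed

lemma sqn_sim:
  assumes "valid_alg n m A" "sqn {..<n*m} \<eta> = 1" "i \<le> nq A"
  shows "sqn (joint (wdim A) (n*m) K) (sim (n*m) K A \<eta> f i) = sqn (joint (wdim A) (n*m) K) f"
  using assms(3)
proof (induction i)
  case 0
  then show ?case using assms by (simp add: valid_alg_def lift_mat_sqn)
next
  case (Suc i)
  then show ?case using assms by (simp add: valid_alg_def lift_mat_sqn sqn_sim_query)
qed

lemma query_op_House:
  "query_op n m A (House (n*m) \<chi>) (House (n*m) \<eta>) i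
    = ctrl_op (wdim A) (n*m) (qctrl A i) (House (n*m) (if qtarget A i then \<chi> else \<eta>))"
  by (simp add: query_op_def Let_def)

lemma query_op_vec_carrier:
  "query_op n m A U V i *\<^sub>v s \<in> carrier_vec (wdim A * (n*m))"
  by (rule carrier_vecI) (simp add: query_op_def ctrl_op_def Let_def)

lemma alg_state_carrier:
  assumes "valid_alg n m A" "i \<le> nq A"
  shows "alg_state n m A U V i \<in> carrier_vec (wdim A * (n*m))"
proof (cases i)
  case 0
  then show ?thesis using assms by (auto simp: valid_alg_def unitary_mat_def intro: mult_mat_vec_carrier)
next
  case (Suc j)
  have "query_op n m A U V j *\<^sub>v alg_state n m A U V j \<in> carrier_vec (wdim A * (n*m))"
    by (rule query_op_vec_carrier)
  then show ?thesis
    using assms Suc by (auto simp: valid_alg_def unitary_mat_def intro: mult_mat_vec_carrier)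
qed

lemma tens_alg_state_Suc:
  assumes "valid_alg n m A" "i < nq A" "p \<in> joint (wdim A) (n*m) K"
  shows "tens (n*m) K \<chi> (alg_state n m A (House (n*m) \<chi>) (House (n*m) \<eta>) (Suc i)) p
    = lift_mat (wdim A) (n*m) (unis A (Suc i)) (tens (n*m) K \<chi>
        (query_op n m A (House (n*m) \<chi>) (House (n*m) \<eta>) i
          *\<^sub>v alg_state n m A (House (n*m) \<chi>) (House (n*m) \<eta>) i)) p"
proof -
  have "unis A (Suc i) \<in> carrier_mat (wdim A * (n*m)) (wdim A * (n*m))"
    using assms by (auto simp: valid_alg_def unitary_mat_def)
  then show ?thesis
    unfolding alg_state.simps using assms(3)
    by (intro tens_lift_mat query_op_vec_carrier)
qed

text \<open>With \<open>K = 0\<close> copies the joint space is the space of the algorithm, so the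
  norm statements about lifted operators apply. All queries are taken as exact there, hence the flag
  \<open>False\<close> and the choice of the state by \<open>qtarget\<close>.\<close>

lemma nrm_alg_state:
  assumes valid: "valid_alg n m A" and nm: "0 < n * m"
    and \<chi>: "sqn {..<n*m} \<chi> = 1" and \<eta>: "sqn {..<n*m} \<eta> = 1" and i: "i \<le> nq A"
  shows "sqn {..<wdim A * (n*m)} (\<lambda>j. alg_state n m A (House (n*m) \<chi>) (House (n*m) \<eta>) i $ j) = 1"
  using i
proof (induction i)
  case 0
  have D: "0 < wdim A * (n*m)" using valid nm by (auto simp: valid_alg_def)
  have U: "unitary_mat (wdim A * (n*m)) (unis A 0)" using valid by (simp add: valid_alg_def)
  let ?e = "unit_vec (wdim A * (n*m)) 0 :: complex vec"
  have "sqn {..<wdim A * (n*m)} (\<lambda>j. (unis A 0 *\<^sub>v ?e) $ j)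
      = sqn {..<wdim A * (n*m)} (\<lambda>j. \<Sum>l<wdim A * (n*m). unis A 0 $$ (j, l) * ?e $ l)"
    using U by (intro sqn_cong) (auto simp: unitary_mat_def scalar_prod_def lessThan_atLeast0 intro!: sum.cong)
  also have "\<dots> = sqn {..<wdim A * (n*m)} (\<lambda>l. ?e $ l)"
    by (rule unitary_sqn[OF U])
  also have "\<dots> = (\<Sum>l<wdim A * (n*m). if l = 0 then 1 else 0)"
    unfolding sqn_def by (rule sum.cong) (auto simp: unit_vec_def)
  also have "\<dots> = 1" using D by simp
  finally show ?case by simp
next
  case (Suc i)
  let ?s = "alg_state n m A (House (n*m) \<chi>) (House (n*m) \<eta>)" and ?S = "joint (wdim A) (n*m) 0"
  let ?q = "query_op n m A (House (n*m) \<chi>) (House (n*m) \<eta>) i *\<^sub>v ?s i"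
  let ?P = "qctrl A i" and ?\<eta> = "if qtarget A i then \<chi> else \<eta>"
  have P: "?P \<in> carrier_mat (wdim A) (wdim A)" "cadj ?P = ?P" "?P * ?P = ?P"
    and U: "unitary_mat (wdim A * (n*m)) (unis A (Suc i))"
    using Suc.prems valid by (auto simp: valid_alg_def)
  have c: "?s i \<in> carrier_vec (wdim A * (n*m))" using Suc.prems valid by (intro alg_state_carrier) auto
  have "sqn {..<wdim A * (n*m)} (\<lambda>j. ?s (Suc i) $ j) = sqn ?S (tens (n*m) 0 \<chi> (?s (Suc i)))"
    by (rule tens_sqn[OF \<chi>, symmetric])
  also have "\<dots> = sqn ?S (lift_mat (wdim A) (n*m) (unis A (Suc i)) (tens (n*m) 0 \<chi> ?q))"
    using Suc.prems valid by (intro sqn_cong tens_alg_state_Suc) auto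
  also have "\<dots> = sqn ?S (tens (n*m) 0 \<chi> ?q)"
    by (rule lift_mat_sqn[OF U])
  also have "\<dots> = sqn ?S (sim_query (wdim A) (n*m) 0 ?\<eta> False ?P (tens (n*m) 0 \<chi> (?s i)))"
    unfolding query_op_House sim_query_def
    by (intro sqn_cong) (simp add: tens_query[OF c P(1)])
  also have "\<dots> = sqn ?S (tens (n*m) 0 \<chi> (?s i))"
    using \<chi> \<eta> P by (intro sqn_sim_query) auto
  also have "\<dots> = 1"
    using Suc tens_sqn[OF \<chi>, of "wdim A" 0 "?s i"] by simp
  finally show ?case .
qed

text \<open>Hybrid argument: the unitaries and the simulated queries are isometries and carry
  earlier errors along unchanged. A query to the first oracle adds at most 2/sqrt(K+1), the 2 being
  the factor in I - 2M; one to the second adds nothing.\<close>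

lemma sim_close:
  assumes valid: "valid_alg n m A" and nm: "0 < n * m"
    and \<chi>: "sqn {..<n*m} \<chi> = 1" and \<eta>: "sqn {..<n*m} \<eta> = 1" and i: "i \<le> nq A"
  shows "nrm (joint (wdim A) (n*m) K)
     (\<lambda>p. sim (n*m) K A \<eta> (tens (n*m) K \<chi> (unit_vec (wdim A * (n*m)) 0)) i p
        - tens (n*m) K \<chi> (alg_state n m A (House (n*m) \<chi>) (House (n*m) \<eta>) i) p)
    \<le> real i * (2 / sqrt (real (Suc K)))"
  using i
proof (induction i)
  case 0
  let ?e = "unit_vec (wdim A * (n*m)) 0 :: complex vec"
  have U: "unitary_mat (wdim A * (n*m)) (unis A 0)" using valid by (simp add: valid_alg_def)
  have "tens (n*m) K \<chi> (unis A 0 *\<^sub>v ?e) p = lift_mat (wdim A) (n*m) (unis A 0) (tens (n*m) K \<chi> ?e) p"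
    if "p \<in> joint (wdim A) (n*m) K" for p
    using that U by (intro tens_lift_mat) (auto simp: unitary_mat_def)
  then have "nrm (joint (wdim A) (n*m) K) (\<lambda>p. sim (n*m) K A \<eta> (tens (n*m) K \<chi> ?e) 0 p
        - tens (n*m) K \<chi> (alg_state n m A (House (n*m) \<chi>) (House (n*m) \<eta>) 0) p)
      = nrm (joint (wdim A) (n*m) K) (\<lambda>p. 0)"
    by (intro nrm_cong) simp
  then show ?case by (simp add: nrm_def sqn_def)
next
  case (Suc i)
  let ?S = "joint (wdim A) (n*m) K"
  let ?s = "alg_state n m A (House (n*m) \<chi>) (House (n*m) \<eta>)"
  let ?q = "query_op n m A (House (n*m) \<chi>) (House (n*m) \<eta>) i *\<^sub>v ?s i"
  let ?P = "qctrl A i" and ?\<eta> = "if qtarget A i then \<chi> else \<eta>"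
  let ?f = "sim (n*m) K A \<eta> (tens (n*m) K \<chi> (unit_vec (wdim A * (n*m)) 0))"
  let ?Q = "sim_query (wdim A) (n*m) K \<eta> (qtarget A i) ?P"
  let ?t = "tens (n*m) K \<chi> (?s i)"
  let ?W = "lift_mat (wdim A) (n*m) (unis A (Suc i))"
  have P: "?P \<in> carrier_mat (wdim A) (wdim A)" "cadj ?P = ?P" "?P * ?P = ?P"
    and U: "unitary_mat (wdim A * (n*m)) (unis A (Suc i))"
    using Suc.prems valid by (auto simp: valid_alg_def)
  have c: "?s i \<in> carrier_vec (wdim A * (n*m))" using Suc.prems valid by (intro alg_state_carrier) auto
  have nW: "nrm ?S (?W h) = nrm ?S h" for h by (simp add: nrm_def lift_mat_sqn[OF U])
  have nQ: "nrm ?S (?Q h) = nrm ?S h" for h by (simp add: nrm_def sqn_sim_query[OF \<eta> P])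
  have "nrm ?S (\<lambda>p. ?f (Suc i) p - tens (n*m) K \<chi> (?s (Suc i)) p)
      = nrm ?S (\<lambda>p. ?W (?Q (?f i)) p - ?W (tens (n*m) K \<chi> ?q) p)"
    using Suc.prems valid by (intro nrm_cong) (simp add: tens_alg_state_Suc del: alg_state.simps)
  also have "\<dots> = nrm ?S (\<lambda>p. ?Q (?f i) p - tens (n*m) K \<chi> ?q p)"
    by (simp only: lin_diff[OF lin_lift_mat, symmetric] nW)
  also have "\<dots> \<le> nrm ?S (\<lambda>p. ?Q (?f i) p - ?Q ?t p) + nrm ?S (\<lambda>p. ?Q ?t p - tens (n*m) K \<chi> ?q p)"
    using nrm_triangle[of ?S "\<lambda>p. ?Q (?f i) p - ?Q ?t p" "\<lambda>p. ?Q ?t p - tens (n*m) K \<chi> ?q p"] by simp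
  also have "nrm ?S (\<lambda>p. ?Q (?f i) p - ?Q ?t p) \<le> real i * (2 / sqrt (real (Suc K)))"
    using Suc by (simp add: lin_diff[OF lin_sim_query, symmetric] nQ)
  also have "nrm ?S (\<lambda>p. ?Q ?t p - tens (n*m) K \<chi> ?q p) \<le> 2 / sqrt (real (Suc K))"
  proof (cases "qtarget A i")
    case False
    then have "nrm ?S (\<lambda>p. ?Q ?t p - tens (n*m) K \<chi> ?q p) = nrm ?S (\<lambda>p. 0)"
      unfolding query_op_House sim_query_def
      by (intro nrm_cong) (simp add: tens_query[OF c P(1)])
    then show ?thesis by (simp add: nrm_def sqn_def)
  next
    case True
    define h where "h = (\<lambda>p. symm K ?t p - lift_proj (n*m) \<chi> ?t p)"
    have "lift_ctrl (wdim A) ?P h = (\<lambda>p. lift_ctrl (wdim A) ?P (symm K ?t) p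
        - lift_ctrl (wdim A) ?P (lift_proj (n*m) \<chi> ?t) p)"
      unfolding h_def by (rule lin_diff[OF lin_lift_ctrl])
    then have "nrm ?S (\<lambda>p. ?Q ?t p - tens (n*m) K \<chi> ?q p)
        = nrm ?S (\<lambda>p. (-2) * lift_ctrl (wdim A) ?P h p)"
      unfolding query_op_House sim_query_def
      by (intro nrm_cong) (simp add: tens_query[OF c P(1)] True right_diff_distrib)
    also have "\<dots> = 2 * nrm ?S (lift_ctrl (wdim A) ?P h)"
      by (simp only: nrm_scale) simp
    also have "\<dots> \<le> 2 * nrm ?S h"
      using oproj_contract[OF oproj_lift_ctrl[OF P]] by simp
    also have "nrm ?S h \<le> nrm {..<wdim A * (n*m)} (\<lambda>j. ?s i $ j) / sqrt (real (Suc K))"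
      unfolding h_def by (rule symm_tens_close[OF \<chi>])
    also have "nrm {..<wdim A * (n*m)} (\<lambda>j. ?s i $ j) = 1"
      using Suc.prems by (simp add: nrm_def nrm_alg_state[OF valid nm \<chi> \<eta>])
    finally show ?thesis by simp
  qed
  finally show ?case
    by (simp only: of_nat_Suc[of i] distrib_right mult_1_left add.commute)
qed

section \<open>The accepted branch as a linear map of the copies\<close>

definition sim_start :: "((nat \<Rightarrow> nat) \<Rightarrow> complex) \<Rightarrow> nat \<times> (nat \<Rightarrow> nat) \<Rightarrow> complex" where
  "sim_start u = (\<lambda>(w, z). if w = 0 \<and> z 0 = 0 then u (z(0 := undefined)) else 0)"

text \<open>The unnormalised branch of the simulated run ending in an outcome of \<open>E\<close>,
  for an arbitrary state \<open>u\<close> of the copies. Being a linear contraction in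
  \<open>u\<close>, it turns all questions about queries into questions about \<open>K\<close>
  copies.\<close>

definition sim_accept :: "nat \<Rightarrow> nat \<Rightarrow> qalg \<Rightarrow> (nat \<Rightarrow> complex) \<Rightarrow> nat set
    \<Rightarrow> ((nat \<Rightarrow> nat) \<Rightarrow> complex) \<Rightarrow> nat \<times> (nat \<Rightarrow> nat) \<Rightarrow> complex" where
  "sim_accept d K A \<eta> E u =
     (\<lambda>(w, z). if w * d + z 0 \<in> E then sim d K A \<eta> (sim_start u) (nq A) (w, z) else 0)"

lemma lin_sim_accept: "lin (sim_accept d K A \<eta> E)"
proof -
  have "lin sim_start" by (auto simp: lin_def sim_start_def)
  have "lin (\<lambda>u. sim d K A \<eta> (sim_start u) (nq A))"
    by (rule lin_comp[where F = "\<lambda>f. sim d K A \<eta> f (nq A)" and G = sim_start, OF lin_sim \<open>lin sim_start\<close>])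
  then show ?thesis by (auto simp: lin_def sim_accept_def)
qed

lemma sqn_sim_start:
  assumes "0 < k" "0 < d"
  shows "sqn (joint k d K) (sim_start u) = sqn (copies d K) u"
proof -
  have "sqn (joint k d K) (sim_start u)
      = (\<Sum>w<k. if w = 0 then \<Sum>y\<in>copies d K. \<Sum>x<d. if x = 0 then (cmod (u (y(0 := undefined))))\<^sup>2 else 0 else 0)"
    unfolding sqn_joint sum_regs
  proof (rule sum.cong[OF refl])
    fix w
    have "(cmod (sim_start u (w, y(0 := x))))\<^sup>2
        = (if w = 0 then if x = 0 then (cmod (u (y(0 := undefined))))\<^sup>2 else 0 else 0)" for y and x :: nat
      by (simp add: sim_start_def)
    then show "(\<Sum>y\<in>copies d K. \<Sum>x<d. (cmod (sim_start u (w, y(0 := x))))\<^sup>2)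
      = (if w = 0 then \<Sum>y\<in>copies d K. \<Sum>x<d. if x = 0 then (cmod (u (y(0 := undefined))))\<^sup>2 else 0 else 0)"
      by (cases "w = 0") simp_all
  qed
  also have "\<dots> = (\<Sum>y\<in>copies d K. (cmod (u (y(0 := undefined))))\<^sup>2)"
    using assms by simp
  also have "\<dots> = sqn (copies d K) u"
    unfolding sqn_def
    by (intro sum.cong refl arg_cong[where f = "\<lambda>y. (cmod (u y))\<^sup>2"])
      (auto simp: copies_def PiE_def extensional_def)
  finally show ?thesis .
qed

lemma nrm_sim_accept:
  assumes "valid_alg n m A" "0 < n * m" "sqn {..<n*m} \<eta> = 1"
  shows "nrm (joint (wdim A) (n*m) K) (sim_accept (n*m) K A \<eta> E u) \<le> nrm (copies (n*m) K) u"
proof -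
  have "sqn (joint (wdim A) (n*m) K) (sim_accept (n*m) K A \<eta> E u)
      \<le> sqn (joint (wdim A) (n*m) K) (sim (n*m) K A \<eta> (sim_start u) (nq A))"
    unfolding sqn_def sim_accept_def by (intro sum_mono) auto
  also have "\<dots> = sqn (copies (n*m) K) u"
    using assms by (simp add: sqn_sim sqn_sim_start valid_alg_def)
  finally show ?thesis by (simp add: nrm_def)
qed

text \<open>By \<open>sim_close\<close> the final states are within 2Q/sqrt(K+1) for Q queries.
  Discarding the outcomes outside \<open>E\<close> does not increase the distance, and passing to
  squared norms costs another factor 2.\<close>

theorem query_simulation:
  assumes valid: "valid_alg n m A" and nm: "0 < n * m"
    and \<chi>: "sqn {..<n*m} \<chi> = 1" and \<eta>: "sqn {..<n*m} \<eta> = 1"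
  shows "\<bar>(\<Sum>j \<in> {j. j < wdim A * (n*m) \<and> j \<in> E}.
            (cmod (final_state n m A (House (n*m) \<chi>) (House (n*m) \<eta>) $ j))\<^sup>2)
        - sqn (joint (wdim A) (n*m) K) (sim_accept (n*m) K A \<eta> E (\<lambda>y. \<Prod>l\<in>{1..K}. \<chi> (y l)))\<bar>
     \<le> 4 * real (nq A) / sqrt (real (Suc K))"
proof -
  let ?S = "joint (wdim A) (n*m) K" and ?D = "wdim A * (n*m)"
  let ?s = "final_state n m A (House (n*m) \<chi>) (House (n*m) \<eta>)"
  let ?u = "\<lambda>y. \<Prod>l\<in>{1..K}. \<chi> (y l)"
  define sE where "sE = vec ?D (\<lambda>j. if j \<in> E then ?s $ j else 0)"
  have start: "sim_start ?u p = tens (n*m) K \<chi> (unit_vec ?D 0) p" if "p \<in> ?S" for p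
  proof -
    obtain w z where wz: "p = (w, z)" "w < wdim A" "z \<in> regs (n*m) K"
      using \<open>p \<in> ?S\<close> by (auto simp: joint_def)
    have "w * (n*m) + z 0 < ?D" using wz regs_0 by (intro pair_index_less) auto
    moreover have "(\<Prod>l\<in>{1..K}. \<chi> ((z(0 := undefined)) l)) = (\<Prod>l\<in>{1..K}. \<chi> (z l))"
      by (rule prod.cong) auto
    ultimately show ?thesis
      using nm unfolding wz sim_start_def tens_def
      by (auto simp: unit_vec_def simp del: fun_upd_apply One_nat_def)
  qed
  have sim_eq: "nrm ?S (\<lambda>p. sim (n*m) K A \<eta> (sim_start ?u) (nq A) p
      - sim (n*m) K A \<eta> (tens (n*m) K \<chi> (unit_vec ?D 0)) (nq A) p) = 0"
  proof -
    have "nrm ?S (\<lambda>p. sim_start ?u p - tens (n*m) K \<chi> (unit_vec ?D 0) p) = nrm ?S (\<lambda>p. 0)"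
      by (intro nrm_cong) (simp add: start del: One_nat_def)
    then show ?thesis
      by (simp add: lin_diff[OF lin_sim, symmetric] nrm_def sqn_sim[OF valid \<eta>]) (simp add: sqn_def)
  qed
  have "nrm ?S (\<lambda>p. sim (n*m) K A \<eta> (sim_start ?u) (nq A) p - tens (n*m) K \<chi> ?s p)
      \<le> real (nq A) * (2 / sqrt (real (Suc K)))"
    using sim_close[OF valid nm \<chi> \<eta> order_refl, of K] sim_eq
      nrm_triangle[of ?S "\<lambda>p. sim (n*m) K A \<eta> (sim_start ?u) (nq A) p
      - sim (n*m) K A \<eta> (tens (n*m) K \<chi> (unit_vec ?D 0)) (nq A) p" "\<lambda>p.
      sim (n*m) K A \<eta> (tens (n*m) K \<chi> (unit_vec ?D 0)) (nq A) p - tens (n*m) K \<chi> ?s p"]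
    by (simp add: final_state_def)
  moreover have "nrm ?S (\<lambda>p. tens (n*m) K \<chi> sE p - sim_accept (n*m) K A \<eta> E ?u p)
      \<le> nrm ?S (\<lambda>p. sim (n*m) K A \<eta> (sim_start ?u) (nq A) p - tens (n*m) K \<chi> ?s p)"
    unfolding nrm_L2
  proof (rule L2_set_mono)
    fix p assume "p \<in> ?S"
    then obtain w z where wz: "p = (w, z)" "w < wdim A" "z \<in> regs (n*m) K"
      by (auto simp: joint_def)
    have "w * (n*m) + z 0 < ?D" using wz regs_0 by (intro pair_index_less) auto
    then show "cmod (tens (n*m) K \<chi> sE p - sim_accept (n*m) K A \<eta> E ?u p)
       \<le> cmod (sim (n*m) K A \<eta> (sim_start ?u) (nq A) p - tens (n*m) K \<chi> ?s p)"
      unfolding wz sE_def tens_def sim_accept_def by (simp add: norm_minus_commute)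
  qed simp
  ultimately have close: "nrm ?S (\<lambda>p. tens (n*m) K \<chi> sE p - sim_accept (n*m) K A \<eta> E ?u p)
      \<le> real (nq A) * (2 / sqrt (real (Suc K)))" by simp
  have sE: "sqn ?S (tens (n*m) K \<chi> sE) = (\<Sum>j \<in> {j. j < ?D \<and> j \<in> E}. (cmod (?s $ j))\<^sup>2)"
  proof -
    have "sqn ?S (tens (n*m) K \<chi> sE) = (\<Sum>j<?D. if j \<in> E then (cmod (?s $ j))\<^sup>2 else 0)"
      unfolding tens_sqn[OF \<chi>] unfolding sqn_def sE_def by (intro sum.cong refl) auto
    also have "\<dots> = (\<Sum>j \<in> {..<?D} \<inter> {j. j \<in> E}. (cmod (?s $ j))\<^sup>2)"
      by (simp add: sum.If_cases)
    also have "{..<?D} \<inter> {j. j \<in> E} = {j. j < ?D \<and> j \<in> E}" by auto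
    finally show ?thesis .
  qed
  have "sqn ?S (tens (n*m) K \<chi> sE) \<le> 1"
  proof -
    have "sqn ?S (tens (n*m) K \<chi> sE) \<le> (\<Sum>j<?D. (cmod (?s $ j))\<^sup>2)"
      unfolding sE by (intro sum_mono2) auto
    also have "\<dots> = 1"
      using nrm_alg_state[OF valid nm \<chi> \<eta> order_refl] by (simp add: final_state_def sqn_def)
    finally show ?thesis .
  qed
  moreover have "nrm ?S (sim_accept (n*m) K A \<eta> E ?u) \<le> 1"
    using nrm_sim_accept[OF valid nm \<eta>, of K E ?u]
    by (simp add: nrm_def[of "copies _ _"] sqn_copies_prod \<chi> del: One_nat_def)
  ultimately have "\<bar>sqn ?S (tens (n*m) K \<chi> sE) - sqn ?S (sim_accept (n*m) K A \<eta> E ?u)\<bar>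
      \<le> 2 * nrm ?S (\<lambda>p. tens (n*m) K \<chi> sE p - sim_accept (n*m) K A \<eta> E ?u p)"
    by (intro sqn_diff_le) (simp_all add: nrm_def)
  then show ?thesis using close unfolding sE by simp
qed

section \<open>Orthogonal families, random signs and shifts\<close>

lemma orth_family_sqn:
  assumes "finite I"
    and orth: "\<And>i j. i \<in> I \<Longrightarrow> j \<in> I \<Longrightarrow> ip S (U i) (U j) = (if i = j then complex_of_real (\<beta> i) else 0)"
  shows "sqn S (\<lambda>x. \<Sum>i\<in>I. c i * U i x) = (\<Sum>i\<in>I. \<beta> i * (cmod (c i))\<^sup>2)"
proof -
  have "complex_of_real (sqn S (\<lambda>x. \<Sum>i\<in>I. c i * U i x))
      = (\<Sum>i\<in>I. \<Sum>j\<in>I. cnj (c i) * (c j * ip S (U i) (U j)))"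
    by (simp add: ip_self[symmetric] ip_sum_left ip_sum_right ip_scale_left ip_scale_right)
  also have "\<dots> = (\<Sum>i\<in>I. cnj (c i) * (c i * complex_of_real (\<beta> i)))"
  proof (rule sum.cong[OF refl])
    fix i assume i: "i \<in> I"
    have "(\<Sum>j\<in>I. cnj (c i) * (c j * ip S (U i) (U j)))
        = (\<Sum>j\<in>I. if i = j then cnj (c i) * (c i * complex_of_real (\<beta> i)) else 0)"
      using orth[OF i] by (intro sum.cong refl) auto
    then show "(\<Sum>j\<in>I. cnj (c i) * (c j * ip S (U i) (U j))) = cnj (c i) * (c i * complex_of_real (\<beta> i))"
      using i assms(1) by simp
  qed
  also have "\<dots> = complex_of_real (\<Sum>i\<in>I. \<beta> i * (cmod (c i))\<^sup>2)"
    unfolding of_real_sum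
    by (intro sum.cong refl) (simp add: complex_norm_square mult_ac del: of_real_power)
  finally show ?thesis by (simp only: of_real_eq_iff)
qed

text \<open>The hypothesis on \<open>c\<close> makes the sum the orthogonal projection of
  \<open>f\<close> onto the span of the family, so Pythagoras applies. The family is left
  unnormalised, with squared norms \<open>\<beta> i\<close>.\<close>

lemma orth_family_residual:
  assumes "finite I"
    and orth: "\<And>i j. i \<in> I \<Longrightarrow> j \<in> I \<Longrightarrow> ip S (U i) (U j) = (if i = j then complex_of_real (\<beta> i) else 0)"
    and coef: "\<And>i. i \<in> I \<Longrightarrow> ip S (U i) f = complex_of_real (\<beta> i) * c i"
  shows "sqn S (\<lambda>x. f x - (\<Sum>i\<in>I. c i * U i x)) = sqn S f - (\<Sum>i\<in>I. \<beta> i * (cmod (c i))\<^sup>2)"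
proof -
  let ?p = "\<lambda>x. \<Sum>i\<in>I. c i * U i x"
  let ?s = "complex_of_real (\<Sum>i\<in>I. \<beta> i * (cmod (c i))\<^sup>2)"
  have "ip S ?p f = (\<Sum>i\<in>I. cnj (c i) * (complex_of_real (\<beta> i) * c i))"
    by (simp add: ip_sum_left ip_scale_left coef)
  also have "\<dots> = ?s"
    unfolding of_real_sum
    by (intro sum.cong refl) (simp add: complex_norm_square mult_ac del: of_real_power)
  finally have pf: "ip S ?p f = ?s" .
  have fp: "ip S f ?p = ?s"
    using ip_commute[of S f ?p] pf by (simp only: complex_cnj_complex_of_real)
  have pp: "ip S ?p ?p = ?s"
    unfolding ip_self by (rule arg_cong[where f = complex_of_real], rule orth_family_sqn[OF assms(1)], rule orth)
  have "complex_of_real (sqn S (\<lambda>x. f x - ?p x)) = complex_of_real (sqn S f) - ?s"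
    unfolding sqn_diff_expand pf fp pp unfolding ip_self by simp
  then have "complex_of_real (sqn S (\<lambda>x. f x - ?p x))
      = complex_of_real (sqn S f - (\<Sum>i\<in>I. \<beta> i * (cmod (c i))\<^sup>2))"
    by simp
  then show ?thesis by (simp only: of_real_eq_iff)
qed

text \<open>With a_i = <G U_i, w>, linearity gives sum |a_i|^2 = <G (sum a_i U_i), w>. Contraction
  and Cauchy-Schwarz bound this by sqrt(\<beta> sum |a_i|^2) |w|, and a common factor cancels. The
  images themselves need not be orthogonal.\<close>

lemma orth_family_image_bessel:
  assumes fin: "finite I" and G: "lin G" "\<And>u. nrm T (G u) \<le> nrm S u"
    and orth: "\<And>i j. i \<in> I \<Longrightarrow> j \<in> I \<Longrightarrow> ip S (U i) (U j) = (if i = j then complex_of_real \<beta> else 0)"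
    and \<beta>: "0 \<le> \<beta>"
  shows "(\<Sum>i\<in>I. (cmod (ip T (G (U i)) w))\<^sup>2) \<le> \<beta> * sqn T w"
proof -
  define a where "a i = ip T (G (U i)) w" for i
  define X where "X = (\<Sum>i\<in>I. (cmod (a i))\<^sup>2)"
  have X0: "0 \<le> X" by (simp add: X_def sum_nonneg)
  have "complex_of_real X = (\<Sum>i\<in>I. cnj (a i) * ip T (G (U i)) w)"
    unfolding X_def of_real_sum a_def[symmetric]
    by (intro sum.cong refl) (simp add: complex_norm_square mult.commute del: of_real_power)
  also have "\<dots> = ip T (G (\<lambda>y. \<Sum>i\<in>I. a i * U i y)) w"
    by (simp add: lin_sum[OF G(1)] ip_sum_left ip_scale_left)
  finally have "X = cmod (ip T (G (\<lambda>y. \<Sum>i\<in>I. a i * U i y)) w)"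
    using X0 by (metis abs_of_nonneg norm_of_real)
  also have "\<dots> \<le> nrm T (G (\<lambda>y. \<Sum>i\<in>I. a i * U i y)) * nrm T w"
    by (rule cmod_ip_le)
  also have "\<dots> \<le> nrm S (\<lambda>y. \<Sum>i\<in>I. a i * U i y) * nrm T w"
    by (intro mult_right_mono G nrm_nonneg)
  also have "nrm S (\<lambda>y. \<Sum>i\<in>I. a i * U i y) = sqrt (\<beta> * X)"
    by (simp add: nrm_def orth_family_sqn[OF fin orth] X_def sum_distrib_left)
  finally have "X \<le> sqrt (\<beta> * X * sqn T w)"
    by (simp add: nrm_def real_sqrt_mult)
  then have "X\<^sup>2 \<le> (sqrt (\<beta> * X * sqn T w))\<^sup>2"
    using X0 by (intro power_mono) auto
  then have "X * X \<le> \<beta> * sqn T w * X"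
    using X0 \<beta> by (simp add: sqn_nonneg power2_eq_square algebra_simps)
  then have "X \<le> \<beta> * sqn T w"
    using X0 \<beta> sqn_nonneg[of T w] by (cases "X = 0") auto
  then show ?thesis by (simp add: X_def a_def)
qed

definition signs :: "'a set \<Rightarrow> ('a \<Rightarrow> real) set" where
  "signs B = PiE B (\<lambda>_. {1, -1})"

lemma finite_signs: "finite B \<Longrightarrow> finite (signs B)"
  by (simp add: signs_def finite_PiE)

lemma card_signs: "finite B \<Longrightarrow> card (signs B) = 2 ^ card B"
  by (simp add: signs_def card_PiE numeral_2_eq_2)

text \<open>The products over subsets are the characters of the group of sign vectors; an element in
  exactly one of the two sets contributes the factor 1 - 1.\<close>

lemma signs_orthogonal:
  assumes B: "finite B" and J: "J \<subseteq> B" "J' \<subseteq> B"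
  shows "(\<Sum>g\<in>signs B. (\<Prod>b\<in>J. g b) * (\<Prod>b\<in>J'. g b)) = (if J = J' then 2 ^ card B else 0)"
proof -
  have ext: "(\<Prod>b\<in>J. g b) = (\<Prod>b\<in>B. if b \<in> J then g b else 1)" if "J \<subseteq> B" for J and g :: "'a \<Rightarrow> real"
    using B that by (simp add: prod.If_cases Int_absorb1)
  have "(\<Sum>g\<in>signs B. (\<Prod>b\<in>J. g b) * (\<Prod>b\<in>J'. g b))
      = (\<Sum>g\<in>PiE B (\<lambda>_. {1, -1}). \<Prod>b\<in>B. (if b \<in> J then g b else 1) * (if b \<in> J' then g b else 1))"
    unfolding signs_def prod.distrib by (simp only: ext[OF J(1)] ext[OF J(2)])
  also have "\<dots> = (\<Prod>b\<in>B. \<Sum>x\<in>{1, -1}. (if b \<in> J then x else 1) * (if b \<in> J' then x else 1))"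
    by (rule prod_sum_PiE[symmetric]) (use B in auto)
  also have "\<dots> = (\<Prod>b\<in>B. if b \<in> J \<longleftrightarrow> b \<in> J' then 2 else 0)"
    by (intro prod.cong refl) auto
  also have "\<dots> = (if J = J' then 2 ^ card B else 0)"
  proof (cases "J = J'")
    case False
    then obtain b where "b \<in> B" "\<not> (b \<in> J \<longleftrightarrow> b \<in> J')" using J by blast
    then have "(\<Prod>b\<in>B. if b \<in> J \<longleftrightarrow> b \<in> J' then 2 else 0) = (0::real)"
      using B by (intro prod_zero) auto
    then show ?thesis using False by simp
  qed simp
  finally show ?thesis .
qed

text \<open>Orthogonality of the characters removes all cross terms between different sets. Later
  the sets are the sets of labels shown by the copies.\<close>

lemma sign_average:
  assumes B: "finite B" and J: "\<And>J. J \<in> \<J> \<Longrightarrow> J \<subseteq> B"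
  shows "(\<Sum>g\<in>signs B. sqn S (\<lambda>s. \<Sum>J\<in>\<J>. complex_of_real (\<Prod>b\<in>J. g b) * X J s))
    = 2 ^ card B * (\<Sum>J\<in>\<J>. sqn S (X J))"
proof -
  have fin: "finite \<J>" using B J by (meson finite_subset PowI finite_Pow_iff subsetI)
  have "complex_of_real (\<Sum>g\<in>signs B. sqn S (\<lambda>s. \<Sum>J\<in>\<J>. complex_of_real (\<Prod>b\<in>J. g b) * X J s))
      = (\<Sum>g\<in>signs B. \<Sum>J\<in>\<J>. \<Sum>J'\<in>\<J>. complex_of_real ((\<Prod>b\<in>J. g b) * (\<Prod>b\<in>J'. g b)) * ip S (X J) (X J'))"
    by (simp add: ip_self[symmetric] ip_sum_left ip_sum_right ip_scale_left ip_scale_right mult.assoc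
        del: of_real_prod)
  also have "\<dots> = (\<Sum>J\<in>\<J>. \<Sum>J'\<in>\<J>. complex_of_real (\<Sum>g\<in>signs B. (\<Prod>b\<in>J. g b) * (\<Prod>b\<in>J'. g b)) * ip S (X J) (X J'))"
    unfolding of_real_sum sum_distrib_right
    by (subst sum.swap, rule sum.cong[OF refl], rule sum.swap)
  also have "\<dots> = (\<Sum>J\<in>\<J>. \<Sum>J'\<in>\<J>. if J = J' then 2 ^ card B * ip S (X J) (X J) else 0)"
    by (intro sum.cong refl) (simp add: signs_orthogonal[OF B J J])
  also have "\<dots> = complex_of_real (2 ^ card B * (\<Sum>J\<in>\<J>. sqn S (X J)))"
    using fin by (simp add: ip_self sum_distrib_left)
  finally show ?thesis by (simp only: of_real_eq_iff)
qed

lemma sum_cyclic_shift: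
  fixes f :: "nat \<Rightarrow> 'a :: comm_monoid_add"
  assumes "0 < r"
  shows "(\<Sum>t<r. f ((b + t) mod r)) = (\<Sum>i<r. f i)"
proof -
  have "inj_on (\<lambda>t. (b + t) mod r) {..<r}"
  proof (rule inj_onI)
    fix t t' assume t: "t \<in> {..<r}" "t' \<in> {..<r}" "(b + t) mod r = (b + t') mod r"
    then have "int r dvd (int b + int t) - (int b + int t')"
      by (metis mod_eq_dvd_iff of_nat_add of_nat_mod)
    then have "int r dvd int t - int t'" by simp
    then have "int t mod int r = int t' mod int r" by (simp add: mod_eq_dvd_iff)
    then show "t = t'" using t by simp
  qed
  then have "bij_betw (\<lambda>t. (b + t) mod r) {..<r} {..<r}"
    unfolding bij_betw_def using assms by (intro conjI endo_inj_surj) auto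
  then show ?thesis by (rule sum.reindex_bij_betw)
qed

text \<open>Injectivity of \<open>b div r\<close> on \<open>J\<close> gives each factor a shift of
  its own, so the sum over \<open>u\<close> factorises. A cell with a label yields a complete cyclic
  sum, a cell without one yields \<open>r\<close>.\<close>

lemma shift_average:
  fixes F :: "nat \<Rightarrow> nat \<Rightarrow> real"
  assumes r: "0 < r" and J: "J \<subseteq> {..<L * r}" "inj_on (\<lambda>b. b div r) J"
  shows "(\<Sum>u\<in>PiE {..<L} (\<lambda>_. {..<r}). \<Prod>b\<in>J. F b ((b + u (b div r)) mod r))
    = real r ^ L * (\<Prod>b\<in>J. (\<Sum>i<r. F b i) / real r)"
proof -
  have finJ: "finite J" using J finite_subset by auto
  let ?C = "(\<lambda>b. b div r) ` J"
  \<comment> \<open>\<open>\<beta>\<close> recovers the only label of \<open>J\<close> in a given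
    cell, which turns products over \<open>J\<close> into products over cells.\<close>
  define \<beta> where "\<beta> = inv_into J (\<lambda>b. b div r)"
  have \<beta>: "\<beta> (b div r) = b" if "b \<in> J" for b
    unfolding \<beta>_def using J(2) that by (rule inv_into_f_f)
  have CL: "?C \<subseteq> {..<L}"
    using J(1) r by (auto simp: less_mult_imp_div_less)
  have over: "(\<Prod>b\<in>J. H b) = (\<Prod>c<L. if c \<in> ?C then H (\<beta> c) else 1)" for H :: "nat \<Rightarrow> real"
  proof -
    have "(\<Prod>c<L. if c \<in> ?C then H (\<beta> c) else 1) = (\<Prod>c\<in>?C. H (\<beta> c))"
      using CL by (simp add: prod.If_cases Int_absorb1)
    also have "\<dots> = (\<Prod>b\<in>J. H (\<beta> (b div r)))"
      using J(2) by (simp add: prod.reindex)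
    also have "\<dots> = (\<Prod>b\<in>J. H b)" by (simp add: \<beta>)
    finally show ?thesis ..
  qed
  have "(\<Sum>u\<in>PiE {..<L} (\<lambda>_. {..<r}). \<Prod>b\<in>J. F b ((b + u (b div r)) mod r))
      = (\<Sum>u\<in>PiE {..<L} (\<lambda>_. {..<r}). \<Prod>c<L. if c \<in> ?C then F (\<beta> c) ((\<beta> c + u c) mod r) else 1)"
  proof (rule sum.cong[OF refl])
    fix u
    have "(\<Prod>b\<in>J. F b ((b + u (b div r)) mod r))
        = (\<Prod>c<L. if c \<in> ?C then F (\<beta> c) ((\<beta> c + u (\<beta> c div r)) mod r) else 1)"
      by (rule over)
    also have "\<dots> = (\<Prod>c<L. if c \<in> ?C then F (\<beta> c) ((\<beta> c + u c) mod r) else 1)"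
      by (intro prod.cong refl) (auto simp: \<beta>)
    finally show "(\<Prod>b\<in>J. F b ((b + u (b div r)) mod r))
        = (\<Prod>c<L. if c \<in> ?C then F (\<beta> c) ((\<beta> c + u c) mod r) else 1)" .
  qed
  also have "\<dots> = (\<Prod>c<L. \<Sum>t<r. if c \<in> ?C then F (\<beta> c) ((\<beta> c + t) mod r) else 1)"
    by (rule prod_sum_PiE[symmetric]) auto
  also have "\<dots> = (\<Prod>c<L. real r * (if c \<in> ?C then (\<Sum>i<r. F (\<beta> c) i) / real r else 1))"
    using r by (intro prod.cong refl) (auto simp: sum_cyclic_shift)
  also have "\<dots> = real r ^ L * (\<Prod>b\<in>J. (\<Sum>i<r. F b i) / real r)"
    unfolding over prod.distrib by simp
  finally show ?thesis .
qed

section \<open>The random purification\<close>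

lemma divide_mod_cell: "b < L * r \<Longrightarrow> b div r < (L::nat)"
  by (simp add: less_mult_imp_div_less)

lemma card_cell:
  assumes "0 < r" "c < L"
  shows "card {b. b < L * r \<and> b div r = c} = r"
proof -
  have "{b. b < L * r \<and> b div r = c} = {c * r ..< c * r + r}"
  proof safe
    fix b assume "c = b div r" "b < L * r"
    have "b = b div r * r + b mod r" "b mod r < r" using assms(1) by simp_all
    then show "b \<in> {b div r * r ..< b div r * r + r}"
      unfolding atLeastLessThan_iff by linarith
  next
    fix b assume b: "b \<in> {c * r ..< c * r + r}"
    then show "b div r = c"
      using assms by (intro div_nat_eqI) (auto simp: algebra_simps)
    have "c * r + r \<le> L * r"
      using assms(2) by (metis Suc_leI add.commute mult_Suc mult_le_mono1)
    then show "b < L * r" using b by simp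
  qed
  then show ?thesis by simp
qed

locale purification =
  fixes n m r L K :: nat
  assumes r: "0 < r" and L: "0 < L" and m: "L * r \<le> m" and n: "r < n"
begin

text \<open>Basis index of row \<open>Suc a\<close> of A and label \<open>b\<close> of B. Skipping
  row 0 keeps clear of index 0, which carries the |0> part of \<open>chi\<close>.\<close>

definition emb :: "nat \<Rightarrow> nat \<Rightarrow> nat" where
  "emb a b = Suc a * m + b"

definition pick :: "(nat \<Rightarrow> nat) \<Rightarrow> nat \<Rightarrow> nat" where
  "pick u b = (b + u (b div r)) mod r"

text \<open>The unit vector \<open>(|0> - |\<psi>>)/\<surd>2\<close>, where \<open>\<psi>\<close> is the purification with \<open>g b * v (pick u b)\<close>
  attached to the basis state \<open>b\<close> of \<open>B\<close>.  Within each cell of \<open>r\<close> consecutive labels every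
  \<open>v i\<close> occurs exactly once, so the reduced state does not depend on \<open>g\<close> and \<open>u\<close>.\<close>

definition chi :: "(nat \<Rightarrow> nat \<Rightarrow> real) \<Rightarrow> (nat \<Rightarrow> real) \<Rightarrow> (nat \<Rightarrow> nat) \<Rightarrow> nat \<Rightarrow> real" where
  "chi v g u h = (if h = 0 then 1 / sqrt 2
     else if h div m \<in> {1..r} \<and> h mod m < L * r
       then - (g (h mod m) * v (pick u (h mod m)) (h div m - 1)) / sqrt (2 * real (L * r))
     else 0)"

abbreviation "chi_copies v g u \<equiv> (\<lambda>y. \<Prod>l\<in>{1..K}. complex_of_real (chi v g u (y l)))"

definition unit_family :: "(nat \<Rightarrow> nat \<Rightarrow> real) \<Rightarrow> bool" where
  "unit_family v \<longleftrightarrow> (\<forall>i<r. (\<Sum>a<r. (v i a)\<^sup>2) = 1)"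

lemma m0: "0 < m" using r L m by (metis gr0I le_0_eq nat_0_less_mult_iff less_not_refl)

lemma emb_pos: "0 < emb a b" using m0 by (simp add: emb_def)

lemma emb_div: "b < L * r \<Longrightarrow> emb a b div m = Suc a"
  using m m0 unfolding emb_def by (subst add.commute) (simp del: mult_Suc)

lemma emb_mod: "b < L * r \<Longrightarrow> emb a b mod m = b"
  using m unfolding emb_def by (subst add.commute) (simp del: mult_Suc)

lemma emb_less: "a < r \<Longrightarrow> b < L * r \<Longrightarrow> emb a b < n * m"
  unfolding emb_def using m n by (intro pair_index_less) auto

lemma emb_inj: "emb a b = emb a' b' \<Longrightarrow> b < L * r \<Longrightarrow> b' < L * r \<Longrightarrow> a = a' \<and> b = b'"
  by (metis emb_div emb_mod Suc_inject)

lemma pick_less: "pick u b < r" using r by (simp add: pick_def)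

lemma chi_0 [simp]: "chi v g u 0 = 1 / sqrt 2" by (simp add: chi_def)

lemma chi_emb:
  "a < r \<Longrightarrow> b < L * r \<Longrightarrow> chi v g u (emb a b) = - (g b * v (pick u b) a) / sqrt (2 * real (L * r))"
  using emb_pos[of a b] by (simp add: chi_def emb_div emb_mod)

lemma chi_eq_0:
  assumes "h \<noteq> 0" "\<And>a b. a < r \<Longrightarrow> b < L * r \<Longrightarrow> h \<noteq> emb a b"
  shows "chi v g u h = 0"
proof (rule ccontr)
  assume "chi v g u h \<noteq> 0"
  then have h: "h div m \<in> {1..r}" "h mod m < L * r"
    using assms(1) unfolding chi_def by presburger+
  then obtain a where a: "h div m = Suc a" by (cases "h div m") auto
  then have "h = emb a (h mod m)"
    unfolding emb_def by (metis div_mult_mod_eq)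
  then show False using assms(2)[of a "h mod m"] h a by auto
qed

lemma sum_chi_support:
  fixes F :: "nat \<Rightarrow> real"
  assumes "\<And>h. h \<noteq> 0 \<Longrightarrow> (\<And>a b. a < r \<Longrightarrow> b < L * r \<Longrightarrow> h \<noteq> emb a b) \<Longrightarrow> F h = 0"
  shows "(\<Sum>h<n*m. F h) = F 0 + (\<Sum>a<r. \<Sum>b<L*r. F (emb a b))"
proof -
  let ?E = "(\<lambda>(a, b). emb a b) ` ({..<r} \<times> {..<L*r})"
  have "(\<Sum>h<n*m. F h) = (\<Sum>h\<in>insert 0 ?E. F h)"
  proof (rule sum.mono_neutral_right)
    show "insert 0 ?E \<subseteq> {..<n*m}" using emb_less n m0 by auto
    show "\<forall>h\<in>{..<n*m} - insert 0 ?E. F h = 0"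
    proof
      fix h assume h: "h \<in> {..<n*m} - insert 0 ?E"
      then have "h \<noteq> emb a b" if "a < r" "b < L * r" for a b
        using that by auto
      then show "F h = 0" using h assms by auto
    qed
  qed simp
  also have "\<dots> = F 0 + (\<Sum>h\<in>?E. F h)"
  proof (rule sum.insert)
    show "0 \<notin> ?E"
    proof
      assume "0 \<in> ?E"
      then obtain a b where "emb a b = 0" by force
      then show False using emb_pos[of a b] by simp
    qed
  qed simp
  also have "(\<Sum>h\<in>?E. F h) = (\<Sum>(a, b)\<in>{..<r} \<times> {..<L*r}. F (emb a b))"
    by (subst sum.reindex) (auto simp: inj_on_def case_prod_beta dest: emb_inj)
  also have "\<dots> = (\<Sum>a<r. \<Sum>b<L*r. F (emb a b))"
    by (simp add: sum.cartesian_product)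
  finally show ?thesis .
qed

lemma signs_square: "g \<in> signs B \<Longrightarrow> b \<in> B \<Longrightarrow> (g b)\<^sup>2 = 1"
  by (auto simp: signs_def PiE_def Pi_def power2_eq_1_iff)

lemma sqn_chi:
  assumes v: "unit_family v" and g: "g \<in> signs {..<L*r}"
  shows "sqn {..<n*m} (\<lambda>h. complex_of_real (chi v g u h)) = 1"
proof -
  have "sqn {..<n*m} (\<lambda>h. complex_of_real (chi v g u h)) = (\<Sum>h<n*m. (chi v g u h)\<^sup>2)"
    by (simp add: sqn_def)
  also have "\<dots> = (chi v g u 0)\<^sup>2 + (\<Sum>a<r. \<Sum>b<L*r. (chi v g u (emb a b))\<^sup>2)"
    by (rule sum_chi_support) (simp add: chi_eq_0)
  also have "(\<Sum>a<r. \<Sum>b<L*r. (chi v g u (emb a b))\<^sup>2)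
      = (\<Sum>a<r. \<Sum>b<L*r. (v (pick u b) a)\<^sup>2 / (2 * real (L * r)))"
    using g by (intro sum.cong refl) (simp add: chi_emb power_divide power_mult_distrib signs_square)
  also have "\<dots> = (\<Sum>b<L*r. (\<Sum>a<r. (v (pick u b) a)\<^sup>2) / (2 * real (L * r)))"
    by (subst sum.swap) (simp add: sum_divide_distrib)
  also have "\<dots> = 1 / 2"
    using v r L by (simp add: unit_family_def pick_less)
  finally show ?thesis by (simp add: power_divide)
qed

section \<open>Label patterns of the copies\<close>

text \<open>A pattern records for each copy whether it sits in |0>, written \<open>None\<close>, or
  else which label of B it shows. The index in A is left open and supplied separately by a
  labelling.\<close>

definition pats :: "(nat \<Rightarrow> nat option) set" where
  "pats = PiE {1..K} (\<lambda>_. insert None (Some ` {..<L*r}))"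

definition collide :: "nat \<Rightarrow> nat \<Rightarrow> (nat \<Rightarrow> nat option) \<Rightarrow> bool" where
  "collide l l' q \<longleftrightarrow> (\<exists>b b'. q l = Some b \<and> q l' = Some b' \<and> b div r = b' div r)"

text \<open>Labels in distinct cells see independent signs and shifts; this is what makes the later
  averages factorise.\<close>

definition good :: "(nat \<Rightarrow> nat option) \<Rightarrow> bool" where
  "good q \<longleftrightarrow> (\<forall>l\<in>{1..K}. \<forall>l'\<in>{1..K}. l \<noteq> l' \<longrightarrow> \<not> collide l l' q)"

definition lab :: "(nat \<Rightarrow> nat option) \<Rightarrow> nat set" where
  "lab q = {b. \<exists>l\<in>{1..K}. q l = Some b}"

text \<open>The A-indices are attached to labels rather than to copies. For good patterns this loses
  nothing, since no label occurs twice.\<close>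

definition inst :: "(nat \<Rightarrow> nat option) \<Rightarrow> (nat \<Rightarrow> nat) \<Rightarrow> nat \<Rightarrow> nat" where
  "inst q \<alpha> = restrict (\<lambda>l. case q l of None \<Rightarrow> 0 | Some b \<Rightarrow> emb (\<alpha> b) b) {1..K}"

definition cells :: "nat set set" where
  "cells = {J. J \<subseteq> {..<L*r} \<and> inj_on (\<lambda>b. b div r) J}"

definition pats_on :: "nat set \<Rightarrow> (nat \<Rightarrow> nat option) set" where
  "pats_on J = {q \<in> pats. good q \<and> lab q = J}"

definition labellings :: "nat set \<Rightarrow> (nat \<Rightarrow> nat) set" where
  "labellings J = PiE J (\<lambda>_. {..<r})"

text \<open>For a label set and A-indices, this adds up all placements of the labels on the copies.
  They have equal amplitudes in a product state, so the blocks suffice to expand its good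
  part.\<close>

definition block :: "nat set \<times> (nat \<Rightarrow> nat) \<Rightarrow> (nat \<Rightarrow> nat) \<Rightarrow> complex" where
  "block i y = (\<Sum>q\<in>pats_on (fst i). if y = inst q (snd i) then 1 else 0)"

definition coef :: "nat set \<Rightarrow> real" where
  "coef J = (1 / sqrt 2) ^ K * (- 1 / sqrt (real (L * r))) ^ card J"

definition amp :: "(nat \<Rightarrow> nat \<Rightarrow> real) \<Rightarrow> (nat \<Rightarrow> real) \<Rightarrow> (nat \<Rightarrow> nat) \<Rightarrow> nat set \<times> (nat \<Rightarrow> nat) \<Rightarrow> real" where
  "amp v g u i = coef (fst i) * (\<Prod>b\<in>fst i. g b) * (\<Prod>b\<in>fst i. v (pick u b) (snd i b))"

abbreviation "index_set \<equiv> Sigma cells labellings"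

lemma finite_pats [simp]: "finite pats" by (simp add: pats_def finite_PiE)

lemma finite_pats_on [simp]: "finite (pats_on J)" by (simp add: pats_on_def)

lemma finite_cells [simp]: "finite cells"
  by (rule finite_subset[of _ "Pow {..<L*r}"]) (auto simp: cells_def)

lemma cells_finite: "J \<in> cells \<Longrightarrow> finite J"
  by (auto simp: cells_def intro: finite_subset)

lemma finite_labellings [simp]: "J \<in> cells \<Longrightarrow> finite (labellings J)"
  by (simp add: labellings_def finite_PiE cells_finite)

lemma finite_index_set [simp]: "finite index_set" by auto

lemma lab_less: "q \<in> pats \<Longrightarrow> b \<in> lab q \<Longrightarrow> b < L * r"
  by (force simp: pats_def lab_def PiE_def Pi_def)

lemma good_lab_cells: "q \<in> pats \<Longrightarrow> good q \<Longrightarrow> lab q \<in> cells"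
  unfolding cells_def
proof safe
  fix b assume "q \<in> pats" "b \<in> lab q" then show "b < L * r" by (rule lab_less)
next
  assume "good q"
  show "inj_on (\<lambda>b. b div r) (lab q)"
  proof (rule inj_onI)
    fix b b' assume b: "b \<in> lab q" "b' \<in> lab q" "b div r = b' div r"
    then obtain l l' where l: "l \<in> {1..K}" "l' \<in> {1..K}" "q l = Some b" "q l' = Some b'"
      unfolding lab_def by blast
    then have "collide l l' q" using b by (simp add: collide_def)
    then have "l = l'" using \<open>good q\<close> l unfolding good_def by blast
    then show "b = b'" using l by simp
  qed
qed

lemma inst_mem:
  assumes "q \<in> pats" "\<alpha> \<in> labellings (lab q)"
  shows "inst q \<alpha> \<in> copies (n*m) K"
  unfolding copies_def
proof (rule PiE_I)
  fix l assume l: "l \<in> {1..K}"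
  show "inst q \<alpha> l \<in> {..<n*m}"
  proof (cases "q l")
    case None then show ?thesis using l n m0 by (simp add: inst_def)
  next
    case (Some b)
    then have "b \<in> lab q" using l by (auto simp: lab_def)
    then have "b < L * r" "\<alpha> b < r"
      using assms lab_less by (auto simp: labellings_def)
    then show ?thesis using l Some by (simp add: inst_def emb_less)
  qed
qed (auto simp: inst_def)

text \<open>A copy at index 0 means \<open>None\<close>, because \<open>emb\<close> is positive; at
  any other index, quotient and remainder by \<open>m\<close> recover A-index and label. Hence
  different blocks have disjoint supports.\<close>

lemma inst_inj:
  assumes q: "q \<in> pats_on J" "\<alpha> \<in> labellings J" and q': "q' \<in> pats_on J'" "\<alpha>' \<in> labellings J'"
    and eq: "inst q \<alpha> = inst q' \<alpha>'"
  shows "q = q' \<and> J = J' \<and> \<alpha> = \<alpha>'"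
proof -
  have qp: "q \<in> pats" "q' \<in> pats" and J: "J = lab q" "J' = lab q'" using q q' by (auto simp: pats_on_def)
  have L: "b < L * r" if "l \<in> {1..K}" "q l = Some b \<or> q' l = Some b" for l b
  proof -
    have "b \<in> lab q \<or> b \<in> lab q'" using that by (auto simp: lab_def)
    then show ?thesis using lab_less qp by blast
  qed
  have ql: "q l = q' l \<and> (\<forall>b. q l = Some b \<longrightarrow> \<alpha> b = \<alpha>' b)" if l: "l \<in> {1..K}" for l
  proof -
    have e: "(case q l of None \<Rightarrow> 0 | Some b \<Rightarrow> emb (\<alpha> b) b)
        = (case q' l of None \<Rightarrow> 0 | Some b \<Rightarrow> emb (\<alpha>' b) b)"
      using fun_cong[OF eq, of l] l by (simp add: inst_def)
    show ?thesis
    proof (cases "q l")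
      case None
      then show ?thesis using e emb_pos by (cases "q' l") (auto, metis less_irrefl)
    next
      case (Some b)
      show ?thesis
      proof (cases "q' l")
        case None
        then show ?thesis using e emb_pos[of "\<alpha> b" b] Some by simp
      next
        case (Some b')
        have "emb (\<alpha> b) b = emb (\<alpha>' b') b'" using e \<open>q l = Some b\<close> Some by simp
        moreover have "b < L * r" "b' < L * r" using L[OF l] \<open>q l = Some b\<close> Some by blast+
        ultimately have "\<alpha> b = \<alpha>' b'" "b = b'" using emb_inj by blast+
        then show ?thesis using \<open>q l = Some b\<close> Some by simp
      qed
    qed
  qed
  have "q = q'"
    using qp ql unfolding pats_def by (intro PiE_ext[of q "{1..K}" _ q']) auto
  moreover from this have "J = J'" using J by simp
  moreover have "\<alpha> = \<alpha>'"
  proof (rule PiE_ext[of \<alpha> J _ \<alpha>'])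
    fix b assume "b \<in> J"
    then show "\<alpha> b = \<alpha>' b" using ql J by (auto simp: lab_def)
  qed (use q q' \<open>J = J'\<close> in \<open>auto simp: labellings_def\<close>)
  ultimately show ?thesis by simp
qed

text \<open>In a good pattern the map from labelled copies to labels is injective, so the product
  can be reindexed by labels.\<close>

lemma prod_pattern:
  fixes t :: "nat \<Rightarrow> 'b :: comm_monoid_mult"
  assumes "good q"
  shows "(\<Prod>l\<in>{1..K}. case q l of None \<Rightarrow> 1 | Some b \<Rightarrow> t b) = (\<Prod>b\<in>lab q. t b)"
proof -
  let ?A = "{l\<in>{1..K}. q l \<noteq> None}"
  have "(\<Prod>l\<in>{1..K}. case q l of None \<Rightarrow> 1 | Some b \<Rightarrow> t b) = (\<Prod>l\<in>?A. t (the (q l)))"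
    by (rule prod.mono_neutral_cong_right) auto
  also have "\<dots> = (\<Prod>b\<in>(\<lambda>l. the (q l)) ` ?A. t b)"
  proof (subst prod.reindex)
    show "inj_on (\<lambda>l. the (q l)) ?A"
      using assms unfolding inj_on_def good_def collide_def by (metis (mono_tags, lifting) mem_Collect_eq option.collapse)
  qed (simp add: comp_def)
  also have "(\<lambda>l. the (q l)) ` ?A = lab q"
    unfolding lab_def by force
  finally show ?thesis .
qed

lemma prod_scaled_pattern:
  fixes t :: "nat \<Rightarrow> real"
  assumes "good q"
  shows "(\<Prod>l\<in>{1..K}. case q l of None \<Rightarrow> c | Some b \<Rightarrow> c * t b) = c ^ K * (\<Prod>b\<in>lab q. t b)"
proof -
  have "(\<Prod>l\<in>{1..K}. case q l of None \<Rightarrow> c | Some b \<Rightarrow> c * t b)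
      = (\<Prod>l\<in>{1..K}. c * (case q l of None \<Rightarrow> 1 | Some b \<Rightarrow> t b))"
    by (intro prod.cong refl) (auto split: option.split)
  then show ?thesis by (simp add: prod.distrib prod_pattern[OF assms] del: One_nat_def)
qed

lemma chi_inst:
  assumes q: "q \<in> pats_on J" and \<alpha>: "\<alpha> \<in> labellings J"
  shows "(\<Prod>l\<in>{1..K}. chi v g u (inst q \<alpha> l)) = amp v g u (J, \<alpha>)"
proof -
  have qp: "q \<in> pats" "good q" and J: "J = lab q" using q by (auto simp: pats_on_def)
  define s where "s = - 1 / sqrt (real (L * r))"
  have "(\<Prod>l\<in>{1..K}. chi v g u (inst q \<alpha> l))
      = (\<Prod>l\<in>{1..K}. case q l of None \<Rightarrow> 1 / sqrt 2
          | Some b \<Rightarrow> (1 / sqrt 2) * (s * (g b * v (pick u b) (\<alpha> b))))"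
  proof (rule prod.cong[OF refl])
    fix l assume l: "l \<in> {1..K}"
    show "chi v g u (inst q \<alpha> l) = (case q l of None \<Rightarrow> 1 / sqrt 2
          | Some b \<Rightarrow> (1 / sqrt 2) * (s * (g b * v (pick u b) (\<alpha> b))))"
    proof (cases "q l")
      case None then show ?thesis using l by (simp add: inst_def)
    next
      case (Some b)
      then have "b \<in> lab q" using l by (auto simp: lab_def)
      then have "b < L * r" "\<alpha> b < r"
        using \<alpha> lab_less[OF qp(1)] J by (auto simp: labellings_def)
      then show ?thesis using l Some by (simp add: inst_def chi_emb real_sqrt_mult s_def)
    qed
  qed
  also have "\<dots> = (1 / sqrt 2) ^ K * (\<Prod>b\<in>J. s * (g b * v (pick u b) (\<alpha> b)))"
    unfolding J by (rule prod_scaled_pattern[OF qp(2)])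
  also have "\<dots> = amp v g u (J, \<alpha>)"
  proof -
    have "coef J = (1 / sqrt 2) ^ K * s ^ card J" by (simp only: coef_def s_def)
    then show ?thesis by (simp add: amp_def prod.distrib)
  qed
  finally show ?thesis .
qed

section \<open>Pattern weights and the probability of a collision\<close>

text \<open>The outcome distribution when one copy of \<open>chi\<close> is tested for |0> and
  otherwise for its label: \<open>None\<close> has probability 1/2, the rest is uniform over the
  labels. Products of weights describe \<open>K\<close> independent copies.\<close>

definition weight :: "nat option \<Rightarrow> real" where
  "weight x = (case x of None \<Rightarrow> 1 / 2 | Some b \<Rightarrow> 1 / 2 * (1 / real (L * r)))"

lemma weight_nonneg: "0 \<le> weight x"
  by (simp add: weight_def split: option.split)

lemma weight_pattern:
  assumes "q \<in> pats_on J"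
  shows "(\<Prod>l\<in>{1..K}. weight (q l)) = (coef J)\<^sup>2"
proof -
  have q: "good q" "J = lab q" using assms by (auto simp: pats_on_def)
  have "(coef J)\<^sup>2 = (1 / 2) ^ K * (1 / real (L * r)) ^ card J"
  proof -
    have "(coef J)\<^sup>2 = ((1 / sqrt 2)\<^sup>2) ^ K * ((- 1 / sqrt (real (L * r)))\<^sup>2) ^ card J"
    proof -
      have "(x ^ k)\<^sup>2 = (x\<^sup>2) ^ k" for x :: real and k
        by (simp only: power_mult[symmetric] mult.commute)
      then show ?thesis unfolding coef_def power_mult_distrib by simp
    qed
    then show ?thesis by (simp add: power_divide)
  qed
  then show ?thesis
    unfolding weight_def prod_scaled_pattern[OF q(1)] q(2) by simp
qed

lemma sum_weight_coord:
  "(\<Sum>x\<in>insert None (Some ` {..<L*r}). weight x * f x)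
    = f None / 2 + (\<Sum>b<L*r. f (Some b)) / (2 * real (L * r))"
  by (subst sum.insert) (auto simp: weight_def sum.reindex sum_divide_distrib)

lemma sum_weight: "(\<Sum>x\<in>insert None (Some ` {..<L*r}). weight x) = 1"
  using sum_weight_coord[of "\<lambda>_. 1"] r L by simp

lemma sum_pats_prod:
  fixes F :: "nat \<Rightarrow> nat option \<Rightarrow> real"
  shows "(\<Sum>q\<in>pats. \<Prod>l\<in>{1..K}. F l (q l))
    = (\<Prod>l\<in>{1..K}. \<Sum>x\<in>insert None (Some ` {..<L*r}). F l x)"
  unfolding pats_def by (rule prod_sum_PiE[symmetric]) auto

lemma sum_pats_weight: "(\<Sum>q\<in>pats. \<Prod>l\<in>{1..K}. weight (q l)) = 1"
  unfolding sum_pats_prod[of "\<lambda>_. weight"] by (simp add: sum_weight)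

text \<open>A copy shows a label of a given cell with probability 1/(2L); the squares summed over
  \<open>L\<close> cells give 1/(4L). The indicators \<open>hit c\<close> write the event as a sum
  of products over copies, which factorises.\<close>

lemma collision_weight:
  assumes l: "l \<in> {1..K}" "l' \<in> {1..K}" "l \<noteq> l'"
  shows "(\<Sum>q\<in>pats. if collide l l' q then \<Prod>k\<in>{1..K}. weight (q k) else 0) = 1 / (4 * real L)"
proof -
  define hit where "hit c x = (case x of None \<Rightarrow> 0 | Some b \<Rightarrow> (if b div r = c then 1 else (0 :: real)))"
    for c and x :: "nat option"
  have coord: "(\<Sum>x\<in>insert None (Some ` {..<L*r}). weight x * hit c x) = 1 / (2 * real L)"
    if "c < L" for c
  proof -
    have "(\<Sum>b<L*r. if b div r = c then 1 else (0 :: real)) = real (card {b. b < L * r \<and> b div r = c})"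
      by (simp add: sum.If_cases Int_def)
    then show ?thesis
      unfolding sum_weight_coord using r L that by (simp add: hit_def card_cell)
  qed
  have "(if collide l l' q then \<Prod>k\<in>{1..K}. weight (q k) else 0)
      = (\<Sum>c<L. \<Prod>k\<in>{1..K}. weight (q k) * (if k = l \<or> k = l' then hit c (q k) else 1))"
    if q: "q \<in> pats" for q
  proof -
    have "(\<Prod>k\<in>{1..K}. if k = l \<or> k = l' then hit c (q k) else 1) = hit c (q l) * hit c (q l')" for c
    proof -
      have "(\<Prod>k\<in>{1..K}. if k = l \<or> k = l' then hit c (q k) else 1) = (\<Prod>k\<in>{l, l'}. hit c (q k))"
        using l by (subst prod.mono_neutral_cong_right[where S = "{l, l'}" and h = "\<lambda>k. hit c (q k)"]) auto
      then show ?thesis using l by simp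
    qed
    moreover have "(\<Sum>c<L. hit c (q l) * hit c (q l')) = (if collide l l' q then 1 else 0)"
    proof (cases "q l = None \<or> q l' = None")
      case True
      then show ?thesis by (auto simp: hit_def collide_def)
    next
      case False
      then obtain b b' where b: "q l = Some b" "q l' = Some b'" by auto
      then have "b \<in> lab q" using l(1) unfolding lab_def by blast
      then have "b div r < L" using lab_less[OF q] by (auto intro: divide_mod_cell)
      moreover have "(\<Sum>c<L. hit c (q l) * hit c (q l'))
          = (\<Sum>c<L. if b div r = c then if b' div r = c then 1 else 0 else 0)"
        using b by (intro sum.cong refl) (simp add: hit_def)
      ultimately show ?thesis using b by (auto simp: collide_def)
    qed
    ultimately show ?thesis
      by (simp add: prod.distrib sum_distrib_left[symmetric])
  qed
  then have "(\<Sum>q\<in>pats. if collide l l' q then \<Prod>k\<in>{1..K}. weight (q k) else 0)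
      = (\<Sum>c<L. \<Sum>q\<in>pats. \<Prod>k\<in>{1..K}. weight (q k) * (if k = l \<or> k = l' then hit c (q k) else 1))"
    by (subst sum.swap) simp
  also have "\<dots> = (\<Sum>c<L. (1 / (2 * real L))\<^sup>2)"
  proof (rule sum.cong[OF refl])
    fix c assume c: "c \<in> {..<L}"
    have "(\<Sum>q\<in>pats. \<Prod>k\<in>{1..K}. weight (q k) * (if k = l \<or> k = l' then hit c (q k) else 1))
        = (\<Prod>k\<in>{1..K}. \<Sum>x\<in>insert None (Some ` {..<L*r}). weight x * (if k = l \<or> k = l' then hit c x else 1))"
      by (rule sum_pats_prod)
    also have "\<dots> = (\<Prod>k\<in>{1..K}. if k = l \<or> k = l' then 1 / (2 * real L) else 1)"
    proof (rule prod.cong[OF refl])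
      fix k
      have "c < L" using c by simp
      show "(\<Sum>x\<in>insert None (Some ` {..<L*r}). weight x * (if k = l \<or> k = l' then hit c x else 1))
        = (if k = l \<or> k = l' then 1 / (2 * real L) else 1)"
        by (cases "k = l \<or> k = l'") (simp_all only: coord[OF \<open>c < L\<close>] sum_weight if_True if_False mult_1_right)
    qed
    also have "\<dots> = (\<Prod>k\<in>{l, l'}. 1 / (2 * real L))"
      using l by (intro prod.mono_neutral_cong_right) auto
    also have "\<dots> = (1 / (2 * real L))\<^sup>2" using l by (simp add: power2_eq_square)
    finally show "(\<Sum>q\<in>pats. \<Prod>k\<in>{1..K}. weight (q k) * (if k = l \<or> k = l' then hit c (q k) else 1))
        = (1 / (2 * real L))\<^sup>2" .
  qed
  also have "\<dots> = 1 / (4 * real L)" using L by (simp add: power2_eq_square field_simps)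
  finally show ?thesis .
qed

text \<open>All patterns with label set \<open>J\<close> have the weight
  \<open>(coef J)\<^sup>2\<close>, so the left side is the total weight of the good patterns,
  grouped by label set.\<close>

lemma sum_coef_card:
  "(\<Sum>J\<in>cells. (coef J)\<^sup>2 * real (card (pats_on J))) = (\<Sum>q | q \<in> pats \<and> good q. \<Prod>l\<in>{1..K}. weight (q l))"
proof -
  have "(\<Sum>J\<in>cells. (coef J)\<^sup>2 * real (card (pats_on J)))
      = (\<Sum>J\<in>cells. \<Sum>q\<in>pats_on J. \<Prod>l\<in>{1..K}. weight (q l))"
    by (intro sum.cong refl) (simp add: weight_pattern del: One_nat_def)
  also have "\<dots> = (\<Sum>J\<in>cells. sum (\<lambda>q. \<Prod>l\<in>{1..K}. weight (q l)) {q \<in> {q. q \<in> pats \<and> good q}. lab q = J})"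
    by (intro sum.cong refl) (auto simp: pats_on_def)
  also have "\<dots> = (\<Sum>q | q \<in> pats \<and> good q. \<Prod>l\<in>{1..K}. weight (q l))"
    by (rule sum.group) (auto intro: good_lab_cells)
  finally show ?thesis .
qed

lemma sum_coef_card_le_1: "(\<Sum>J\<in>cells. (coef J)\<^sup>2 * real (card (pats_on J))) \<le> 1"
proof -
  have "(\<Sum>q | q \<in> pats \<and> good q. \<Prod>l\<in>{1..K}. weight (q l)) \<le> (\<Sum>q\<in>pats. \<Prod>l\<in>{1..K}. weight (q l))"
    by (rule sum_mono2) (auto intro: prod_nonneg weight_nonneg)
  also have "\<dots> = 1" by (rule sum_pats_weight)
  finally show ?thesis unfolding sum_coef_card .
qed

text \<open>Union bound over at most K^2 ordered pairs of copies, each colliding with probability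
  1/(4L).\<close>

lemma sum_coef_card_ge: "1 - (real K)\<^sup>2 / (4 * real L) \<le> (\<Sum>J\<in>cells. (coef J)\<^sup>2 * real (card (pats_on J)))"
proof -
  let ?w = "\<lambda>q. \<Prod>l\<in>{1..K}. weight (q l)"
  have w0: "0 \<le> ?w q" for q by (intro prod_nonneg) (simp add: weight_nonneg)
  have "1 = (\<Sum>q\<in>pats. ?w q)" by (rule sum_pats_weight[symmetric])
  also have "\<dots> = (\<Sum>q | q \<in> pats \<and> good q. ?w q) + (\<Sum>q | q \<in> pats \<and> \<not> good q. ?w q)"
    by (subst sum.union_disjoint[symmetric]) (auto intro: sum.cong)
  finally have total: "1 = (\<Sum>q | q \<in> pats \<and> good q. ?w q) + (\<Sum>q | q \<in> pats \<and> \<not> good q. ?w q)" .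
  have "(\<Sum>q | q \<in> pats \<and> \<not> good q. ?w q)
      \<le> (\<Sum>q\<in>pats. \<Sum>l\<in>{1..K}. \<Sum>l'\<in>{1..K}-{l}. if collide l l' q then ?w q else 0)"
  proof -
    have "?w q \<le> (\<Sum>l\<in>{1..K}. \<Sum>l'\<in>{1..K}-{l}. if collide l l' q then ?w q else 0)" if "\<not> good q" for q
    proof -
      obtain l l' where l: "l \<in> {1..K}" "l' \<in> {1..K} - {l}" "collide l l' q"
        using \<open>\<not> good q\<close> unfolding good_def by blast
      have "?w q = (if collide l l' q then ?w q else 0)" using l by simp
      also have "\<dots> \<le> (\<Sum>l'\<in>{1..K}-{l}. if collide l l' q then ?w q else 0)"
        using l(2) w0 by (intro member_le_sum) (auto simp del: One_nat_def)
      also have "\<dots> \<le> (\<Sum>l\<in>{1..K}. \<Sum>l'\<in>{1..K}-{l}. if collide l l' q then ?w q else 0)"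
        using l(1) w0
        by (intro member_le_sum[where f = "\<lambda>l. \<Sum>l'\<in>{1..K}-{l}. if collide l l' q then ?w q else 0"] sum_nonneg)
          (auto simp del: One_nat_def)
      finally show ?thesis .
    qed
    then have "(\<Sum>q | q \<in> pats \<and> \<not> good q. ?w q)
      \<le> (\<Sum>q | q \<in> pats \<and> \<not> good q. \<Sum>l\<in>{1..K}. \<Sum>l'\<in>{1..K}-{l}. if collide l l' q then ?w q else 0)"
      by (intro sum_mono) blast
    also have "\<dots> \<le> (\<Sum>q\<in>pats. \<Sum>l\<in>{1..K}. \<Sum>l'\<in>{1..K}-{l}. if collide l l' q then ?w q else 0)"
      using w0 by (intro sum_mono2 sum_nonneg) (auto simp del: One_nat_def)
    finally show ?thesis .
  qed
  also have "(\<Sum>q\<in>pats. \<Sum>l\<in>{1..K}. \<Sum>l'\<in>{1..K}-{l}. if collide l l' q then ?w q else 0)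
      = (\<Sum>l\<in>{1..K}. \<Sum>q\<in>pats. \<Sum>l'\<in>{1..K}-{l}. if collide l l' q then ?w q else 0)"
    by (rule sum.swap)
  also have "\<dots> = (\<Sum>l\<in>{1..K}. \<Sum>l'\<in>{1..K}-{l}. \<Sum>q\<in>pats. if collide l l' q then ?w q else 0)"
    by (intro sum.cong[OF refl] sum.swap)
  also have "\<dots> = (\<Sum>l\<in>{1..K}. \<Sum>l'\<in>{1..K}-{l}. 1 / (4 * real L))"
    by (intro sum.cong refl collision_weight) auto
  also have "\<dots> \<le> (\<Sum>l\<in>{1..K}. \<Sum>l'\<in>{1..K}. 1 / (4 * real L))"
    by (intro sum_mono sum_mono2) auto
  also have "\<dots> = (real K)\<^sup>2 / (4 * real L)" by (simp add: power2_eq_square)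
  finally show ?thesis using total unfolding sum_coef_card by linarith
qed

section \<open>Truncation of product states to good patterns\<close>

lemma ip_delta:
  assumes "a \<in> S" "finite S"
  shows "ip S (\<lambda>y. if y = a then 1 else 0) f = f a"
proof -
  have "ip S (\<lambda>y. if y = a then 1 else 0) f = (\<Sum>y\<in>S. if y = a then f y else 0)"
    unfolding ip_def by (rule sum.cong) auto
  then show ?thesis using assms by simp
qed

lemma ip_block:
  assumes "i \<in> index_set"
  shows "ip (copies (n*m) K) (block i) f = (\<Sum>q\<in>pats_on (fst i). f (inst q (snd i)))"
proof -
  have "ip (copies (n*m) K) (block i) f
      = (\<Sum>q\<in>pats_on (fst i). ip (copies (n*m) K) (\<lambda>y. if y = inst q (snd i) then 1 else 0) f)"
    unfolding block_def by (rule ip_sum_left)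
  also have "\<dots> = (\<Sum>q\<in>pats_on (fst i). f (inst q (snd i)))"
    using assms by (intro sum.cong refl ip_delta inst_mem) (auto simp: pats_on_def)
  finally show ?thesis .
qed

lemma ip_block_block:
  assumes i: "i \<in> index_set" and j: "j \<in> index_set"
  shows "ip (copies (n*m) K) (block i) (block j)
    = (if i = j then complex_of_real (real (card (pats_on (fst i)))) else 0)"
proof -
  have "block j (inst q (snd i)) = (if i = j then 1 else 0)" if q: "q \<in> pats_on (fst i)" for q
  proof -
    have "block j (inst q (snd i)) = (\<Sum>q'\<in>pats_on (fst j). if i = j then if q = q' then 1 else 0 else 0)"
      unfolding block_def
    proof (rule sum.cong[OF refl])
      fix q' assume "q' \<in> pats_on (fst j)"
      with q i j inst_inj[of q "fst i" "snd i" q' "fst j" "snd j"]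
      show "(if inst q (snd i) = inst q' (snd j) then 1 else 0)
          = (if i = j then if q = q' then 1 else 0 else (0::complex))"
        by (auto simp: prod_eq_iff)
    qed
    then show ?thesis using q by (cases "i = j") simp_all
  qed
  then show ?thesis unfolding ip_block[OF i] by simp
qed

lemma ip_block_chi:
  assumes i: "i \<in> index_set"
  shows "ip (copies (n*m) K) (block i) (chi_copies v g u)
    = complex_of_real (real (card (pats_on (fst i)))) * complex_of_real (amp v g u i)"
proof -
  have "(\<Prod>l\<in>{1..K}. complex_of_real (chi v g u (inst q (snd i) l))) = complex_of_real (amp v g u i)"
    if "q \<in> pats_on (fst i)" for q
  proof -
    have "amp v g u i = (\<Prod>l\<in>{1..K}. chi v g u (inst q (snd i) l))"
      using chi_inst[OF that, of "snd i" v g u] i by auto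
    then show ?thesis by simp
  qed
  then show ?thesis unfolding ip_block[OF i] by simp
qed

text \<open>The part of the product state on good patterns, expanded in fixed vectors so that signs
  and shifts enter through the scalars \<open>amp\<close> alone.\<close>

definition truncated :: "(nat \<Rightarrow> nat \<Rightarrow> real) \<Rightarrow> (nat \<Rightarrow> real) \<Rightarrow> (nat \<Rightarrow> nat) \<Rightarrow> (nat \<Rightarrow> nat) \<Rightarrow> complex" where
  "truncated v g u y = (\<Sum>i\<in>index_set. complex_of_real (amp v g u i) * block i y)"

text \<open>Signs square to one, and the squared entries of the unit vectors \<open>v i\<close> sum
  to one over the A-indices, so only the squared \<open>coef\<close> survives.\<close>

lemma sum_amp_square:
  assumes v: "unit_family v" and g: "g \<in> signs {..<L*r}"
  shows "(\<Sum>i\<in>index_set. real (card (pats_on (fst i))) * (cmod (complex_of_real (amp v g u i)))\<^sup>2)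
    = (\<Sum>J\<in>cells. (coef J)\<^sup>2 * real (card (pats_on J)))"
proof -
  have "(\<Sum>\<alpha>\<in>labellings J. (amp v g u (J, \<alpha>))\<^sup>2) = (coef J)\<^sup>2" if J: "J \<in> cells" for J
  proof -
    have g2: "(\<Prod>b\<in>J. (g b)\<^sup>2) = 1"
      using J by (intro prod.neutral ballI signs_square[OF g]) (auto simp: cells_def)
    have "(\<Sum>\<alpha>\<in>labellings J. (amp v g u (J, \<alpha>))\<^sup>2)
        = (coef J)\<^sup>2 * (\<Sum>\<alpha>\<in>labellings J. \<Prod>b\<in>J. (v (pick u b) (\<alpha> b))\<^sup>2)"
      by (simp add: amp_def power_mult_distrib g2 prod_power_distrib sum_distrib_left)
    also have "(\<Sum>\<alpha>\<in>labellings J. \<Prod>b\<in>J. (v (pick u b) (\<alpha> b))\<^sup>2) = (\<Prod>b\<in>J. \<Sum>a<r. (v (pick u b) a)\<^sup>2)"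
      unfolding labellings_def using J by (intro prod_sum_PiE[symmetric]) (auto simp: cells_finite)
    also have "\<dots> = 1" using v by (simp add: unit_family_def pick_less)
    finally show ?thesis by simp
  qed
  then have "(\<Sum>J\<in>cells. \<Sum>\<alpha>\<in>labellings J. real (card (pats_on J)) * (amp v g u (J, \<alpha>))\<^sup>2)
      = (\<Sum>J\<in>cells. (coef J)\<^sup>2 * real (card (pats_on J)))"
    by (intro sum.cong refl) (simp add: sum_distrib_left[symmetric])
  then show ?thesis by (simp add: sum.Sigma case_prod_beta)
qed

text \<open>The squared residual of the orthogonal expansion is one minus the weight of the good
  patterns, hence the weight of the patterns with a collision.\<close>

lemma truncation_error:
  assumes v: "unit_family v" and g: "g \<in> signs {..<L*r}"
  shows "nrm (copies (n*m) K) (\<lambda>y. chi_copies v g u y - truncated v g u y) \<le> real K / (2 * sqrt (real L))"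
proof -
  have "sqn (copies (n*m) K) (\<lambda>y. chi_copies v g u y - truncated v g u y)
      = sqn (copies (n*m) K) (chi_copies v g u) - (\<Sum>J\<in>cells. (coef J)\<^sup>2 * real (card (pats_on J)))"
    unfolding truncated_def sum_amp_square[OF v g, of u, symmetric]
    by (rule orth_family_residual) (simp_all only: finite_index_set ip_block_block ip_block_chi)
  also have "sqn (copies (n*m) K) (chi_copies v g u) = 1"
    using sqn_copies_prod[of "n*m" K "\<lambda>h. complex_of_real (chi v g u h)"] sqn_chi[OF v g, of u] by simp
  also have "1 - (\<Sum>J\<in>cells. (coef J)\<^sup>2 * real (card (pats_on J))) \<le> (real K)\<^sup>2 / (4 * real L)"
    using sum_coef_card_ge by linarith
  finally have "nrm (copies (n*m) K) (\<lambda>y. chi_copies v g u y - truncated v g u y)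
      \<le> sqrt ((real K)\<^sup>2 / (4 * real L))" by (simp add: nrm_def)
  then show ?thesis by (simp add: real_sqrt_divide real_sqrt_mult)
qed

lemma nrm_truncated:
  assumes v: "unit_family v" and g: "g \<in> signs {..<L*r}"
  shows "nrm (copies (n*m) K) (truncated v g u) \<le> 1"
proof -
  have "sqn (copies (n*m) K) (truncated v g u)
      = (\<Sum>i\<in>index_set. real (card (pats_on (fst i))) * (cmod (complex_of_real (amp v g u i)))\<^sup>2)"
    unfolding truncated_def[abs_def]
    by (rule orth_family_sqn) (simp_all only: finite_index_set ip_block_block)
  also have "\<dots> \<le> 1" unfolding sum_amp_square[OF v g] by (rule sum_coef_card_le_1)
  finally show ?thesis by (simp add: nrm_def)
qed

lemma sqn_truncation_error:
  assumes G: "lin G" "\<And>f. nrm T (G f) \<le> nrm (copies (n*m) K) f"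
    and v: "unit_family v" and g: "g \<in> signs {..<L*r}"
  shows "\<bar>sqn T (G (chi_copies v g u)) - sqn T (G (truncated v g u))\<bar> \<le> real K / sqrt (real L)"
proof -
  have "nrm (copies (n*m) K) (chi_copies v g u) \<le> 1"
    using sqn_copies_prod[of "n*m" K "\<lambda>h. complex_of_real (chi v g u h)"] sqn_chi[OF v g, of u]
    by (simp add: nrm_def)
  then have "\<bar>sqn T (G (chi_copies v g u)) - sqn T (G (truncated v g u))\<bar>
      \<le> 2 * nrm T (\<lambda>s. G (chi_copies v g u) s - G (truncated v g u) s)"
    using G(2) nrm_truncated[OF v g, of u] by (intro sqn_diff_le) (meson order_trans)+
  also have "\<dots> \<le> 2 * nrm (copies (n*m) K) (\<lambda>y. chi_copies v g u y - truncated v g u y)"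
    using G(2)[of "\<lambda>y. chi_copies v g u y - truncated v g u y"] by (simp add: lin_diff[OF G(1)] del: One_nat_def)
  also have "\<dots> \<le> 2 * (real K / (2 * sqrt (real L)))"
    by (intro mult_left_mono truncation_error v g) simp
  finally show ?thesis by simp
qed

section \<open>Averaging over signs and shifts\<close>

abbreviation "shifts \<equiv> PiE {..<L} (\<lambda>_. {..<r})"

definition Avg :: "((nat \<Rightarrow> real) \<Rightarrow> (nat \<Rightarrow> nat) \<Rightarrow> real) \<Rightarrow> real" where
  "Avg f = (\<Sum>g\<in>signs {..<L*r}. \<Sum>u\<in>shifts. f g u) / (2 ^ (L * r) * real r ^ L)"

definition rho :: "(nat \<Rightarrow> nat \<Rightarrow> real) \<Rightarrow> nat \<Rightarrow> nat \<Rightarrow> real" where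
  "rho v a a' = (\<Sum>i<r. v i a * v i a') / real r"

lemma card_shifts: "card shifts = r ^ L"
  by (simp add: card_PiE)

lemma Avg_const: "Avg (\<lambda>g u. c) = c"
  using r by (simp add: Avg_def card_signs card_shifts)

lemma Avg_mono:
  assumes "\<And>g u. g \<in> signs {..<L*r} \<Longrightarrow> f g u \<le> f' g u"
  shows "Avg f \<le> Avg f'"
  unfolding Avg_def using assms by (intro divide_right_mono sum_mono) auto

lemma Avg_diff: "Avg (\<lambda>g u. f g u - f' g u) = Avg f - Avg f'"
  by (simp add: Avg_def sum_subtractf diff_divide_distrib)

lemma Avg_close:
  assumes "\<And>g u. g \<in> signs {..<L*r} \<Longrightarrow> \<bar>f g u - f' g u\<bar> \<le> c"
  shows "\<bar>Avg f - Avg f'\<bar> \<le> c"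
proof -
  have b: "f g u - f' g u \<le> c" "- c \<le> f g u - f' g u" if "g \<in> signs {..<L*r}" for g u
    using assms[OF that, of u] by linarith+
  have "Avg (\<lambda>g u. f g u - f' g u) \<le> Avg (\<lambda>g u. c)" "Avg (\<lambda>g u. - c) \<le> Avg (\<lambda>g u. f g u - f' g u)"
    by (rule Avg_mono, rule b, assumption)+
  then show ?thesis unfolding Avg_diff Avg_const by (simp add: abs_le_iff)
qed

text \<open>The signs separate the label sets. For a fixed set the shifts, one for each cell,
  replace every product of two entries of a \<open>v i\<close> by its mean over \<open>i\<close>, an
  entry of \<open>rho v\<close>. The average thus depends on the ensemble only through tensor powers
  of its density matrix.\<close>

lemma Avg_truncated:
  assumes G: "lin G"
  shows "Avg (\<lambda>g u. sqn T (G (truncated v g u)))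
    = (\<Sum>J\<in>cells. (coef J)\<^sup>2 * (\<Sum>\<alpha>\<in>labellings J. \<Sum>\<alpha>'\<in>labellings J.
        Re (ip T (G (block (J, \<alpha>))) (G (block (J, \<alpha>')))) * (\<Prod>b\<in>J. rho v (\<alpha> b) (\<alpha>' b))))"
proof -
  define V where "V u J \<alpha> = (\<Prod>b\<in>J. v (pick u b) (\<alpha> b))" for u J and \<alpha> :: "nat \<Rightarrow> nat"
  define X where "X u J s = (\<Sum>\<alpha>\<in>labellings J. complex_of_real (coef J * V u J \<alpha>) * G (block (J, \<alpha>)) s)"
    for u J s
  have expand: "G (truncated v g u) = (\<lambda>s. \<Sum>J\<in>cells. complex_of_real (\<Prod>b\<in>J. g b) * X u J s)" for g u
  proof -
    have "G (truncated v g u) = (\<lambda>s. \<Sum>i\<in>index_set. complex_of_real (amp v g u i) * G (block i) s)"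
      unfolding truncated_def[abs_def] by (rule lin_sum[OF G])
    also have "\<dots> = (\<lambda>s. \<Sum>J\<in>cells. \<Sum>\<alpha>\<in>labellings J. complex_of_real (amp v g u (J, \<alpha>)) * G (block (J, \<alpha>)) s)"
      by (simp add: sum.Sigma case_prod_beta)
    also have "\<dots> = (\<lambda>s. \<Sum>J\<in>cells. complex_of_real (\<Prod>b\<in>J. g b) * X u J s)"
      unfolding X_def V_def amp_def by (simp add: sum_distrib_left mult_ac)
    finally show ?thesis .
  qed
  have sqnX: "sqn T (X u J) = (coef J)\<^sup>2 * (\<Sum>\<alpha>\<in>labellings J. \<Sum>\<alpha>'\<in>labellings J.
        Re (ip T (G (block (J, \<alpha>))) (G (block (J, \<alpha>')))) * (V u J \<alpha> * V u J \<alpha>'))" for u J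
  proof -
    have "complex_of_real (sqn T (X u J)) = (\<Sum>\<alpha>\<in>labellings J. \<Sum>\<alpha>'\<in>labellings J.
        complex_of_real ((coef J)\<^sup>2 * (V u J \<alpha> * V u J \<alpha>')) * ip T (G (block (J, \<alpha>))) (G (block (J, \<alpha>'))))"
      unfolding ip_self[symmetric] X_def
      by (simp add: ip_sum_left ip_sum_right ip_scale_left ip_scale_right power2_eq_square mult_ac)
    then have "sqn T (X u J) = Re (\<Sum>\<alpha>\<in>labellings J. \<Sum>\<alpha>'\<in>labellings J.
        complex_of_real ((coef J)\<^sup>2 * (V u J \<alpha> * V u J \<alpha>')) * ip T (G (block (J, \<alpha>))) (G (block (J, \<alpha>'))))"
      by (metis Re_complex_of_real)
    then show ?thesis by (simp add: sum_distrib_left mult_ac)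
  qed
  have shift: "(\<Sum>u\<in>shifts. V u J \<alpha> * V u J \<alpha>') = real r ^ L * (\<Prod>b\<in>J. rho v (\<alpha> b) (\<alpha>' b))"
    if "J \<in> cells" for J \<alpha> \<alpha>'
    using shift_average[OF r, of J L "\<lambda>b i. v i (\<alpha> b) * v i (\<alpha>' b)"] that
    unfolding V_def rho_def pick_def prod.distrib[symmetric] by (simp add: cells_def)
  have "(\<Sum>g\<in>signs {..<L*r}. \<Sum>u\<in>shifts. sqn T (G (truncated v g u)))
      = (\<Sum>u\<in>shifts. \<Sum>g\<in>signs {..<L*r}. sqn T (\<lambda>s. \<Sum>J\<in>cells. complex_of_real (\<Prod>b\<in>J. g b) * X u J s))"
    unfolding expand by (rule sum.swap)
  also have "\<dots> = (\<Sum>u\<in>shifts. 2 ^ (L * r) * (\<Sum>J\<in>cells. sqn T (X u J)))"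
    by (intro sum.cong refl) (subst sign_average, auto simp: cells_def)
  also have "\<dots> = 2 ^ (L * r) * (\<Sum>J\<in>cells. \<Sum>u\<in>shifts. sqn T (X u J))"
    by (subst sum.swap) (simp add: sum_distrib_left)
  also have "(\<Sum>J\<in>cells. \<Sum>u\<in>shifts. sqn T (X u J)) = (\<Sum>J\<in>cells. (coef J)\<^sup>2 * (\<Sum>\<alpha>\<in>labellings J. \<Sum>\<alpha>'\<in>labellings J.
        Re (ip T (G (block (J, \<alpha>))) (G (block (J, \<alpha>')))) * (\<Sum>u\<in>shifts. V u J \<alpha> * V u J \<alpha>')))"
  proof (rule sum.cong[OF refl])
    fix J
    let ?I = "\<lambda>\<alpha> \<alpha>'. Re (ip T (G (block (J, \<alpha>))) (G (block (J, \<alpha>'))))"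
    have "(\<Sum>u\<in>shifts. sqn T (X u J)) = (coef J)\<^sup>2 * (\<Sum>u\<in>shifts. \<Sum>\<alpha>\<in>labellings J. \<Sum>\<alpha>'\<in>labellings J.
        ?I \<alpha> \<alpha>' * (V u J \<alpha> * V u J \<alpha>'))"
      by (simp add: sqnX sum_distrib_left)
    also have "(\<Sum>u\<in>shifts. \<Sum>\<alpha>\<in>labellings J. \<Sum>\<alpha>'\<in>labellings J. ?I \<alpha> \<alpha>' * (V u J \<alpha> * V u J \<alpha>'))
        = (\<Sum>\<alpha>\<in>labellings J. \<Sum>u\<in>shifts. \<Sum>\<alpha>'\<in>labellings J. ?I \<alpha> \<alpha>' * (V u J \<alpha> * V u J \<alpha>'))"
      by (rule sum.swap)
    also have "\<dots> = (\<Sum>\<alpha>\<in>labellings J. \<Sum>\<alpha>'\<in>labellings J. \<Sum>u\<in>shifts. ?I \<alpha> \<alpha>' * (V u J \<alpha> * V u J \<alpha>'))"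
      by (intro sum.cong[OF refl] sum.swap)
    finally show "(\<Sum>u\<in>shifts. sqn T (X u J)) = (coef J)\<^sup>2 * (\<Sum>\<alpha>\<in>labellings J. \<Sum>\<alpha>'\<in>labellings J.
        ?I \<alpha> \<alpha>' * (\<Sum>u\<in>shifts. V u J \<alpha> * V u J \<alpha>'))"
      by (simp add: sum_distrib_left)
  qed
  also have "\<dots> = (\<Sum>J\<in>cells. (coef J)\<^sup>2 * (\<Sum>\<alpha>\<in>labellings J. \<Sum>\<alpha>'\<in>labellings J.
        Re (ip T (G (block (J, \<alpha>))) (G (block (J, \<alpha>')))) * (real r ^ L * (\<Prod>b\<in>J. rho v (\<alpha> b) (\<alpha>' b)))))"
    by (intro sum.cong refl) (simp add: shift)
  also have "\<dots> = real r ^ L * (\<Sum>J\<in>cells. (coef J)\<^sup>2 * (\<Sum>\<alpha>\<in>labellings J. \<Sum>\<alpha>'\<in>labellings J.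
        Re (ip T (G (block (J, \<alpha>))) (G (block (J, \<alpha>')))) * (\<Prod>b\<in>J. rho v (\<alpha> b) (\<alpha>' b))))"
    by (simp add: sum_distrib_left mult_ac)
  finally show ?thesis using r by (simp add: Avg_def)
qed

lemma card_lab_le: "card (lab q) \<le> K"
proof -
  have "lab q \<subseteq> (\<lambda>l. the (q l)) ` {1..K}" unfolding lab_def by force
  then have "card (lab q) \<le> card ((\<lambda>l. the (q l)) ` {1..K})" by (intro card_mono) auto
  also have "\<dots> \<le> card {1..K}" by (rule card_image_le) simp
  finally show ?thesis by simp
qed

text \<open>Cauchy-Schwarz over pairs of labellings. By Bessel each column of the matrix of inner
  products has squared norm at most c^2, with c the number of patterns on \<open>J\<close>, and
  there are r^|J| columns. That factor reappears in the hypothesis on \<open>\<kappa>\<close>, which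
  is a chi-square distance relative to the maximally mixed state.\<close>

lemma block_bilinear_bound:
  assumes G: "lin G" "\<And>f. nrm T (G f) \<le> nrm (copies (n*m) K) f" and J: "J \<in> cells"
    and \<kappa>: "0 \<le> \<kappa>" "card J \<le> K \<Longrightarrow>
      real r ^ card J * (\<Sum>\<alpha>\<in>labellings J. \<Sum>\<alpha>'\<in>labellings J. (\<delta> \<alpha> \<alpha>')\<^sup>2) \<le> \<kappa>\<^sup>2"
  shows "\<bar>\<Sum>\<alpha>\<in>labellings J. \<Sum>\<alpha>'\<in>labellings J.
      Re (ip T (G (block (J, \<alpha>))) (G (block (J, \<alpha>')))) * \<delta> \<alpha> \<alpha>'\<bar> \<le> real (card (pats_on J)) * \<kappa>"
proof -
  let ?I = "\<lambda>\<alpha> \<alpha>'. ip T (G (block (J, \<alpha>))) (G (block (J, \<alpha>')))"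
  let ?A = "labellings J \<times> labellings J" and ?c = "real (card (pats_on J))"
  have norm_block: "sqn (copies (n*m) K) (block (J, \<alpha>)) = ?c" if "\<alpha> \<in> labellings J" for \<alpha>
  proof -
    have "complex_of_real (sqn (copies (n*m) K) (block (J, \<alpha>))) = complex_of_real ?c"
      unfolding ip_self[symmetric] using that J by (simp add: ip_block_block)
    then show ?thesis by (simp only: of_real_eq_iff)
  qed
  have row: "(\<Sum>\<alpha>\<in>labellings J. (cmod (?I \<alpha> \<alpha>'))\<^sup>2) \<le> ?c\<^sup>2" if "\<alpha>' \<in> labellings J" for \<alpha>'
  proof -
    have "(\<Sum>\<alpha>\<in>labellings J. (cmod (?I \<alpha> \<alpha>'))\<^sup>2) \<le> ?c * sqn T (G (block (J, \<alpha>')))"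
    proof (rule orth_family_image_bessel[OF _ G])
      show "ip (copies (n*m) K) (block (J, \<alpha>)) (block (J, \<beta>)) = (if \<alpha> = \<beta> then complex_of_real ?c else 0)"
        if "\<alpha> \<in> labellings J" "\<beta> \<in> labellings J" for \<alpha> \<beta>
        using that J by (simp add: ip_block_block)
    qed (use J in auto)
    also have "sqn T (G (block (J, \<alpha>'))) \<le> sqn (copies (n*m) K) (block (J, \<alpha>'))"
      using G(2)[of "block (J, \<alpha>')"] by (simp add: nrm_def)
    finally show ?thesis
      using norm_block[OF that] by (simp add: power2_eq_square mult_left_mono)
  qed
  have "(\<Sum>\<alpha>\<in>labellings J. \<Sum>\<alpha>'\<in>labellings J. (cmod (?I \<alpha> \<alpha>'))\<^sup>2) \<le> real (card (labellings J)) * ?c\<^sup>2"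
    using sum_bounded_above[of "labellings J" "\<lambda>\<alpha>'. \<Sum>\<alpha>\<in>labellings J. (cmod (?I \<alpha> \<alpha>'))\<^sup>2", OF row]
    by (subst sum.swap) simp
  also have "card (labellings J) = r ^ card J"
    using J by (simp add: labellings_def card_PiE cells_finite)
  finally have I2: "(\<Sum>p\<in>?A. (cmod (?I (fst p) (snd p)))\<^sup>2) \<le> real r ^ card J * ?c\<^sup>2"
    by (simp add: sum.cartesian_product case_prod_beta)
  have "\<bar>\<Sum>\<alpha>\<in>labellings J. \<Sum>\<alpha>'\<in>labellings J. Re (?I \<alpha> \<alpha>') * \<delta> \<alpha> \<alpha>'\<bar>
      = \<bar>\<Sum>p\<in>?A. Re (?I (fst p) (snd p)) * \<delta> (fst p) (snd p)\<bar>"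
    by (simp add: sum.cartesian_product case_prod_beta)
  also have "\<dots> \<le> (\<Sum>p\<in>?A. \<bar>cmod (?I (fst p) (snd p))\<bar> * \<bar>\<delta> (fst p) (snd p)\<bar>)"
    by (rule order_trans[OF sum_abs])
      (intro sum_mono, simp add: abs_mult abs_Re_le_cmod mult_right_mono)
  also have "\<dots> \<le> L2_set (\<lambda>p. cmod (?I (fst p) (snd p))) ?A * L2_set (\<lambda>p. \<delta> (fst p) (snd p)) ?A"
    by (rule L2_set_mult_ineq)
  also have "\<dots> \<le> sqrt (real r ^ card J * ?c\<^sup>2) * L2_set (\<lambda>p. \<delta> (fst p) (snd p)) ?A"
    using I2 by (intro mult_right_mono L2_set_nonneg) (simp add: L2_set_def)
  also have "\<dots> = ?c * sqrt (real r ^ card J * (\<Sum>\<alpha>\<in>labellings J. \<Sum>\<alpha>'\<in>labellings J. (\<delta> \<alpha> \<alpha>')\<^sup>2))"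
    by (simp add: L2_set_def real_sqrt_mult sum.cartesian_product case_prod_beta)
  also have "\<dots> \<le> ?c * \<kappa>"
  proof (cases "card J \<le> K")
    case True
    then have "sqrt (real r ^ card J * (\<Sum>\<alpha>\<in>labellings J. \<Sum>\<alpha>'\<in>labellings J. (\<delta> \<alpha> \<alpha>')\<^sup>2)) \<le> \<kappa>"
      using \<kappa> by (intro real_le_lsqrt) (auto intro!: mult_nonneg_nonneg sum_nonneg)
    then show ?thesis by (intro mult_left_mono) auto
  next
    \<comment> \<open>More labels than copies: no pattern has label set \<open>J\<close>, and both
      sides vanish.\<close>
    case False
    then have "pats_on J = {}" using card_lab_le by (auto simp: pats_on_def)
    then show ?thesis by simp
  qed
  finally show ?thesis .
qed

text \<open>Each label set contributes at most its total pattern weight times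
  \<open>\<kappa>\<close>, and these weights sum to at most 1. The truncation error is paid twice,
  for the ensemble and for \<open>v0\<close>.\<close>

theorem ensemble_indistinguishable:
  assumes G: "lin G" "\<And>f. nrm T (G f) \<le> nrm (copies (n*m) K) f"
    and \<Omega>: "finite \<Omega>" "\<Omega> \<noteq> {}"
    and v: "\<And>\<omega>. \<omega> \<in> \<Omega> \<Longrightarrow> unit_family (v \<omega>)" and v0: "unit_family v0"
    and \<kappa>: "0 \<le> \<kappa>" "\<And>J. J \<in> cells \<Longrightarrow> card J \<le> K \<Longrightarrow>
      real r ^ card J * (\<Sum>\<alpha>\<in>labellings J. \<Sum>\<alpha>'\<in>labellings J.
        ((\<Sum>\<omega>\<in>\<Omega>. \<Prod>b\<in>J. rho (v \<omega>) (\<alpha> b) (\<alpha>' b)) / real (card \<Omega>)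
          - (\<Prod>b\<in>J. rho v0 (\<alpha> b) (\<alpha>' b)))\<^sup>2) \<le> \<kappa>\<^sup>2"
  shows "\<bar>(\<Sum>\<omega>\<in>\<Omega>. Avg (\<lambda>g u. sqn T (G (chi_copies (v \<omega>) g u)))) / real (card \<Omega>)
      - Avg (\<lambda>g u. sqn T (G (chi_copies v0 g u)))\<bar> \<le> \<kappa> + 2 * (real K / sqrt (real L))"
proof -
  let ?e = "real K / sqrt (real L)" and ?N = "real (card \<Omega>)"
  let ?t = "\<lambda>v. Avg (\<lambda>g u. sqn T (G (truncated v g u)))"
  let ?c = "\<lambda>v. Avg (\<lambda>g u. sqn T (G (chi_copies v g u)))"
  let ?I = "\<lambda>J \<alpha> \<alpha>'. Re (ip T (G (block (J, \<alpha>))) (G (block (J, \<alpha>'))))"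
  let ?\<delta> = "\<lambda>J \<alpha> \<alpha>'. (\<Sum>\<omega>\<in>\<Omega>. \<Prod>b\<in>J. rho (v \<omega>) (\<alpha> b) (\<alpha>' b)) / ?N - (\<Prod>b\<in>J. rho v0 (\<alpha> b) (\<alpha>' b))"
  have N: "?N > 0" using \<Omega> by (simp add: card_gt_0_iff)
  have tc: "\<bar>?c w - ?t w\<bar> \<le> ?e" if "unit_family w" for w
    by (rule Avg_close) (rule sqn_truncation_error[OF G that])
  have "(\<Sum>\<omega>\<in>\<Omega>. ?t (v \<omega>)) = (\<Sum>J\<in>cells. (coef J)\<^sup>2 * (\<Sum>\<alpha>\<in>labellings J. \<Sum>\<alpha>'\<in>labellings J.
      ?I J \<alpha> \<alpha>' * (\<Sum>\<omega>\<in>\<Omega>. \<Prod>b\<in>J. rho (v \<omega>) (\<alpha> b) (\<alpha>' b))))"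
  proof -
    have "(\<Sum>\<omega>\<in>\<Omega>. ?t (v \<omega>)) = (\<Sum>J\<in>cells. \<Sum>\<omega>\<in>\<Omega>. (coef J)\<^sup>2 * (\<Sum>\<alpha>\<in>labellings J. \<Sum>\<alpha>'\<in>labellings J.
      ?I J \<alpha> \<alpha>' * (\<Prod>b\<in>J. rho (v \<omega>) (\<alpha> b) (\<alpha>' b))))"
      unfolding Avg_truncated[OF G(1)] by (rule sum.swap)
    also have "\<dots> = (\<Sum>J\<in>cells. (coef J)\<^sup>2 * (\<Sum>\<alpha>\<in>labellings J. \<Sum>\<omega>\<in>\<Omega>. \<Sum>\<alpha>'\<in>labellings J.
      ?I J \<alpha> \<alpha>' * (\<Prod>b\<in>J. rho (v \<omega>) (\<alpha> b) (\<alpha>' b))))"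
      unfolding sum_distrib_left[symmetric]
      by (intro sum.cong[OF refl] arg_cong2[where f = times] refl sum.swap)
    also have "\<dots> = (\<Sum>J\<in>cells. (coef J)\<^sup>2 * (\<Sum>\<alpha>\<in>labellings J. \<Sum>\<alpha>'\<in>labellings J. \<Sum>\<omega>\<in>\<Omega>.
      ?I J \<alpha> \<alpha>' * (\<Prod>b\<in>J. rho (v \<omega>) (\<alpha> b) (\<alpha>' b))))"
      by (intro sum.cong[OF refl] arg_cong2[where f = times] refl sum.swap)
    finally show ?thesis by (simp only: sum_distrib_left)
  qed
  then have "(\<Sum>\<omega>\<in>\<Omega>. ?t (v \<omega>)) / ?N - ?t v0
      = (\<Sum>J\<in>cells. (coef J)\<^sup>2 * (\<Sum>\<alpha>\<in>labellings J. \<Sum>\<alpha>'\<in>labellings J. ?I J \<alpha> \<alpha>' * ?\<delta> J \<alpha> \<alpha>'))"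
    unfolding Avg_truncated[OF G(1)]
    by (simp add: sum_divide_distrib right_diff_distrib sum_subtractf sum_distrib_left)
  then have "\<bar>(\<Sum>\<omega>\<in>\<Omega>. ?t (v \<omega>)) / ?N - ?t v0\<bar>
      \<le> (\<Sum>J\<in>cells. \<bar>(coef J)\<^sup>2 * (\<Sum>\<alpha>\<in>labellings J. \<Sum>\<alpha>'\<in>labellings J. ?I J \<alpha> \<alpha>' * ?\<delta> J \<alpha> \<alpha>')\<bar>)"
    by (simp only: sum_abs)
  also have "\<dots> \<le> (\<Sum>J\<in>cells. (coef J)\<^sup>2 * (real (card (pats_on J)) * \<kappa>))"
  proof (rule sum_mono)
    fix J assume J: "J \<in> cells"
    have "\<bar>\<Sum>\<alpha>\<in>labellings J. \<Sum>\<alpha>'\<in>labellings J. ?I J \<alpha> \<alpha>' * ?\<delta> J \<alpha> \<alpha>'\<bar> \<le> real (card (pats_on J)) * \<kappa>"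
      by (rule block_bilinear_bound[OF G J \<kappa>(1) \<kappa>(2)[OF J]])
    then show "\<bar>(coef J)\<^sup>2 * (\<Sum>\<alpha>\<in>labellings J. \<Sum>\<alpha>'\<in>labellings J. ?I J \<alpha> \<alpha>' * ?\<delta> J \<alpha> \<alpha>')\<bar>
        \<le> (coef J)\<^sup>2 * (real (card (pats_on J)) * \<kappa>)"
      by (simp only: abs_mult abs_power2) (rule mult_left_mono, auto)
  qed
  also have "\<dots> = (\<Sum>J\<in>cells. (coef J)\<^sup>2 * real (card (pats_on J))) * \<kappa>"
    by (simp add: sum_distrib_right mult.assoc)
  also have "\<dots> \<le> 1 * \<kappa>"
    by (intro mult_right_mono sum_coef_card_le_1 \<kappa>)
  finally have main: "\<bar>(\<Sum>\<omega>\<in>\<Omega>. ?t (v \<omega>)) / ?N - ?t v0\<bar> \<le> \<kappa>" by simp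
  have "\<bar>(\<Sum>\<omega>\<in>\<Omega>. ?c (v \<omega>)) / ?N - (\<Sum>\<omega>\<in>\<Omega>. ?t (v \<omega>)) / ?N\<bar> \<le> ?e"
  proof -
    have "\<bar>(\<Sum>\<omega>\<in>\<Omega>. ?c (v \<omega>)) - (\<Sum>\<omega>\<in>\<Omega>. ?t (v \<omega>))\<bar> \<le> (\<Sum>\<omega>\<in>\<Omega>. \<bar>?c (v \<omega>) - ?t (v \<omega>)\<bar>)"
      unfolding sum_subtractf[symmetric] by (rule sum_abs)
    also have "\<dots> \<le> ?N * ?e"
      using tc v by (intro sum_bounded_above) auto
    finally show ?thesis
      using N by (simp add: diff_divide_distrib[symmetric] abs_divide pos_divide_le_eq mult.commute)
  qed
  then show ?thesis using main tc[OF v0] by linarith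
qed

end

section \<open>The tilted ensemble\<close>

lemma sum_pow_Pow:
  fixes x :: real
  assumes "finite A"
  shows "(\<Sum>B\<in>Pow A. x ^ card B) = (1 + x) ^ card A"
  using prod_add[OF assms, of "\<lambda>_. x" "\<lambda>_. 1"] by (simp add: add.commute)

lemma sum_exp_series_le:
  fixes x :: real
  assumes "0 \<le> x"
  shows "(\<Sum>k\<le>h. x ^ k / fact k) \<le> exp x"
proof -
  have "(\<Sum>k\<in>{..h}. x ^ k /\<^sub>R fact k) \<le> (\<Sum>k. x ^ k /\<^sub>R fact k)"
    using assms by (intro sum_le_suminf summable_exp_generic) auto
  then show ?thesis by (simp add: exp_def divide_inverse mult.commute)
qed

text \<open>Expand c = 1 + (c - 1) over the subsets \<open>B\<close> of the fixed points. Exactly (h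
  - |B|)! permutations fix \<open>B\<close> pointwise, and there are h choose k sets of size k, so
  the sum is h! times a partial sum of the series of exp(c - 1).\<close>

lemma fixed_point_average:
  fixes c :: real
  assumes c: "1 \<le> c"
  shows "(\<Sum>p | p permutes {..<h}. c ^ card {i. i < h \<and> p i = i}) \<le> fact h * exp (c - 1)"
proof -
  let ?P = "{p. p permutes {..<h}}"
  have "(\<Sum>p\<in>?P. c ^ card {i. i < h \<and> p i = i})
      = (\<Sum>p\<in>?P. \<Sum>B\<in>Pow {..<h}. if \<forall>i\<in>B. p i = i then (c - 1) ^ card B else 0)"
  proof (rule sum.cong[OF refl])
    fix p
    have "c ^ card {i. i < h \<and> p i = i} = (\<Sum>B\<in>Pow {i. i < h \<and> p i = i}. (c - 1) ^ card B)"
      by (subst sum_pow_Pow) auto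
    also have "\<dots> = (\<Sum>B\<in>Pow {..<h}. if \<forall>i\<in>B. p i = i then (c - 1) ^ card B else 0)"
      by (rule sum.mono_neutral_cong_left) auto
    finally show "c ^ card {i. i < h \<and> p i = i}
      = (\<Sum>B\<in>Pow {..<h}. if \<forall>i\<in>B. p i = i then (c - 1) ^ card B else 0)" .
  qed
  also have "\<dots> = (\<Sum>B\<in>Pow {..<h}. \<Sum>p\<in>?P. if \<forall>i\<in>B. p i = i then (c - 1) ^ card B else 0)"
    by (rule sum.swap)
  also have "\<dots> = (\<Sum>B\<in>Pow {..<h}. fact (h - card B) * (c - 1) ^ card B)"
  proof (rule sum.cong[OF refl])
    fix B assume B: "B \<in> Pow {..<h}"
    have "{p \<in> ?P. \<forall>i\<in>B. p i = i} = {p. p permutes ({..<h} - B)}"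
    proof (intro subset_antisym subsetI)
      fix p assume "p \<in> {p \<in> ?P. \<forall>i\<in>B. p i = i}"
      then have p: "p permutes {..<h}" "\<forall>i\<in>B. p i = i" by auto
      have "p permutes ({..<h} - B)"
      proof (rule permutes_superset[OF p(1)])
        fix i assume "i \<in> {..<h} - ({..<h} - B)"
        then show "p i = i" using p(2) by blast
      qed
      then show "p \<in> {p. p permutes ({..<h} - B)}" by simp
    next
      fix p assume "p \<in> {p. p permutes ({..<h} - B)}"
      then have p: "p permutes ({..<h} - B)" by simp
      have "p permutes {..<h}" by (rule permutes_subset[OF p]) auto
      moreover have "\<forall>i\<in>B. p i = i" using permutes_not_in[OF p] by blast
      ultimately show "p \<in> {p \<in> ?P. \<forall>i\<in>B. p i = i}" by simp
    qed
    then have "card (?P \<inter> {p. \<forall>i\<in>B. p i = i}) = fact (h - card B)"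
      using B by (simp add: Int_def card_permutations card_Diff_subset finite_subset)
    then show "(\<Sum>p\<in>?P. if \<forall>i\<in>B. p i = i then (c - 1) ^ card B else 0) = fact (h - card B) * (c - 1) ^ card B"
      by (simp add: sum.If_cases finite_permutations)
  qed
  also have "\<dots> = (\<Sum>k\<le>h. \<Sum>B | B \<in> Pow {..<h} \<and> card B = k. fact (h - card B) * (c - 1) ^ card B)"
    by (rule sum.group[symmetric]) (auto intro: subset_eq_atLeast0_lessThan_card simp: lessThan_atLeast0)
  also have "\<dots> = (\<Sum>k\<le>h. fact h * ((c - 1) ^ k / fact k))"
  proof (rule sum.cong[OF refl])
    fix k assume k: "k \<in> {..h}"
    have "card {B. B \<in> Pow {..<h} \<and> card B = k} = h choose k"
      using n_subsets[of "{..<h}" k] by simp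
    moreover have "(\<Sum>B | B \<in> Pow {..<h} \<and> card B = k. fact (h - card B) * (c - 1) ^ card B)
        = (\<Sum>B | B \<in> Pow {..<h} \<and> card B = k. fact (h - k) * (c - 1) ^ k)"
      by (rule sum.cong) auto
    ultimately show "(\<Sum>B | B \<in> Pow {..<h} \<and> card B = k. fact (h - card B) * (c - 1) ^ card B)
        = fact h * ((c - 1) ^ k / fact k)"
      using k by (simp add: binomial_fact)
  qed
  also have "\<dots> = fact h * (\<Sum>k\<le>h. (c - 1) ^ k / fact k)"
    by (simp add: sum_distrib_left)
  also have "\<dots> \<le> fact h * exp (c - 1)"
    using c by (intro mult_left_mono sum_exp_series_le) auto
  finally show ?thesis .
qed

text \<open>Composing with \<open>p'\<close> on the left turns agreements with \<open>p'\<close>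
  into fixed points.\<close>

lemma agreement_average:
  fixes c :: real
  assumes c: "1 \<le> c" and p': "p' permutes {..<h}"
  shows "(\<Sum>p | p permutes {..<h}. c ^ card {i. i < h \<and> p i = p' i}) \<le> fact h * exp (c - 1)"
proof -
  have "(\<Sum>p | p permutes {..<h}. c ^ card {i. i < h \<and> p i = p' i})
      = (\<Sum>p | p permutes {..<h}. c ^ card {i. i < h \<and> (p' \<circ> p) i = p' i})"
    by (rule setum_permutations_compose_left[OF p'])
  also have "\<dots> = (\<Sum>p | p permutes {..<h}. c ^ card {i. i < h \<and> p i = i})"
    using permutes_inj[OF p'] by (simp add: inj_eq)
  also have "\<dots> \<le> fact h * exp (c - 1)" by (rule fixed_point_average[OF c])
  finally show ?thesis .
qed

text \<open>A pair \<open>(p, s)\<close> stands for the perfect matching of the first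
  \<open>h\<close> indices with the next \<open>h\<close> that joins \<open>i\<close> to
  \<open>h + p i\<close>, with a sign on each edge.\<close>

definition matchings :: "nat \<Rightarrow> ((nat \<Rightarrow> nat) \<times> (nat \<Rightarrow> real)) set" where
  "matchings h = {p. p permutes {..<h}} \<times> signs {..<h}"

definition agreement :: "nat \<Rightarrow> (nat \<Rightarrow> nat) \<times> (nat \<Rightarrow> real) \<Rightarrow> (nat \<Rightarrow> nat) \<times> (nat \<Rightarrow> real) \<Rightarrow> real" where
  "agreement h \<omega> \<omega>' = (\<Sum>i<h. if fst \<omega> i = fst \<omega>' i then snd \<omega> i * snd \<omega>' i else 0)"

lemma finite_matchings [simp]: "finite (matchings h)"
  by (simp add: matchings_def finite_permutations finite_signs)

lemma card_matchings: "card (matchings h) = fact h * 2 ^ h"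
  by (simp add: matchings_def card_cartesian_product card_permutations card_signs)

lemma matchings_nonempty: "matchings h \<noteq> {}"
  using card_matchings[of h] by (metis card.empty fact_nonzero mult_eq_0_iff power_not_zero zero_neq_numeral)

text \<open>Averaging over the signs gives each agreement of the permutations the factor c = cosh
  \<mu>, and the permutations then give exp(c - 1). For \<mu> in [0, 1] one has cosh \<mu> - 1 <=
  \<mu>^2. Without the signs the exponent would be linear in \<mu> instead of quadratic.\<close>

lemma agreement_mgf:
  assumes \<mu>: "0 \<le> \<mu>" "\<mu> \<le> 1" and \<omega>': "\<omega>' \<in> matchings h"
  shows "(\<Sum>\<omega>\<in>matchings h. exp (\<mu> * agreement h \<omega> \<omega>')) \<le> real (card (matchings h)) * exp (\<mu>\<^sup>2)"
proof -
  obtain p' s' where \<omega>'_eq: "\<omega>' = (p', s')" and p': "p' permutes {..<h}" and s': "s' \<in> signs {..<h}"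
    using \<omega>' by (auto simp: matchings_def)
  define c where "c = (exp \<mu> + exp (- \<mu>)) / 2"
  have c1: "1 \<le> c"
    using add_mono[OF exp_ge_add_one_self[of \<mu>] exp_ge_add_one_self[of "-\<mu>"]] by (simp add: c_def)
  have c2: "c - 1 \<le> \<mu>\<^sup>2"
  proof -
    have "exp (- \<mu>) \<le> inverse (1 + \<mu>)"
      unfolding exp_minus using \<mu> exp_ge_add_one_self[of \<mu>] by (intro le_imp_inverse_le) auto
    also have "\<dots> \<le> 1 - \<mu> + \<mu>\<^sup>2"
    proof -
      have "1 \<le> (1 - \<mu> + \<mu>\<^sup>2) * (1 + \<mu>)"
        using \<mu> by (simp add: power2_eq_square algebra_simps)
      then show ?thesis using \<mu> by (simp add: inverse_eq_divide pos_divide_le_eq)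
    qed
    finally have "exp \<mu> + exp (- \<mu>) \<le> 2 * (1 + \<mu>\<^sup>2)"
      using exp_bound[OF \<mu>] by simp
    moreover have "exp \<mu> + exp (- \<mu>) = 2 * c" by (simp add: c_def)
    ultimately show ?thesis by simp
  qed
  have inner: "(\<Sum>s\<in>signs {..<h}. exp (\<mu> * agreement h (p, s) \<omega>'))
      = 2 ^ h * c ^ card {i. i < h \<and> p i = p' i}" for p
  proof -
    have "(\<Sum>s\<in>signs {..<h}. exp (\<mu> * agreement h (p, s) \<omega>'))
        = (\<Sum>s\<in>PiE {..<h} (\<lambda>_. {1, -1}). \<Prod>i<h. if p i = p' i then exp (\<mu> * (s i * s' i)) else 1)"
      unfolding signs_def agreement_def \<omega>'_eq
      by (simp add: sum_distrib_left exp_sum if_distrib cong: if_cong)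
    also have "\<dots> = (\<Prod>i<h. \<Sum>t\<in>{1, -1}. if p i = p' i then exp (\<mu> * (t * s' i)) else 1)"
      by (rule prod_sum_PiE[symmetric]) auto
    also have "\<dots> = (\<Prod>i<h. 2 * (if p i = p' i then c else 1))"
    proof (rule prod.cong[OF refl])
      fix i assume "i \<in> {..<h}"
      then have "s' i = 1 \<or> s' i = -1" using s' by (auto simp: signs_def)
      then show "(\<Sum>t\<in>{1, -1}. if p i = p' i then exp (\<mu> * (t * s' i)) else 1)
          = 2 * (if p i = p' i then c else 1)"
        by (auto simp: c_def)
    qed
    also have "\<dots> = 2 ^ h * c ^ card {i. i < h \<and> p i = p' i}"
      unfolding prod.distrib by (simp add: prod.If_cases Int_def)
    finally show ?thesis .
  qed
  have "(\<Sum>\<omega>\<in>matchings h. exp (\<mu> * agreement h \<omega> \<omega>'))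
      = (\<Sum>p | p permutes {..<h}. \<Sum>s\<in>signs {..<h}. exp (\<mu> * agreement h (p, s) \<omega>'))"
    unfolding matchings_def by (simp add: sum.cartesian_product)
  also have "\<dots> = 2 ^ h * (\<Sum>p | p permutes {..<h}. c ^ card {i. i < h \<and> p i = p' i})"
    unfolding inner by (simp add: sum_distrib_left)
  also have "\<dots> \<le> 2 ^ h * (fact h * exp (c - 1))"
    by (intro mult_left_mono agreement_average c1 p') simp
  also have "\<dots> \<le> 2 ^ h * (fact h * exp (\<mu>\<^sup>2))"
    using c2 by simp
  finally show ?thesis by (simp add: card_matchings mult_ac)
qed

section \<open>The tilted states and their exchange operators\<close>

definition basis :: "nat \<Rightarrow> nat \<Rightarrow> real" where
  "basis i a = (if a = i then 1 else 0)"

text \<open>An ensemble of \<open>r\<close> pure states with average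
  \<open>(I + 2 x y X) / r\<close>, where \<open>X\<close> exchanges \<open>i\<close> and \<open>h + p i\<close> with sign \<open>s i\<close>.\<close>

definition tilted :: "nat \<Rightarrow> real \<Rightarrow> real \<Rightarrow> (nat \<Rightarrow> nat) \<times> (nat \<Rightarrow> real) \<Rightarrow> nat \<Rightarrow> nat \<Rightarrow> real" where
  "tilted h x y \<omega> i a =
     (if i < h then x * basis i a + y * snd \<omega> i * basis (h + fst \<omega> i) a
      else if i < 2 * h then y * snd \<omega> (i - h) * basis (i - h) a + x * basis (h + fst \<omega> (i - h)) a
      else basis i a)"

definition exch :: "nat \<Rightarrow> (nat \<Rightarrow> nat) \<times> (nat \<Rightarrow> real) \<Rightarrow> nat \<Rightarrow> nat \<Rightarrow> real" where
  "exch h \<omega> a a' = (\<Sum>i<h. snd \<omega> i *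
     (basis i a * basis (h + fst \<omega> i) a' + basis (h + fst \<omega> i) a * basis i a'))"

lemma matchings_perm: "\<omega> \<in> matchings h \<Longrightarrow> fst \<omega> permutes {..<h}"
  by (auto simp: matchings_def)

lemma matchings_less: "\<omega> \<in> matchings h \<Longrightarrow> i < h \<Longrightarrow> fst \<omega> i < h"
  using permutes_in_image[OF matchings_perm, of \<omega> h i] by simp

lemma matchings_sign: "\<omega> \<in> matchings h \<Longrightarrow> i < h \<Longrightarrow> (snd \<omega> i)\<^sup>2 = 1"
  by (auto simp: matchings_def signs_def PiE_def Pi_def power2_eq_1_iff)

lemma basis_sum_right: "i < r \<Longrightarrow> (\<Sum>a<r. f a * basis i a) = f i"
  by (simp add: basis_def if_distrib cong: if_cong)

lemma basis_orth: "i < r \<Longrightarrow> (\<Sum>a<r. basis i a * basis j a) = (if i = j then 1 else 0)"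
  by (subst mult.commute) (simp add: basis_sum_right, simp add: basis_def)

lemma sum_halves:
  fixes f :: "nat \<Rightarrow> real"
  assumes "2 * h \<le> r"
  shows "(\<Sum>i<r. f i) = (\<Sum>i<h. f i + f (h + i)) + (\<Sum>i\<in>{2*h..<r}. f i)"
proof -
  have "(\<Sum>i<r. f i) = (\<Sum>i\<in>{0..<h}. f i) + (\<Sum>i\<in>{h..<2*h}. f i) + (\<Sum>i\<in>{2*h..<r}. f i)"
    using assms by (simp add: lessThan_atLeast0 sum.atLeastLessThan_concat)
  also have "(\<Sum>i\<in>{h..<2*h}. f i) = (\<Sum>i\<in>{0..<h}. f (h + i))"
    using sum.shift_bounds_nat_ivl[of f 0 h h] by (simp add: mult_2 add.commute)
  finally show ?thesis by (simp add: sum.distrib lessThan_atLeast0)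
qed

lemma tilted_unit:
  assumes \<omega>: "\<omega> \<in> matchings h" and h: "2 * h \<le> r" and xy: "x\<^sup>2 + y\<^sup>2 = 1" and i: "i < r"
  shows "(\<Sum>a<r. (tilted h x y \<omega> i a)\<^sup>2) = 1"
proof -
  have two: "(\<Sum>a<r. (c * basis j a + d * basis l a)\<^sup>2) = c\<^sup>2 + d\<^sup>2"
    if "j < r" "l < r" "j \<noteq> l" for c d :: real and j l
  proof -
    have "(\<Sum>a<r. (c * basis j a + d * basis l a)\<^sup>2)
        = c\<^sup>2 * (\<Sum>a<r. basis j a * basis j a) + 2 * c * d * (\<Sum>a<r. basis j a * basis l a)
          + d\<^sup>2 * (\<Sum>a<r. basis l a * basis l a)"
      unfolding sum_distrib_left sum.distrib[symmetric]
      by (rule sum.cong) (auto simp: power2_eq_square algebra_simps)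
    then show ?thesis using that by (simp add: basis_orth)
  qed
  consider "i < h" | "h \<le> i" "i < 2 * h" | "2 * h \<le> i" by linarith
  then show ?thesis
  proof cases
    case 1
    then have "h + fst \<omega> i < r" using matchings_less[OF \<omega>, of i] h by linarith
    then show ?thesis
      using 1 i matchings_sign[OF \<omega> 1] xy by (simp add: tilted_def two power_mult_distrib)
  next
    case 2
    then have j: "i - h < h" by linarith
    then have "h + fst \<omega> (i - h) < r" "i - h < r" using matchings_less[OF \<omega>, of "i - h"] h by linarith+
    then show ?thesis
      using 2 j matchings_sign[OF \<omega> j] xy by (simp add: tilted_def two power_mult_distrib)
  next
    case 3
    then show ?thesis using i by (simp add: tilted_def power2_eq_square basis_orth)
  qed
qed

text \<open>The vectors \<open>i\<close> and \<open>h + i\<close> live in the plane of the basis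
  vectors \<open>i\<close> and \<open>h + p i\<close>. Their outer products add up to the identity
  of that plane plus 2xy s times the exchange. Reindexing by the permutation then collects the
  identity parts.\<close>

lemma tilted_gram:
  assumes \<omega>: "\<omega> \<in> matchings h" and h: "2 * h \<le> r" and xy: "x\<^sup>2 + y\<^sup>2 = 1" and a: "a < r"
  shows "(\<Sum>i<r. tilted h x y \<omega> i a * tilted h x y \<omega> i a') = basis a a' + 2 * x * y * exch h \<omega> a a'"
proof -
  have id: "(\<Sum>i<r. basis i a * basis i a') = basis a a'"
    using a by (simp add: basis_def if_distrib cong: if_cong)
  have "(\<Sum>i<r. tilted h x y \<omega> i a * tilted h x y \<omega> i a')
      = (\<Sum>i<h. tilted h x y \<omega> i a * tilted h x y \<omega> i a' + tilted h x y \<omega> (h + i) a * tilted h x y \<omega> (h + i) a')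
        + (\<Sum>i\<in>{2*h..<r}. basis i a * basis i a')"
    unfolding sum_halves[OF h] by (auto simp: tilted_def intro!: arg_cong2[where f = plus] sum.cong)
  also have "(\<Sum>i<h. tilted h x y \<omega> i a * tilted h x y \<omega> i a' + tilted h x y \<omega> (h + i) a * tilted h x y \<omega> (h + i) a')
      = (\<Sum>i<h. (basis i a * basis i a' + basis (h + fst \<omega> i) a * basis (h + fst \<omega> i) a')
          + 2 * x * y * (snd \<omega> i *
     (basis i a * basis (h + fst \<omega> i) a' + basis (h + fst \<omega> i) a * basis i a')))"
  proof (rule sum.cong[OF refl])
    fix i assume "i \<in> {..<h}"
    then have i: "i < h" by simp
    define s where "s = snd \<omega> i"
    have s2: "s * s = 1" using matchings_sign[OF \<omega> i] by (simp add: s_def power2_eq_square)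
    have xy': "x * x = 1 - y * y" using xy by (simp add: power2_eq_square)
    define A A' B B' where "A = basis i a" and "A' = basis i a'"
      and "B = basis (h + fst \<omega> i) a" and "B' = basis (h + fst \<omega> i) a'"
    have "(x * A + y * s * B) * (x * A' + y * s * B') + (y * s * A + x * B) * (y * s * A' + x * B')
        = (x * x + y * y * (s * s)) * (A * A' + B * B') + 2 * x * y * (s * (A * B' + B * A'))"
      by (simp add: algebra_simps)
    also have "\<dots> = (A * A' + B * B') + 2 * x * y * (s * (A * B' + B * A'))"
      by (simp add: s2 xy')
    finally show "tilted h x y \<omega> i a * tilted h x y \<omega> i a' + tilted h x y \<omega> (h + i) a * tilted h x y \<omega> (h + i) a'
        = (basis i a * basis i a' + basis (h + fst \<omega> i) a * basis (h + fst \<omega> i) a')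
          + 2 * x * y * (snd \<omega> i *
     (basis i a * basis (h + fst \<omega> i) a' + basis (h + fst \<omega> i) a * basis i a'))"
      using i by (simp add: tilted_def A_def B_def A'_def B'_def s_def)
  qed
  also have "\<dots> = (\<Sum>i<h. basis i a * basis i a') + (\<Sum>i<h. basis (h + fst \<omega> i) a * basis (h + fst \<omega> i) a')
      + 2 * x * y * exch h \<omega> a a'"
    by (simp add: sum.distrib exch_def sum_distrib_left)
  also have "(\<Sum>i<h. basis (h + fst \<omega> i) a * basis (h + fst \<omega> i) a') = (\<Sum>i<h. basis (h + i) a * basis (h + i) a')"
    using sum.permute[OF matchings_perm[OF \<omega>], of "\<lambda>i. basis (h + i) a * basis (h + i) a'"] by (simp add: comp_def)
  finally show ?thesis
    using id unfolding sum_halves[OF h] by (simp add: sum.distrib)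
qed

lemma exch_zero_diag:
  assumes "\<omega> \<in> matchings h"
  shows "exch h \<omega> a a = 0"
  unfolding exch_def using matchings_less[OF assms] by (intro sum.neutral) (auto simp: basis_def)

lemma sum_swap_pairs:
  "(\<Sum>a\<in>A. \<Sum>b\<in>B. \<Sum>i\<in>C. \<Sum>j\<in>D. f a b i j) = (\<Sum>i\<in>C. \<Sum>j\<in>D. \<Sum>a\<in>A. \<Sum>b\<in>B. f a b i j)"
proof -
  have "(\<Sum>a\<in>A. \<Sum>b\<in>B. \<Sum>i\<in>C. \<Sum>j\<in>D. f a b i j) = (\<Sum>a\<in>A. \<Sum>i\<in>C. \<Sum>b\<in>B. \<Sum>j\<in>D. f a b i j)"
    by (intro sum.cong[OF refl] sum.swap)
  also have "\<dots> = (\<Sum>i\<in>C. \<Sum>a\<in>A. \<Sum>b\<in>B. \<Sum>j\<in>D. f a b i j)"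
    by (rule sum.swap)
  also have "\<dots> = (\<Sum>i\<in>C. \<Sum>a\<in>A. \<Sum>j\<in>D. \<Sum>b\<in>B. f a b i j)"
    by (intro sum.cong[OF refl] sum.swap)
  also have "\<dots> = (\<Sum>i\<in>C. \<Sum>j\<in>D. \<Sum>a\<in>A. \<Sum>b\<in>B. f a b i j)"
    by (intro sum.cong[OF refl] sum.swap)
  finally show ?thesis .
qed

text \<open>Two edges contribute only if they join the same indices. Since every edge goes from the
  first half to the second, this means equal first ends and equal images; the factor 2 counts the
  two orders of the ends.\<close>

lemma exch_inner:
  assumes \<omega>: "\<omega> \<in> matchings h" and \<omega>': "\<omega>' \<in> matchings h" and h: "2 * h \<le> r"
  shows "(\<Sum>a<r. \<Sum>a'<r. exch h \<omega> a a' * exch h \<omega>' a a') = 2 * agreement h \<omega> \<omega>'"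
proof -
  let ?o = "\<lambda>i j :: nat. if i = j then 1 else 0 :: real"
  have four: "(\<Sum>a<r. \<Sum>a'<r. (basis i a * basis j a' + basis j a * basis i a')
        * (basis k a * basis l a' + basis l a * basis k a'))
      = 2 * (?o i k * ?o j l + ?o i l * ?o j k)" if "i < r" "j < r" for i j k l
  proof -
    have "(\<Sum>a<r. \<Sum>a'<r. (basis i a * basis j a' + basis j a * basis i a')
        * (basis k a * basis l a' + basis l a * basis k a'))
      = (\<Sum>a<r. basis i a * basis k a) * (\<Sum>a'<r. basis j a' * basis l a')
        + (\<Sum>a<r. basis i a * basis l a) * (\<Sum>a'<r. basis j a' * basis k a')
        + (\<Sum>a<r. basis j a * basis k a) * (\<Sum>a'<r. basis i a' * basis l a')
        + (\<Sum>a<r. basis j a * basis l a) * (\<Sum>a'<r. basis i a' * basis k a')"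
      unfolding sum_product sum.distrib[symmetric]
      by (intro sum.cong refl) (simp add: algebra_simps)
    then show ?thesis using that by (simp add: basis_orth)
  qed
  have "(\<Sum>a<r. \<Sum>a'<r. exch h \<omega> a a' * exch h \<omega>' a a')
      = (\<Sum>i<h. \<Sum>j<h. snd \<omega> i * snd \<omega>' j * (\<Sum>a<r. \<Sum>a'<r.
          (basis i a * basis (h + fst \<omega> i) a' + basis (h + fst \<omega> i) a * basis i a')
        * (basis j a * basis (h + fst \<omega>' j) a' + basis (h + fst \<omega>' j) a * basis j a')))"
  proof -
    have "(\<Sum>a<r. \<Sum>a'<r. exch h \<omega> a a' * exch h \<omega>' a a')
      = (\<Sum>a<r. \<Sum>a'<r. \<Sum>i<h. \<Sum>j<h. snd \<omega> i * snd \<omega>' j * (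
          (basis i a * basis (h + fst \<omega> i) a' + basis (h + fst \<omega> i) a * basis i a')
        * (basis j a * basis (h + fst \<omega>' j) a' + basis (h + fst \<omega>' j) a * basis j a')))"
      unfolding exch_def sum_product by (intro sum.cong refl) (simp add: mult_ac)
    also have "\<dots> = (\<Sum>i<h. \<Sum>j<h. \<Sum>a<r. \<Sum>a'<r. snd \<omega> i * snd \<omega>' j * (
          (basis i a * basis (h + fst \<omega> i) a' + basis (h + fst \<omega> i) a * basis i a')
        * (basis j a * basis (h + fst \<omega>' j) a' + basis (h + fst \<omega>' j) a * basis j a')))"
      by (rule sum_swap_pairs)
    finally show ?thesis by (simp only: sum_distrib_left)
  qed
  also have "\<dots> = (\<Sum>i<h. \<Sum>j<h. if i = j then 2 * (if fst \<omega> i = fst \<omega>' i then snd \<omega> i * snd \<omega>' i else 0) else 0)"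
  proof (intro sum.cong refl)
    fix i j assume "i \<in> {..<h}" "j \<in> {..<h}"
    then have i: "i < h" "i < r" "h + fst \<omega> i < r" and j: "j < h"
      using matchings_less[OF \<omega>, of i] h by auto
    then show "snd \<omega> i * snd \<omega>' j * (\<Sum>a<r. \<Sum>a'<r.
          (basis i a * basis (h + fst \<omega> i) a' + basis (h + fst \<omega> i) a * basis i a')
        * (basis j a * basis (h + fst \<omega>' j) a' + basis (h + fst \<omega>' j) a * basis j a'))
      = (if i = j then 2 * (if fst \<omega> i = fst \<omega>' i then snd \<omega> i * snd \<omega>' i else 0) else 0)"
      by (subst four) auto
  qed
  also have "\<dots> = 2 * agreement h \<omega> \<omega>'"
    by (simp add: agreement_def sum_distrib_left)
  finally show ?thesis .
qed

text \<open>Multiplicativity of the entrywise inner product under tensor powers, written with one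
  factor for each element of \<open>J\<close>.\<close>

lemma sum_labelling_pairs:
  fixes F :: "nat \<Rightarrow> nat \<Rightarrow> real"
  assumes "finite J"
  shows "(\<Sum>\<alpha>\<in>PiE J (\<lambda>_. {..<r}). \<Sum>\<alpha>'\<in>PiE J (\<lambda>_. {..<r}). \<Prod>b\<in>J. F (\<alpha> b) (\<alpha>' b))
    = (\<Sum>a<r. \<Sum>a'<r. F a a') ^ card J"
proof -
  have "(\<Sum>\<alpha>\<in>PiE J (\<lambda>_. {..<r}). \<Sum>\<alpha>'\<in>PiE J (\<lambda>_. {..<r}). \<Prod>b\<in>J. F (\<alpha> b) (\<alpha>' b))
      = (\<Sum>\<alpha>\<in>PiE J (\<lambda>_. {..<r}). \<Prod>b\<in>J. \<Sum>a'<r. F (\<alpha> b) a')"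
    using assms by (intro sum.cong refl prod_sum_PiE[symmetric]) auto
  also have "\<dots> = (\<Prod>b\<in>J. \<Sum>a<r. \<Sum>a'<r. F a a')"
    using assms prod_sum_PiE[of J "\<lambda>_. {..<r}" "\<lambda>b a. \<Sum>a'<r. F a a'"] by simp
  finally show ?thesis by simp
qed

text \<open>The \<open>\<chi>\<^sup>2\<close>-divergence of the averaged tensor power from the maximally mixed state.\<close>

lemma tilted_chi_square:
  fixes \<rho> :: "(nat \<Rightarrow> nat) \<times> (nat \<Rightarrow> real) \<Rightarrow> nat \<Rightarrow> nat \<Rightarrow> real"
  assumes r: "0 < r" and h: "2 * h \<le> r" and \<delta>: "0 \<le> \<delta>" "\<delta> \<le> 1" and J: "finite J"
    and \<mu>: "2 * real (card J) * \<delta>\<^sup>2 / real r \<le> \<mu>" "\<mu> \<le> 1"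
    and \<rho>: "\<And>\<omega> a a'. \<omega> \<in> matchings h \<Longrightarrow> a < r \<Longrightarrow> \<rho> \<omega> a a' = (basis a a' + \<delta> * exch h \<omega> a a') / real r"
  shows "real r ^ card J * (\<Sum>\<alpha>\<in>PiE J (\<lambda>_. {..<r}). \<Sum>\<alpha>'\<in>PiE J (\<lambda>_. {..<r}).
        ((\<Sum>\<omega>\<in>matchings h. \<Prod>b\<in>J. \<rho> \<omega> (\<alpha> b) (\<alpha>' b)) / real (card (matchings h))
          - (\<Prod>b\<in>J. basis (\<alpha> b) (\<alpha>' b) / real r))\<^sup>2) \<le> 2 * \<mu>\<^sup>2"
proof -
  let ?\<Omega> = "matchings h" and ?k = "card J" and ?P = "PiE J (\<lambda>_. {..<r})"
  define N where "N = real (card ?\<Omega>)"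
  define R where "R \<omega> a a' = (basis a a' + \<delta> * exch h \<omega> a a') / real r" for \<omega> a a'
  define \<sigma> where "\<sigma> a a' = basis a a' / real r" for a a'
  define M where "M = (\<lambda>\<alpha> \<alpha>'. \<Sum>\<omega>\<in>?\<Omega>. \<Prod>b\<in>J. R \<omega> (\<alpha> b) (\<alpha>' b))"
  define Z where "Z = (\<lambda>\<alpha> \<alpha>'. \<Prod>b\<in>J. \<sigma> (\<alpha> b) (\<alpha>' b))"
  have N0: "0 < N" using matchings_nonempty by (simp add: N_def card_gt_0_iff)
  have diag': "(\<Sum>a<r. \<Sum>a'<r. f a a' * basis a a') = (\<Sum>a<r. f a a)" for f :: "nat \<Rightarrow> nat \<Rightarrow> real"
    by (intro sum.cong refl basis_sum_right) simp
  have diag: "(\<Sum>a<r. \<Sum>a'<r. basis a a' * f a a') = (\<Sum>a<r. f a a)" for f :: "nat \<Rightarrow> nat \<Rightarrow> real"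
    using diag'[of f] by (simp add: mult.commute)
  have bb: "(\<Sum>a<r. \<Sum>a'<r. basis a a' * basis a a') = real r"
    unfolding diag by (simp add: basis_def)
  have RR: "(\<Sum>a<r. \<Sum>a'<r. R \<omega> a a' * R \<omega>' a a') = (1 + 2 * \<delta>\<^sup>2 * agreement h \<omega> \<omega>' / real r) / real r"
    if "\<omega> \<in> ?\<Omega>" "\<omega>' \<in> ?\<Omega>" for \<omega> \<omega>'
  proof -
    have "(\<Sum>a<r. \<Sum>a'<r. R \<omega> a a' * R \<omega>' a a')
        = ((\<Sum>a<r. \<Sum>a'<r. basis a a' * basis a a') + \<delta> * (\<Sum>a<r. \<Sum>a'<r. basis a a' * exch h \<omega>' a a')
          + \<delta> * (\<Sum>a<r. \<Sum>a'<r. exch h \<omega> a a' * basis a a')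
          + \<delta>\<^sup>2 * (\<Sum>a<r. \<Sum>a'<r. exch h \<omega> a a' * exch h \<omega>' a a')) / (real r * real r)"
      unfolding sum_distrib_left sum.distrib[symmetric] sum_divide_distrib
      by (intro sum.cong refl) (simp add: R_def field_simps power2_eq_square r)
    also have "\<dots> = (real r + \<delta>\<^sup>2 * (2 * agreement h \<omega> \<omega>')) / (real r * real r)"
      using that unfolding bb unfolding diag diag' by (simp add: exch_zero_diag exch_inner[OF _ _ h])
    finally show ?thesis using r by (simp add: field_simps)
  qed
  have R\<sigma>: "(\<Sum>a<r. \<Sum>a'<r. R \<omega> a a' * \<sigma> a a') = 1 / real r" if "\<omega> \<in> ?\<Omega>" for \<omega>
  proof -
    have "(\<Sum>a<r. \<Sum>a'<r. R \<omega> a a' * \<sigma> a a') = (\<Sum>a<r. R \<omega> a a) / real r"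
      unfolding \<sigma>_def times_divide_eq_right sum_divide_distrib[symmetric] diag' ..
    also have "\<dots> = 1 / real r"
      using r that by (simp add: R_def exch_zero_diag basis_def)
    finally show ?thesis .
  qed
  have \<sigma>\<sigma>: "(\<Sum>a<r. \<Sum>a'<r. \<sigma> a a' * \<sigma> a a') = 1 / real r"
  proof -
    have "(\<Sum>a<r. \<Sum>a'<r. \<sigma> a a' * \<sigma> a a') = (\<Sum>a<r. \<sigma> a a) / real r"
      unfolding \<sigma>_def[of _ "_::nat"] times_divide_eq_right sum_divide_distrib[symmetric] diag' by simp
    then show ?thesis using r by (simp add: \<sigma>_def basis_def)
  qed
  have MM: "(\<Sum>\<alpha>\<in>?P. \<Sum>\<alpha>'\<in>?P. M \<alpha> \<alpha>' * M \<alpha> \<alpha>')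
      = (\<Sum>\<omega>\<in>?\<Omega>. \<Sum>\<omega>'\<in>?\<Omega>. ((1 + 2 * \<delta>\<^sup>2 * agreement h \<omega> \<omega>' / real r) / real r) ^ ?k)"
  proof -
    have "(\<Sum>\<alpha>\<in>?P. \<Sum>\<alpha>'\<in>?P. M \<alpha> \<alpha>' * M \<alpha> \<alpha>')
      = (\<Sum>\<alpha>\<in>?P. \<Sum>\<alpha>'\<in>?P. \<Sum>\<omega>\<in>?\<Omega>. \<Sum>\<omega>'\<in>?\<Omega>. \<Prod>b\<in>J. R \<omega> (\<alpha> b) (\<alpha>' b) * R \<omega>' (\<alpha> b) (\<alpha>' b))"
      unfolding M_def sum_product prod.distrib ..
    also have "\<dots> = (\<Sum>\<omega>\<in>?\<Omega>. \<Sum>\<omega>'\<in>?\<Omega>. \<Sum>\<alpha>\<in>?P. \<Sum>\<alpha>'\<in>?P. \<Prod>b\<in>J. R \<omega> (\<alpha> b) (\<alpha>' b) * R \<omega>' (\<alpha> b) (\<alpha>' b))"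
      by (rule sum_swap_pairs)
    also have "\<dots> = (\<Sum>\<omega>\<in>?\<Omega>. \<Sum>\<omega>'\<in>?\<Omega>. (\<Sum>a<r. \<Sum>a'<r. R \<omega> a a' * R \<omega>' a a') ^ ?k)"
      by (intro sum.cong refl) (rule sum_labelling_pairs[OF J, where F = "\<lambda>a a'. R _ a a' * R _ a a'"])
    also have "\<dots> = (\<Sum>\<omega>\<in>?\<Omega>. \<Sum>\<omega>'\<in>?\<Omega>. ((1 + 2 * \<delta>\<^sup>2 * agreement h \<omega> \<omega>' / real r) / real r) ^ ?k)"
      by (intro sum.cong refl) (simp only: RR)
    finally show ?thesis .
  qed
  have MZ: "(\<Sum>\<alpha>\<in>?P. \<Sum>\<alpha>'\<in>?P. M \<alpha> \<alpha>' * Z \<alpha> \<alpha>') = N * (1 / real r) ^ ?k"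
  proof -
    have "(\<Sum>\<alpha>\<in>?P. \<Sum>\<alpha>'\<in>?P. M \<alpha> \<alpha>' * Z \<alpha> \<alpha>')
      = (\<Sum>\<alpha>\<in>?P. \<Sum>\<alpha>'\<in>?P. \<Sum>\<omega>\<in>?\<Omega>. \<Prod>b\<in>J. R \<omega> (\<alpha> b) (\<alpha>' b) * \<sigma> (\<alpha> b) (\<alpha>' b))"
      unfolding M_def Z_def sum_distrib_right prod.distrib ..
    also have "\<dots> = (\<Sum>\<alpha>\<in>?P. \<Sum>\<omega>\<in>?\<Omega>. \<Sum>\<alpha>'\<in>?P. \<Prod>b\<in>J. R \<omega> (\<alpha> b) (\<alpha>' b) * \<sigma> (\<alpha> b) (\<alpha>' b))"
      by (intro sum.cong[OF refl] sum.swap)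
    also have "\<dots> = (\<Sum>\<omega>\<in>?\<Omega>. \<Sum>\<alpha>\<in>?P. \<Sum>\<alpha>'\<in>?P. \<Prod>b\<in>J. R \<omega> (\<alpha> b) (\<alpha>' b) * \<sigma> (\<alpha> b) (\<alpha>' b))"
      by (rule sum.swap)
    also have "\<dots> = (\<Sum>\<omega>\<in>?\<Omega>. (\<Sum>a<r. \<Sum>a'<r. R \<omega> a a' * \<sigma> a a') ^ ?k)"
      by (intro sum.cong refl) (rule sum_labelling_pairs[OF J, where F = "\<lambda>a a'. R _ a a' * \<sigma> a a'"])
    also have "\<dots> = (\<Sum>\<omega>\<in>?\<Omega>. (1 / real r) ^ ?k)"
      by (intro sum.cong refl) (simp add: R\<sigma>)
    finally show ?thesis by (simp add: N_def)
  qed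
  have ZZ: "(\<Sum>\<alpha>\<in>?P. \<Sum>\<alpha>'\<in>?P. Z \<alpha> \<alpha>' * Z \<alpha> \<alpha>') = (1 / real r) ^ ?k"
    unfolding Z_def prod.distrib[symmetric] \<sigma>\<sigma>[symmetric] by (rule sum_labelling_pairs[OF J])
  have "(\<Sum>\<alpha>\<in>?P. \<Sum>\<alpha>'\<in>?P. ((\<Sum>\<omega>\<in>?\<Omega>. \<Prod>b\<in>J. \<rho> \<omega> (\<alpha> b) (\<alpha>' b)) / N - (\<Prod>b\<in>J. basis (\<alpha> b) (\<alpha>' b) / real r))\<^sup>2)
      = (\<Sum>\<alpha>\<in>?P. \<Sum>\<alpha>'\<in>?P. (M \<alpha> \<alpha>' / N - Z \<alpha> \<alpha>')\<^sup>2)"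
  proof (intro sum.cong refl)
    fix \<alpha> \<alpha>' assume \<alpha>: "\<alpha> \<in> ?P"
    have "(\<Prod>b\<in>J. \<rho> \<omega> (\<alpha> b) (\<alpha>' b)) = (\<Prod>b\<in>J. R \<omega> (\<alpha> b) (\<alpha>' b))" if "\<omega> \<in> ?\<Omega>" for \<omega>
      unfolding R_def using \<alpha> that by (intro prod.cong refl \<rho>) auto
    then show "((\<Sum>\<omega>\<in>?\<Omega>. \<Prod>b\<in>J. \<rho> \<omega> (\<alpha> b) (\<alpha>' b)) / N - (\<Prod>b\<in>J. basis (\<alpha> b) (\<alpha>' b) / real r))\<^sup>2
        = (M \<alpha> \<alpha>' / N - Z \<alpha> \<alpha>')\<^sup>2"
      by (simp add: M_def Z_def \<sigma>_def)
  qed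
  \<comment> \<open>As X has zero diagonal, the mixed term and the square of \<open>Z\<close> are
    both multiples of (1/r)^k. Together they leave -(1/r)^k, which the prefactor r^k turns into
    -1.\<close>
  also have "\<dots> = (\<Sum>\<alpha>\<in>?P. \<Sum>\<alpha>'\<in>?P. M \<alpha> \<alpha>' * M \<alpha> \<alpha>') / (N * N)
      - 2 * (\<Sum>\<alpha>\<in>?P. \<Sum>\<alpha>'\<in>?P. M \<alpha> \<alpha>' * Z \<alpha> \<alpha>') / N + (\<Sum>\<alpha>\<in>?P. \<Sum>\<alpha>'\<in>?P. Z \<alpha> \<alpha>' * Z \<alpha> \<alpha>')"
    unfolding sum_divide_distrib sum_distrib_left sum_subtractf[symmetric] sum.distrib[symmetric]
    by (intro sum.cong refl) (simp add: power2_eq_square algebra_simps add_divide_distrib)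
  also have "\<dots> = (\<Sum>\<omega>\<in>?\<Omega>. \<Sum>\<omega>'\<in>?\<Omega>. ((1 + 2 * \<delta>\<^sup>2 * agreement h \<omega> \<omega>' / real r) / real r) ^ ?k) / (N * N)
      - (1 / real r) ^ ?k"
    unfolding MM MZ ZZ using N0 by simp
  finally have eq: "real r ^ ?k * (\<Sum>\<alpha>\<in>?P. \<Sum>\<alpha>'\<in>?P.
        ((\<Sum>\<omega>\<in>?\<Omega>. \<Prod>b\<in>J. \<rho> \<omega> (\<alpha> b) (\<alpha>' b)) / N - (\<Prod>b\<in>J. basis (\<alpha> b) (\<alpha>' b) / real r))\<^sup>2)
      = (\<Sum>\<omega>\<in>?\<Omega>. \<Sum>\<omega>'\<in>?\<Omega>. (1 + 2 * \<delta>\<^sup>2 * agreement h \<omega> \<omega>' / real r) ^ ?k) / (N * N) - 1"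
    using r by (simp add: right_diff_distrib power_divide sum_divide_distrib[symmetric] sum_distrib_left[symmetric])
  define t where "t = 2 * real ?k * \<delta>\<^sup>2 / real r"
  have t: "0 \<le> t" "t \<le> \<mu>" using \<mu> by (auto simp: t_def)
  \<comment> \<open>Raising 1 + t <= exp t to a power requires 1 + t >= 0. The agreement is at least
    -h, so \<open>2 * h \<le> r\<close> and \<open>\<delta> \<le> 1\<close> ensure this.\<close>
  have termwise: "(1 + 2 * \<delta>\<^sup>2 * agreement h \<omega> \<omega>' / real r) ^ ?k \<le> exp (t * agreement h \<omega> \<omega>')"
    if "\<omega> \<in> ?\<Omega>" "\<omega>' \<in> ?\<Omega>" for \<omega> \<omega>'
  proof -
    let ?A = "agreement h \<omega> \<omega>'"
    have "\<bar>?A\<bar> \<le> (\<Sum>i<h. \<bar>if fst \<omega> i = fst \<omega>' i then snd \<omega> i * snd \<omega>' i else 0\<bar>)"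
      unfolding agreement_def by (rule sum_abs)
    also have "\<dots> \<le> (\<Sum>i<h. 1)"
    proof (rule sum_mono)
      fix i assume "i \<in> {..<h}"
      then have "\<bar>snd \<omega> i\<bar> = 1" "\<bar>snd \<omega>' i\<bar> = 1"
        using matchings_sign[OF that(1), of i] matchings_sign[OF that(2), of i] by (auto simp: power2_eq_1_iff)
      then show "\<bar>if fst \<omega> i = fst \<omega>' i then snd \<omega> i * snd \<omega>' i else 0\<bar> \<le> 1"
        by (simp add: abs_mult)
    qed
    finally have "- real h \<le> ?A" by simp
    moreover have "\<delta>\<^sup>2 \<le> 1" using \<delta> by (simp add: power_le_one)
    ultimately have "- (2 * real h) \<le> 2 * \<delta>\<^sup>2 * ?A"
    proof -
      assume a: "- real h \<le> ?A" and d: "\<delta>\<^sup>2 \<le> 1"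
      have "\<delta>\<^sup>2 * (- real h) \<le> \<delta>\<^sup>2 * ?A" using a by (intro mult_left_mono) auto
      moreover have "\<delta>\<^sup>2 * real h \<le> 1 * real h" using d by (intro mult_right_mono) auto
      ultimately have "- real h \<le> \<delta>\<^sup>2 * ?A" by simp
      then have "2 * (- real h) \<le> 2 * (\<delta>\<^sup>2 * ?A)" by (rule mult_left_mono) simp
      then show ?thesis by (simp add: mult.assoc)
    qed
    then have "- real r \<le> 2 * \<delta>\<^sup>2 * ?A" using h by linarith
    then have "0 \<le> 1 + 2 * \<delta>\<^sup>2 * ?A / real r" using r by (simp add: field_simps)
    then have "(1 + 2 * \<delta>\<^sup>2 * ?A / real r) ^ ?k \<le> exp (2 * \<delta>\<^sup>2 * ?A / real r) ^ ?k"
      by (intro power_mono exp_ge_add_one_self)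
    also have "\<dots> = exp (t * ?A)"
      by (simp add: exp_of_nat_mult[symmetric] t_def mult_ac)
    finally show ?thesis .
  qed
  have "(\<Sum>\<omega>\<in>?\<Omega>. \<Sum>\<omega>'\<in>?\<Omega>. (1 + 2 * \<delta>\<^sup>2 * agreement h \<omega> \<omega>' / real r) ^ ?k)
      \<le> (\<Sum>\<omega>\<in>?\<Omega>. \<Sum>\<omega>'\<in>?\<Omega>. exp (t * agreement h \<omega> \<omega>'))"
    by (intro sum_mono termwise)
  also have "\<dots> = (\<Sum>\<omega>'\<in>?\<Omega>. \<Sum>\<omega>\<in>?\<Omega>. exp (t * agreement h \<omega> \<omega>'))"
    by (rule sum.swap)
  also have "\<dots> \<le> (\<Sum>\<omega>'\<in>?\<Omega>. N * exp (t\<^sup>2))"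
    unfolding N_def using t \<mu>(2) by (intro sum_mono agreement_mgf) auto
  also have "\<dots> = N * N * exp (t\<^sup>2)" by (simp add: N_def)
  finally have "(\<Sum>\<omega>\<in>?\<Omega>. \<Sum>\<omega>'\<in>?\<Omega>. (1 + 2 * \<delta>\<^sup>2 * agreement h \<omega> \<omega>' / real r) ^ ?k) / (N * N) \<le> exp (t\<^sup>2)"
    using N0 by (simp add: pos_divide_le_eq mult.commute)
  moreover have "exp (t\<^sup>2) \<le> 1 + 2 * \<mu>\<^sup>2"
  proof -
    have t2: "t\<^sup>2 \<le> \<mu>\<^sup>2" "\<mu>\<^sup>2 \<le> 1" using t \<mu>(2) by (auto intro: power_mono simp: power_le_one)
    then have "exp (t\<^sup>2) \<le> 1 + t\<^sup>2 + (t\<^sup>2)\<^sup>2" by (intro exp_bound) auto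
    also have "(t\<^sup>2)\<^sup>2 \<le> t\<^sup>2 * 1" unfolding power2_eq_square[of "t\<^sup>2"] using t2 by (intro mult_left_mono) auto
    finally show ?thesis using t2 by linarith
  qed
  ultimately show ?thesis unfolding eq[unfolded N_def] N_def by linarith
qed

section \<open>Trace distance, rank and oracle states\<close>

text \<open>\<open>mat_abs\<close> is a definite description, so the positive square root has to be
  shown unique. The root \<open>B0\<close> is c times the projection onto \<open>S\<close>. For
  another root B, a column j outside \<open>S\<close> has squared norm equal to the diagonal entry j
  of its square, which is zero; the columns in \<open>S\<close> are settled by positivity.\<close>

lemma trace_norm_scaled_projector:
  assumes M: "M \<in> carrier_mat n n" and S: "S \<subseteq> {..<n}" and c: "0 < c"
    and sq: "cadj M * M = mat n n (\<lambda>(i, j). if i = j \<and> i \<in> S then complex_of_real (c\<^sup>2) else 0)"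
  shows "trace_norm M = c * real (card S)"
proof -
  define C where "C = complex_of_real c"
  define B0 where "B0 = mat n n (\<lambda>(i, j). if i = j \<and> i \<in> S then C else 0)"
  have sq': "cadj M * M = mat n n (\<lambda>(i, j). if i = j \<and> i \<in> S then C * C else 0)"
    unfolding sq C_def by (rule eq_matI) (auto simp: power2_eq_square)
  have mult_index: "(X * Y) $$ (i, j) = (\<Sum>k<n. X $$ (i, k) * Y $$ (k, j))"
    if "X \<in> carrier_mat n n" "Y \<in> carrier_mat n n" "i < n" "j < n" for X Y :: "complex mat" and i j
    using that by (auto simp: scalar_prod_def lessThan_atLeast0 intro!: sum.cong)
  have B0: "psd_mat n B0" "B0 * B0 = cadj M * M"
  proof -
    have "0 \<le> Re (\<Sum>i<n. cnj (v $ i) * (B0 *\<^sub>v v) $ i)" if v: "v \<in> carrier_vec n" for v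
    proof -
      have "(B0 *\<^sub>v v) $ i = (if i \<in> S then C * v $ i else 0)" if "i < n" for i
      proof -
        have "(B0 *\<^sub>v v) $ i = (\<Sum>k<n. B0 $$ (i, k) * v $ k)"
          using that v by (simp add: B0_def scalar_prod_def lessThan_atLeast0)
        also have "\<dots> = (\<Sum>k<n. if i = k then if i \<in> S then C * v $ k else 0 else 0)"
          using that by (intro sum.cong refl) (auto simp: B0_def)
        finally show ?thesis using that by simp
      qed
      then have "(\<Sum>i<n. cnj (v $ i) * (B0 *\<^sub>v v) $ i)
          = (\<Sum>i<n. complex_of_real (if i \<in> S then c * (cmod (v $ i))\<^sup>2 else 0))"
        by (intro sum.cong refl) (simp add: C_def complex_norm_square mult_ac del: of_real_power)
      also have "\<dots> = complex_of_real (\<Sum>i<n. if i \<in> S then c * (cmod (v $ i))\<^sup>2 else 0)"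
        by (simp only: of_real_sum)
      finally show ?thesis using c by (simp add: sum_nonneg)
    qed
    then show "psd_mat n B0"
      unfolding psd_mat_def by (auto simp: B0_def cadj_def C_def)
    show "B0 * B0 = cadj M * M"
      unfolding sq'
    proof (rule eq_matI)
      fix i j assume "i < dim_row (mat n n (\<lambda>(i, j). if i = j \<and> i \<in> S then C * C else 0))"
        "j < dim_col (mat n n (\<lambda>(i, j). if i = j \<and> i \<in> S then C * C else 0))"
      then have ij: "i < n" "j < n" by auto
      have "(B0 * B0) $$ (i, j) = (\<Sum>k<n. B0 $$ (i, k) * B0 $$ (k, j))"
        using ij by (intro mult_index) (auto simp: B0_def)
      also have "\<dots> = (\<Sum>k<n. if i = k then if i = j \<and> i \<in> S then C * C else 0 else 0)"
        using ij by (intro sum.cong refl) (auto simp: B0_def)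
      finally show "(B0 * B0) $$ (i, j) = mat n n (\<lambda>(i, j). if i = j \<and> i \<in> S then C * C else 0) $$ (i, j)"
        using ij by simp
    qed (auto simp: B0_def)
  qed
  have uniq: "B = B0" if B: "psd_mat n B" "B * B = cadj M * M" for B
  proof -
    have Bc: "B \<in> carrier_mat n n" "cadj B = B" using B by (auto simp: psd_mat_def)
    have herm: "cnj (B $$ (i, j)) = B $$ (j, i)" if "i < n" "j < n" for i j
      using cadj_index[of j B i] that Bc by auto
    have BB: "(\<Sum>k<n. B $$ (i, k) * B $$ (k, j)) = (if i = j \<and> i \<in> S then C * C else 0)"
      if "i < n" "j < n" for i j
      using mult_index[OF Bc(1) Bc(1) that] B(2) sq' that by simp
    have off: "B $$ (k, j) = 0" if "k < n" "j < n" "j \<notin> S" for k j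
    proof -
      have "complex_of_real (\<Sum>k<n. (cmod (B $$ (k, j)))\<^sup>2) = (\<Sum>k<n. B $$ (j, k) * B $$ (k, j))"
        unfolding of_real_sum using that herm
        by (intro sum.cong refl) (simp add: complex_norm_square mult.commute del: of_real_power)
      also have "\<dots> = 0" using BB[OF that(2) that(2)] that(3) by simp
      finally have "(\<Sum>k<n. (cmod (B $$ (k, j)))\<^sup>2) = 0" by (simp only: of_real_eq_0_iff)
      then show ?thesis using that(1) by (simp add: sum_nonneg_eq_0_iff)
    qed
    have on: "B $$ (i, j) = B0 $$ (i, j)" if ij: "i < n" "j < n" "j \<in> S" for i j
    proof -
      \<comment> \<open>The column \<open>w\<close> of \<open>B - B0\<close> satisfies \<open>B w = - c w\<close>, so positivity of \<open>B\<close> forces \<open>w = 0\<close>.\<close>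
      define w where "w = vec n (\<lambda>k. B $$ (k, j) - (if k = j then C else 0))"
      have "(B *\<^sub>v w) $ l = - (C * w $ l)" if l: "l < n" for l
      proof -
        have "(B *\<^sub>v w) $ l = (\<Sum>k<n. B $$ (l, k) * B $$ (k, j) - (if k = j then B $$ (l, k) * C else 0))"
          using l Bc by (auto simp: w_def scalar_prod_def lessThan_atLeast0 right_diff_distrib intro!: sum.cong)
        also have "\<dots> = (if l = j then C * C else 0) - B $$ (l, j) * C"
          using l ij by (simp add: sum_subtractf BB)
        also have "\<dots> = - (C * w $ l)"
          using l by (simp add: w_def algebra_simps)
        finally show ?thesis .
      qed
      then have "(\<Sum>l<n. cnj (w $ l) * (B *\<^sub>v w) $ l) = (\<Sum>l<n. complex_of_real (- (c * (cmod (w $ l))\<^sup>2)))"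
        by (intro sum.cong refl) (simp add: C_def complex_norm_square mult_ac del: of_real_power)
      also have "\<dots> = complex_of_real (- (c * (\<Sum>l<n. (cmod (w $ l))\<^sup>2)))"
        by (simp only: of_real_sum sum_negf sum_distrib_left of_real_minus)
      finally have "Re (\<Sum>l<n. cnj (w $ l) * (B *\<^sub>v w) $ l) = - (c * (\<Sum>l<n. (cmod (w $ l))\<^sup>2))"
        by (simp only: Re_complex_of_real)
      moreover have "w \<in> carrier_vec n" by (simp add: w_def)
      ultimately have "c * (\<Sum>l<n. (cmod (w $ l))\<^sup>2) \<le> 0"
        using B(1) unfolding psd_mat_def by fastforce
      then have "(\<Sum>l<n. (cmod (w $ l))\<^sup>2) \<le> 0"
        using c by (simp only: mult_le_0_iff) auto
      then have "(\<Sum>l<n. (cmod (w $ l))\<^sup>2) = 0"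
        by (rule antisym) (simp add: sum_nonneg)
      then have "w $ i = 0" using ij by (simp add: sum_nonneg_eq_0_iff)
      then show ?thesis using ij by (auto simp: w_def B0_def)
    qed
    show "B = B0"
    proof (rule eq_matI)
      fix i j assume "i < dim_row B0" "j < dim_col B0"
      then have "i < n" "j < n" by (auto simp: B0_def)
      then show "B $$ (i, j) = B0 $$ (i, j)"
        using on off by (cases "j \<in> S") (auto simp: B0_def)
    qed (use Bc in \<open>auto simp: B0_def\<close>)
  qed
  have "mat_abs M = B0"
  proof -
    have dim: "dim_col M = n" using M by simp
    show ?thesis
      unfolding mat_abs_def dim
      by (rule the_equality, rule conjI[OF B0], erule conjE, rule uniq)
  qed
  then have "trace_norm M = Re (\<Sum>i<n. B0 $$ (i, i))"
    using M by (simp add: trace_norm_def)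
  also have "(\<Sum>i<n. B0 $$ (i, i)) = (\<Sum>i<n. if i \<in> S then C else 0)"
    by (intro sum.cong refl) (auto simp: B0_def)
  also have "\<dots> = C * of_nat (card S)"
    using S by (simp add: sum.If_cases Int_absorb1 mult.commute)
  also have "\<dots> = complex_of_real (c * real (card S))"
    by (simp add: C_def)
  finally show ?thesis by (simp only: Re_complex_of_real)
qed

section \<open>Rank from independent columns\<close>

text \<open>Independence of the indexed family gives independence of the set of columns, and also
  injectivity: two equal columns would admit the coefficients 1 and -1.\<close>

lemma columns_lin_indpt:
  fixes A :: "complex mat"
  assumes A: "A \<in> carrier_mat n nc" and I: "I \<subseteq> {..<nc}"
    and indep: "\<And>c. (\<And>i. i < n \<Longrightarrow> (\<Sum>j\<in>I. c j * A $$ (i, j)) = 0) \<Longrightarrow> \<forall>j\<in>I. c j = 0"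
  shows "inj_on (col A) I" "module.lin_indpt class_ring (module_vec TYPE(complex) n) (col A ` I)"
proof -
  interpret vec_space "TYPE(complex)" n .
  have fin: "finite I" using I finite_subset by auto
  have ind: "col A j $ i = A $$ (i, j)" if "i < n" "j \<in> I" for i j
    using that A I by auto
  show inj: "inj_on (col A) I"
  proof (rule inj_onI, rule ccontr)
    fix j k assume jk: "j \<in> I" "k \<in> I" "col A j = col A k" "j \<noteq> k"
    define c where "c l = (if l = j then 1 else if l = k then -1 else 0 :: complex)" for l
    have "(\<Sum>l\<in>I. c l * A $$ (i, l)) = 0" if i: "i < n" for i
    proof -
      have "(\<Sum>l\<in>I. c l * A $$ (i, l))
          = (\<Sum>l\<in>I. (if l = j then A $$ (i, l) else 0) - (if l = k then A $$ (i, l) else 0))"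
        using jk by (intro sum.cong refl) (auto simp: c_def)
      also have "\<dots> = A $$ (i, j) - A $$ (i, k)"
        using fin jk by (simp add: sum_subtractf)
      also have "\<dots> = 0" using ind[OF i jk(1)] ind[OF i jk(2)] jk(3) by simp
      finally show ?thesis .
    qed
    then have "c j = 0" using indep jk(1) by blast
    then show False by (simp add: c_def)
  qed
  show "lin_indpt (col A ` I)"
  proof
    assume dep: "lin_dep (col A ` I)"
    have car: "col A ` I \<subseteq> carrier_vec n" using A I by auto
    obtain a w where a: "lincomb a (col A ` I) = 0\<^sub>v n" "w \<in> col A ` I" "a w \<noteq> 0"
      using finite_lin_dep[OF _ dep] fin car by auto
    have "(\<Sum>j\<in>I. a (col A j) * A $$ (i, j)) = 0" if i: "i < n" for i
    proof -
      have "lincomb a (col A ` I) $ i = (\<Sum>x\<in>col A ` I. a x * x $ i)"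
        by (rule lincomb_index[OF i car])
      also have "\<dots> = (\<Sum>j\<in>I. a (col A j) * A $$ (i, j))"
        using inj ind[OF i] by (simp add: sum.reindex)
      finally show ?thesis using a(1) i by simp
    qed
    from indep[OF this] have "\<forall>j\<in>I. a (col A j) = 0" .
    then show False using a(2,3) by auto
  qed
qed

text \<open>The columns in \<open>I\<close> form a maximal independent subset of all columns,
  because every further column is zero and a set containing zero is dependent.\<close>

lemma mat_rank_columns:
  assumes A: "A \<in> carrier_mat n n" and I: "I \<subseteq> {..<n}"
    and indep: "\<And>c. (\<And>i. i < n \<Longrightarrow> (\<Sum>j\<in>I. c j * A $$ (i, j)) = 0) \<Longrightarrow> \<forall>j\<in>I. c j = 0"
    and zero: "\<And>i j. i < n \<Longrightarrow> j < n \<Longrightarrow> j \<notin> I \<Longrightarrow> A $$ (i, j) = 0"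
  shows "mat_rank n A = card I"
proof -
  interpret vec_space "TYPE(complex)" n .
  note li = columns_lin_indpt[OF A I indep]
  have cols: "set (cols A) = col A ` {..<n}"
    using A by (auto simp: cols_def)
  have "maximal (col A ` I) (\<lambda>T. T \<subseteq> set (cols A) \<and> lin_indpt T)"
    unfolding maximal_def
  proof (intro conjI allI impI)
    show "col A ` I \<subseteq> set (cols A)" using I cols by auto
    show "lin_indpt (col A ` I)" by (rule li(2))
    fix T assume T: "col A ` I \<subseteq> T \<and> (T \<subseteq> set (cols A) \<and> lin_indpt T)"
    have "x \<in> col A ` I" if "x \<in> T" for x
    proof (rule ccontr)
      assume "x \<notin> col A ` I"
      moreover from that T obtain j where "j < n" "x = col A j" unfolding cols by auto
      ultimately have j: "j < n" "j \<notin> I" "x = col A j" by auto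
      then have "x = 0\<^sub>v n" using zero A by (intro eq_vecI) auto
      then have "0\<^sub>v n \<in> T" using that by simp
      moreover have "T \<subseteq> carrier_vec n" using T cols_dim A by blast
      moreover have "(UNIV :: complex set) \<noteq> {0}" by (metis UNIV_I one_neq_zero singletonD)
      ultimately have "lin_dep T" using zero_lin_dep by blast
      then show False using T by simp
    qed
    then show "T = col A ` I" using T by auto
  qed
  from rank_card_indpt[OF A this] show ?thesis
    using li(1) by (simp add: mat_rank_def card_image)
qed

text \<open>Index \<open>0\<close> of \<open>A\<close> is left free, so that the purifications are orthogonal to \<open>|0>\<close>.\<close>

definition embed_state :: "nat \<Rightarrow> nat \<Rightarrow> (nat \<Rightarrow> nat \<Rightarrow> real) \<Rightarrow> complex mat" where
  "embed_state n r R = mat n n (\<lambda>(i, j). if i \<in> {1..r} \<and> j \<in> {1..r} then complex_of_real (R (i - 1) (j - 1)) else 0)"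

lemma embed_carrier [simp]: "embed_state n r R \<in> carrier_mat n n"
  by (simp add: embed_state_def)

lemma embed_index:
  "i < n \<Longrightarrow> j < n \<Longrightarrow> embed_state n r R $$ (i, j)
    = (if i \<in> {1..r} \<and> j \<in> {1..r} then complex_of_real (R (i - 1) (j - 1)) else 0)"
  by (simp add: embed_state_def)

lemma sum_embed:
  fixes f :: "nat \<Rightarrow> 'a :: comm_monoid_add"
  assumes "r < n"
  shows "(\<Sum>k<n. if k \<in> {1..r} then f (k - 1) else 0) = (\<Sum>b<r. f b)"
proof -
  have "(\<Sum>k<n. if k \<in> {1..r} then f (k - 1) else 0) = (\<Sum>k\<in>Suc ` {..<r}. f (k - 1))"
    unfolding image_Suc_lessThan using assms by (intro sum.mono_neutral_cong_right) auto
  also have "\<dots> = (\<Sum>b<r. f b)" by (subst sum.reindex) auto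
  finally show ?thesis .
qed

text \<open>Applying the left inverse \<open>Q\<close> to a vanishing combination of the columns of
  \<open>R\<close> isolates each coefficient.\<close>

lemma mat_rank_embed:
  assumes n: "r < n"
    and inv: "\<And>a c. a < r \<Longrightarrow> c < r \<Longrightarrow> (\<Sum>b<r. Q a b * R b c) = (if a = c then 1 else 0)"
  shows "mat_rank n (embed_state n r R) = r"
proof -
  have "mat_rank n (embed_state n r R) = card {1..r}"
  proof (rule mat_rank_columns)
    show "{1..r} \<subseteq> {..<n}" using n by auto
    show "embed_state n r R $$ (i, j) = 0" if "i < n" "j < n" "j \<notin> {1..r}" for i j
      using that by (auto simp: embed_index)
    fix c assume c: "\<And>i. i < n \<Longrightarrow> (\<Sum>j\<in>{1..r}. c j * embed_state n r R $$ (i, j)) = 0"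
    have col: "(\<Sum>e<r. c (Suc e) * complex_of_real (R b e)) = 0" if b: "b < r" for b
    proof -
      have "(\<Sum>j\<in>{1..r}. c j * embed_state n r R $$ (Suc b, j))
          = (\<Sum>e<r. c (Suc e) * embed_state n r R $$ (Suc b, Suc e))"
        unfolding image_Suc_lessThan[symmetric] by (simp add: sum.reindex)
      also have "\<dots> = (\<Sum>e<r. c (Suc e) * complex_of_real (R b e))"
        using n b by (intro sum.cong refl) (simp add: embed_index)
      finally show ?thesis using c[of "Suc b"] b n by simp
    qed
    show "\<forall>j\<in>{1..r}. c j = 0"
    proof
      fix j assume j: "j \<in> {1..r}"
      then have a: "j - 1 < r" "Suc (j - 1) = j" by auto
      have "0 = (\<Sum>b<r. complex_of_real (Q (j - 1) b) * (\<Sum>e<r. c (Suc e) * complex_of_real (R b e)))"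
        by (simp add: col)
      also have "\<dots> = (\<Sum>b<r. \<Sum>e<r. c (Suc e) * complex_of_real (Q (j - 1) b * R b e))"
        by (simp add: sum_distrib_left mult_ac)
      also have "\<dots> = (\<Sum>e<r. c (Suc e) * complex_of_real (\<Sum>b<r. Q (j - 1) b * R b e))"
        by (subst sum.swap) (simp add: sum_distrib_left)
      also have "\<dots> = (\<Sum>e<r. if j - 1 = e then c (Suc e) else 0)"
        using a by (intro sum.cong refl) (simp add: inv)
      also have "\<dots> = c j" using a by simp
      finally show "c j = 0" by simp
    qed
  qed simp
  then show ?thesis by simp
qed

text \<open>The square of the symmetric difference is c^2 times the projection onto
  \<open>S\<close>, so its absolute value can be written down and no spectral decomposition is
  required.\<close>

lemma trace_dist_embed:
  assumes n: "r < n" and S: "S \<subseteq> {..<r}" and c: "0 < c"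
    and sym: "\<And>a b. a < r \<Longrightarrow> b < r \<Longrightarrow> R a b - R' a b = R b a - R' b a"
    and sq: "\<And>a e. a < r \<Longrightarrow> e < r \<Longrightarrow>
      (\<Sum>b<r. (R a b - R' a b) * (R b e - R' b e)) = (if a = e \<and> a \<in> S then c\<^sup>2 else 0)"
  shows "trace_dist (embed_state n r R) (embed_state n r R') = c * real (card S) / 2"
proof -
  define D where "D a b = R a b - R' a b" for a b
  have M: "embed_state n r R - embed_state n r R' = embed_state n r D"
    by (rule eq_matI) (auto simp: embed_state_def D_def)
  have "trace_norm (embed_state n r D) = c * real (card (Suc ` S))"
  proof (rule trace_norm_scaled_projector[OF _ _ c])
    show "Suc ` S \<subseteq> {..<n}" using S n by auto
    show "cadj (embed_state n r D) * embed_state n r D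
      = mat n n (\<lambda>(i, j). if i = j \<and> i \<in> Suc ` S then complex_of_real (c\<^sup>2) else 0)"
    proof (rule eq_matI)
      fix i j assume "i < dim_row (mat n n (\<lambda>(i, j). if i = j \<and> i \<in> Suc ` S then complex_of_real (c\<^sup>2) else 0))"
        "j < dim_col (mat n n (\<lambda>(i, j). if i = j \<and> i \<in> Suc ` S then complex_of_real (c\<^sup>2) else 0))"
      then have ij: "i < n" "j < n" by auto
      have "(cadj (embed_state n r D) * embed_state n r D) $$ (i, j) = (\<Sum>k<n. cnj (embed_state n r D $$ (k, i)) * embed_state n r D $$ (k, j))"
        using ij by (auto simp: scalar_prod_def cadj_def embed_state_def lessThan_atLeast0 intro!: sum.cong)
      also have "\<dots> = (\<Sum>k<n. if k \<in> {1..r} then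
          (if i \<in> {1..r} \<and> j \<in> {1..r} then complex_of_real (D (k - 1) (i - 1) * D (k - 1) (j - 1)) else 0) else 0)"
        using ij by (intro sum.cong refl) (auto simp: embed_index)
      also have "\<dots> = (\<Sum>b<r. if i \<in> {1..r} \<and> j \<in> {1..r} then complex_of_real (D b (i - 1) * D b (j - 1)) else 0)"
        by (rule sum_embed[OF n])
      also have "\<dots> = (if i = j \<and> i \<in> Suc ` S then complex_of_real (c\<^sup>2) else 0)"
      proof (cases "i \<in> {1..r} \<and> j \<in> {1..r}")
        case True
        then have a: "i - 1 < r" "j - 1 < r" "Suc (i - 1) = i" "Suc (j - 1) = j" by auto
        have "(\<Sum>b<r. D b (i - 1) * D b (j - 1)) = (\<Sum>b<r. D (i - 1) b * D b (j - 1))"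
          using sym a unfolding D_def by (intro sum.cong refl) auto
        also have "\<dots> = (if i - 1 = j - 1 \<and> i - 1 \<in> S then c\<^sup>2 else 0)"
          unfolding D_def by (rule sq[OF a(1,2)])
        also have "\<dots> = (if i = j \<and> i \<in> Suc ` S then c\<^sup>2 else 0)"
          using a by (metis (no_types, lifting) imageE image_eqI diff_Suc_1)
        finally have "(\<Sum>b<r. complex_of_real (D b (i - 1) * D b (j - 1)))
            = complex_of_real (if i = j \<and> i \<in> Suc ` S then c\<^sup>2 else 0)"
          by (simp only: of_real_sum[symmetric])
        then show ?thesis
          unfolding if_P[OF True] by (simp only: if_distrib[of complex_of_real] of_real_0)
      next
        case False
        then have "\<not> (i = j \<and> i \<in> Suc ` S)" using S by auto
        then show ?thesis using False by auto
      qed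
      finally show "(cadj (embed_state n r D) * embed_state n r D) $$ (i, j)
        = mat n n (\<lambda>(i, j). if i = j \<and> i \<in> Suc ` S then complex_of_real (c\<^sup>2) else 0) $$ (i, j)"
        using ij by simp
    qed (auto simp: embed_state_def cadj_def)
  qed simp
  then show ?thesis by (simp add: trace_dist_def M card_image)
qed

section \<open>Reduced states of reflection oracles\<close>

lemma oracle_state_index:
  assumes U: "U \<in> carrier_mat (n*m) (n*m)" and i: "i < n" "i' < n"
  shows "oracle_state n m U $$ (i, i') = (\<Sum>j<m. U $$ (i*m+j, 0) * cnj (U $$ (i'*m+j, 0)))"
proof -
  have "(U * proj0 (n*m) * cadj U) $$ (h, h') = U $$ (h, 0) * cnj (U $$ (h', 0))"
    if h: "h < n*m" "h' < n*m" for h h'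
  proof -
    have "(U * proj0 (n*m)) $$ (h, l) = (if l = 0 then U $$ (h, 0) else 0)" if l: "l < n*m" for l
    proof -
      have "(U * proj0 (n*m)) $$ (h, l) = (\<Sum>k<n*m. U $$ (h, k) * proj0 (n*m) $$ (k, l))"
        using U h l by (simp add: proj0_def scalar_prod_def lessThan_atLeast0)
      also have "\<dots> = (\<Sum>k<n*m. if k = 0 then if l = 0 then U $$ (h, k) else 0 else 0)"
        using l by (intro sum.cong refl) (auto simp: proj0_def)
      finally show ?thesis using le_less_trans[OF le0 h(1)] by simp
    qed
    note e = this
    have "(U * proj0 (n*m) * cadj U) $$ (h, h') = (\<Sum>l<n*m. (U * proj0 (n*m)) $$ (h, l) * cadj U $$ (l, h'))"
      using U h by (simp add: proj0_def cadj_def scalar_prod_def lessThan_atLeast0)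
    also have "\<dots> = (\<Sum>l<n*m. if l = 0 then U $$ (h, 0) * cnj (U $$ (h', l)) else 0)"
      using U h by (intro sum.cong refl) (auto simp: e cadj_index)
    finally show ?thesis using le_less_trans[OF le0 h(1)] by simp
  qed
  then have "(U * proj0 (n*m) * cadj U) $$ (i*m+j, i'*m+j) = U $$ (i*m+j, 0) * cnj (U $$ (i'*m+j, 0))"
    if "j < m" for j
    using that i by (simp add: pair_index_less)
  then show ?thesis
    using i by (simp add: oracle_state_def partial_trace_B_def)
qed

text \<open>Column 0 is the image of |0>. As \<eta> has the entry 1/sqrt 2 at 0, the entry of the
  column there is 1 - 2/2 = 0, and the rest is -sqrt 2 times \<eta>, the purification.\<close>

lemma House_column_0:
  assumes "h < d" "\<eta> 0 = 1 / sqrt 2"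
  shows "House d (\<lambda>h. complex_of_real (\<eta> h)) $$ (h, 0)
    = complex_of_real (if h = 0 then 0 else - sqrt 2 * \<eta> h)"
proof -
  have "2 / sqrt 2 = sqrt 2" by (simp add: real_div_sqrt)
  then have "2 * (x * (1 / sqrt 2)) = sqrt 2 * x" for x by (simp add: field_simps)
  then have "complex_of_real (2 * (\<eta> h * (1 / sqrt 2))) = complex_of_real (sqrt 2 * \<eta> h)"
    by (rule arg_cong)
  then show ?thesis using assms by (auto simp: House_def)
qed

lemma sum_cells:
  fixes f :: "nat \<Rightarrow> real"
  assumes "0 < r"
  shows "(\<Sum>b<L*r. f ((b + u (b div r)) mod r)) = real L * (\<Sum>i<r. f i)"
proof -
  have "(\<Sum>b<L*r. f ((b + u (b div r)) mod r)) = (\<Sum>c<L. \<Sum>t<r. f ((c * r + t + u ((c * r + t) div r)) mod r))"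
    by (rule sum_split_index)
  also have "\<dots> = (\<Sum>c<L. \<Sum>t<r. f ((u c + t) mod r))"
  proof (intro sum.cong refl)
    fix c t assume "t \<in> {..<r}"
    then have "(c * r + t) div r = c" by simp
    moreover have "(c * r + t + u c) mod r = (u c + t) mod r"
      by (metis (no_types, lifting) add.assoc add.commute mod_mult_self3)
    ultimately show "f ((c * r + t + u ((c * r + t) div r)) mod r) = f ((u c + t) mod r)" by simp
  qed
  also have "\<dots> = real L * (\<Sum>i<r. f i)" by (simp add: sum_cyclic_shift[OF assms])
  finally show ?thesis .
qed

context purification
begin

text \<open>Both factors of a term carry the same sign, which cancels, and every cell of labels
  meets each \<open>v i\<close> once. So \<open>g\<close> and \<open>u\<close> leave no trace in the
  reduced state, and the guarantee for a solver covers every random purification.\<close>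

lemma oracle_state_chi:
  assumes g: "g \<in> signs {..<L*r}"
  shows "oracle_state n m (House (n*m) (\<lambda>h. complex_of_real (chi v g u h))) = embed_state n r (rho v)"
proof (rule eq_matI)
  let ?U = "House (n*m) (\<lambda>h. complex_of_real (chi v g u h))"
  fix i i' assume "i < dim_row (embed_state n r (rho v))" "i' < dim_col (embed_state n r (rho v))"
  then have i: "i < n" "i' < n" by (auto simp: embed_state_def)
  have col: "?U $$ (i*m+j, 0) = (if i \<in> {1..r} \<and> j < L * r
      then complex_of_real (g j * v (pick u j) (i - 1) / sqrt (real (L * r))) else 0)"
    if j: "j < m" and "i < n" for i j
  proof -
    have less: "i*m+j < n*m" by (rule pair_index_less[OF \<open>i < n\<close> j])
    have dm: "(i*m+j) div m = i" "(i*m+j) mod m = j" using j by auto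
    show ?thesis
    proof (cases "i \<in> {1..r} \<and> j < L * r")
      case True
      then have "i*m+j = emb (i - 1) j" "i - 1 < r" by (auto simp: emb_def)
      then show ?thesis
        using True House_column_0[of "i*m+j" "n*m" "chi v g u"] less emb_pos[of "i - 1" j]
        by (simp add: chi_emb real_sqrt_mult)
    next
      case False
      then have "i*m+j = 0 \<or> chi v g u (i*m+j) = 0" unfolding chi_def dm by auto
      then show ?thesis
        using False House_column_0[of "i*m+j" "n*m" "chi v g u"] less by auto
    qed
  qed
  have "oracle_state n m ?U $$ (i, i') = (\<Sum>j<m. ?U $$ (i*m+j, 0) * cnj (?U $$ (i'*m+j, 0)))"
    by (rule oracle_state_index) (use i in auto)
  also have "\<dots> = (\<Sum>j<m. if j < L * r then if i \<in> {1..r} \<and> i' \<in> {1..r}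
      then complex_of_real (v (pick u j) (i - 1) * v (pick u j) (i' - 1) / real (L * r)) else 0 else 0)"
  proof (rule sum.cong[OF refl])
    fix j assume "j \<in> {..<m}"
    then have j: "j < m" by simp
    have "g j * g j = 1" if "j < L * r"
      using signs_square[OF g, of j] that by (simp add: power2_eq_square)
    moreover have "sqrt (real (L * r)) * sqrt (real (L * r)) = real (L * r)" by simp
    ultimately have "g j * x / sqrt (real (L * r)) * (g j * y / sqrt (real (L * r))) = x * y / real (L * r)"
      if "j < L * r" for x y
      using that by (simp only: times_divide_times_eq) (simp add: mult.left_commute mult.assoc[symmetric])
    then have cplx: "complex_of_real (g j * x / sqrt (real (L * r))) * cnj (complex_of_real (g j * y / sqrt (real (L * r))))
        = complex_of_real (x * y / real (L * r))" if "j < L * r" for x y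
      using that by (simp only: complex_cnj_complex_of_real of_real_mult[symmetric])
    show "?U $$ (i*m+j, 0) * cnj (?U $$ (i'*m+j, 0))
      = (if j < L * r then if i \<in> {1..r} \<and> i' \<in> {1..r}
        then complex_of_real (v (pick u j) (i - 1) * v (pick u j) (i' - 1) / real (L * r)) else 0 else 0)"
      unfolding col[OF j i(1)] col[OF j i(2)]
      by (cases "j < L * r"; cases "i \<in> {1..r}"; cases "i' \<in> {1..r}";
        simp only: cplx if_True if_False simp_thms complex_cnj_zero mult_zero_left mult_zero_right)
  qed
  also have "\<dots> = (\<Sum>j<L*r. if i \<in> {1..r} \<and> i' \<in> {1..r}
      then complex_of_real (v (pick u j) (i - 1) * v (pick u j) (i' - 1) / real (L * r)) else 0)"
    using m by (intro sum.mono_neutral_cong_right) auto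
  also have "\<dots> = embed_state n r (rho v) $$ (i, i')"
  proof -
    have "(\<Sum>j<L*r. v (pick u j) a * v (pick u j) a' / real (L * r)) = rho v a a'" for a a'
      using sum_cells[OF r, of "\<lambda>i. v i a * v i a'" u L] L
      by (simp add: pick_def rho_def sum_divide_distrib[symmetric])
    then have "(\<Sum>j<L*r. complex_of_real (v (pick u j) a * v (pick u j) a' / real (L * r)))
        = complex_of_real (rho v a a')" for a a'
      by (simp only: of_real_sum[symmetric])
    then show ?thesis using i by (auto simp: embed_index)
  qed
  finally show "oracle_state n m ?U $$ (i, i') = embed_state n r (rho v) $$ (i, i')" .
qed (auto simp: embed_state_def oracle_state_def partial_trace_B_def)

end

section \<open>Spectral properties of the exchange operator\<close>

lemma exch_sym: "exch h \<omega> a b = exch h \<omega> b a"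
  by (simp add: exch_def mult_ac add.commute)

text \<open>Distinct edges of a matching are disjoint and signs square to one, so X is an involution
  on the first \<open>2 * h\<close> coordinates and zero on the others.\<close>

lemma exch_square:
  assumes \<omega>: "\<omega> \<in> matchings h" and h: "2 * h \<le> r" and a: "a < r"
  shows "(\<Sum>b<r. exch h \<omega> a b * exch h \<omega> b c) = (if a = c \<and> a < 2 * h then 1 else 0)"
proof -
  let ?p = "fst \<omega>" and ?s = "snd \<omega>"
  have inj: "?p i = ?p j \<longleftrightarrow> i = j" for i j
    using permutes_inj[OF matchings_perm[OF \<omega>]] by (auto dest: injD)
  have "(\<Sum>b<r. exch h \<omega> a b * exch h \<omega> b c) = (\<Sum>i<h. \<Sum>j<h. \<Sum>b<r. ?s i * ?s j *
      ((basis i a * basis (h + ?p i) b + basis (h + ?p i) a * basis i b)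
        * (basis j b * basis (h + ?p j) c + basis (h + ?p j) b * basis j c)))"
  proof -
    have "(\<Sum>b<r. exch h \<omega> a b * exch h \<omega> b c) = (\<Sum>b<r. \<Sum>i<h. \<Sum>j<h. ?s i * ?s j *
      ((basis i a * basis (h + ?p i) b + basis (h + ?p i) a * basis i b)
        * (basis j b * basis (h + ?p j) c + basis (h + ?p j) b * basis j c)))"
      unfolding exch_def sum_product by (intro sum.cong refl) (simp only: mult_ac)
    also have "\<dots> = (\<Sum>i<h. \<Sum>b<r. \<Sum>j<h. ?s i * ?s j *
      ((basis i a * basis (h + ?p i) b + basis (h + ?p i) a * basis i b)
        * (basis j b * basis (h + ?p j) c + basis (h + ?p j) b * basis j c)))"
      by (rule sum.swap)
    finally show ?thesis by (simp only: sum.swap[of _ "{..<h}" "{..<r}"])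
  qed
  also have "\<dots> = (\<Sum>i<h. \<Sum>j<h. if i = j then basis i a * basis i c + basis (h + ?p i) a * basis (h + ?p i) c else 0)"
  proof (intro sum.cong refl)
    fix i j assume "i \<in> {..<h}" "j \<in> {..<h}"
    then have i: "i < h" "i < r" "h + ?p i < r" and j: "j < h"
      using matchings_less[OF \<omega>, of i] h by auto
    have "(\<Sum>b<r. ?s i * ?s j *
      ((basis i a * basis (h + ?p i) b + basis (h + ?p i) a * basis i b)
        * (basis j b * basis (h + ?p j) c + basis (h + ?p j) b * basis j c)))
      = ?s i * ?s j * (
          basis i a * basis (h + ?p j) c * (\<Sum>b<r. basis (h + ?p i) b * basis j b)
        + basis i a * basis j c * (\<Sum>b<r. basis (h + ?p i) b * basis (h + ?p j) b)
        + basis (h + ?p i) a * basis (h + ?p j) c * (\<Sum>b<r. basis i b * basis j b)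
        + basis (h + ?p i) a * basis j c * (\<Sum>b<r. basis i b * basis (h + ?p j) b))"
      unfolding sum_distrib_left sum.distrib[symmetric]
      by (intro sum.cong refl) (simp add: algebra_simps)
    also have "\<dots> = (if i = j then basis i a * basis i c + basis (h + ?p i) a * basis (h + ?p i) c else 0)"
      using i j matchings_sign[OF \<omega> i(1)] matchings_sign[OF \<omega> j] by (simp add: basis_orth inj power2_eq_square)
    finally show "(\<Sum>b<r. ?s i * ?s j *
      ((basis i a * basis (h + ?p i) b + basis (h + ?p i) a * basis i b)
        * (basis j b * basis (h + ?p j) c + basis (h + ?p j) b * basis j c)))
      = (if i = j then basis i a * basis i c + basis (h + ?p i) a * basis (h + ?p i) c else 0)" .
  qed
  also have "\<dots> = (\<Sum>i<h. basis i a * basis i c) + (\<Sum>i<h. basis (h + ?p i) a * basis (h + ?p i) c)"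
    by (simp add: sum.distrib)
  also have "(\<Sum>i<h. basis (h + ?p i) a * basis (h + ?p i) c) = (\<Sum>i<h. basis (h + i) a * basis (h + i) c)"
    using sum.permute[OF matchings_perm[OF \<omega>], of "\<lambda>i. basis (h + i) a * basis (h + i) c"] by (simp add: comp_def)
  also have "(\<Sum>i<h. basis i a * basis i c) + (\<Sum>i<h. basis (h + i) a * basis (h + i) c)
      = (\<Sum>i<2*h. basis i a * basis i c)"
    using sum_halves[of h "2 * h" "\<lambda>i. basis i a * basis i c"] by (simp add: sum.distrib)
  also have "\<dots> = (\<Sum>i<2*h. if a = i then if a = c then 1 else 0 else 0)"
    by (intro sum.cong refl) (auto simp: basis_def)
  also have "\<dots> = (if a = c \<and> a < 2 * h then 1 else 0)" by simp
  finally show ?thesis .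
qed

text \<open>The product (I - \<delta> X)(I + \<delta> X) = I - \<delta>^2 X^2 is diagonal by
  \<open>exch_square\<close>; dividing row \<open>a\<close> by its diagonal entry gives the left
  inverse that proves full rank on the block.\<close>

lemma tilted_state_inverse:
  assumes \<omega>: "\<omega> \<in> matchings h" and h: "2 * h \<le> r" and \<delta>: "\<bar>\<delta>\<bar> < 1" and r: "0 < r"
    and R: "\<And>a b. a < r \<Longrightarrow> R a b = (basis a b + \<delta> * exch h \<omega> a b) / real r" and ac: "a < r" "c < r"
  shows "(\<Sum>b<r. real r * (basis a b - \<delta> * exch h \<omega> a b) / (if a < 2 * h then 1 - \<delta>\<^sup>2 else 1) * R b c)
    = (if a = c then 1 else 0)"
proof -
  define D where "D = (if a < 2 * h then 1 - \<delta>\<^sup>2 else 1)"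
  have "\<delta>\<^sup>2 < 1" using \<delta> by (simp add: abs_square_less_1)
  then have D: "D \<noteq> 0" by (simp add: D_def)
  have b1: "(\<Sum>b<r. basis a b * f b) = f a" for f :: "nat \<Rightarrow> real"
    using basis_sum_right[OF ac(1), of f] by (simp add: mult.commute)
  have "(\<Sum>b<r. real r * (basis a b - \<delta> * exch h \<omega> a b) / D * R b c)
      = (\<Sum>b<r. (basis a b - \<delta> * exch h \<omega> a b) * (basis b c + \<delta> * exch h \<omega> b c)) / D"
    unfolding sum_divide_distrib using r by (intro sum.cong refl) (simp add: R)
  also have "(\<Sum>b<r. (basis a b - \<delta> * exch h \<omega> a b) * (basis b c + \<delta> * exch h \<omega> b c))
      = (\<Sum>b<r. basis a b * basis b c) + \<delta> * (\<Sum>b<r. basis a b * exch h \<omega> b c)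
        - \<delta> * (\<Sum>b<r. exch h \<omega> a b * basis c b) - \<delta>\<^sup>2 * (\<Sum>b<r. exch h \<omega> a b * exch h \<omega> b c)"
    unfolding sum_distrib_left sum.distrib[symmetric] sum_subtractf[symmetric]
    by (intro sum.cong refl) (auto simp: algebra_simps power2_eq_square basis_def)
  also have "\<dots> = basis a c - \<delta>\<^sup>2 * (if a = c \<and> a < 2 * h then 1 else 0)"
    unfolding b1 basis_sum_right[OF ac(2)] exch_square[OF \<omega> h ac(1)] by simp
  also have "\<dots> = (if a = c then D else 0)" by (auto simp: D_def basis_def)
  finally show ?thesis using D unfolding D_def[symmetric] by simp
qed

lemma tilted_trace_dist:
  assumes \<omega>: "\<omega> \<in> matchings h" and h: "2 * h \<le> r" and \<delta>: "0 < \<delta>" and r: "0 < r" "r < n"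
    and R: "\<And>a b. a < r \<Longrightarrow> R a b = (basis a b + \<delta> * exch h \<omega> a b) / real r"
    and R': "\<And>a b. a < r \<Longrightarrow> R' a b = basis a b / real r"
  shows "trace_dist (embed_state n r R) (embed_state n r R') = \<delta> * real h / real r"
proof -
  have D: "R a b - R' a b = \<delta> / real r * exch h \<omega> a b" if "a < r" for a b
    using that r by (simp add: R R' diff_divide_distrib[symmetric])
  have "trace_dist (embed_state n r R) (embed_state n r R') = \<delta> / real r * real (card {..<2*h}) / 2"
  proof (rule trace_dist_embed[OF r(2)])
    show "{..<2*h} \<subseteq> {..<r}" using h by auto
    show "0 < \<delta> / real r" using \<delta> r by simp
    show "R a b - R' a b = R b a - R' b a" if "a < r" "b < r" for a b
      using that exch_sym[of h \<omega> a b] by (simp add: D)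
    show "(\<Sum>b<r. (R a b - R' a b) * (R b e - R' b e)) = (if a = e \<and> a \<in> {..<2*h} then (\<delta> / real r)\<^sup>2 else 0)"
      if "a < r" "e < r" for a e
    proof -
      have "(\<Sum>b<r. (R a b - R' a b) * (R b e - R' b e))
          = (\<delta> / real r)\<^sup>2 * (\<Sum>b<r. exch h \<omega> a b * exch h \<omega> b e)"
        unfolding sum_distrib_left using that
        by (intro sum.cong refl) (simp add: D power2_eq_square)
      then show ?thesis using exch_square[OF \<omega> h that(1)] by simp
    qed
  qed
  then show ?thesis by simp
qed

lemma trace_dist_self:
  assumes "r < n"
  shows "trace_dist (embed_state n r R) (embed_state n r R) = 0"
  using trace_dist_embed[OF assms, of "{}" 1 R R] by simp

section \<open>The lower bound\<close>

text \<open>The event is a fixed set of basis outcomes, so that it can be followed across oracles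
  with different true distances.\<close>

definition outcome_prob :: "nat \<Rightarrow> nat \<Rightarrow> qalg \<Rightarrow> nat set \<Rightarrow> (nat \<Rightarrow> real) \<Rightarrow> (nat \<Rightarrow> real) \<Rightarrow> real" where
  "outcome_prob n m A E \<chi> \<eta> = (\<Sum>j \<in> {j. j < wdim A * (n*m) \<and> j \<in> E}.
     (cmod (final_state n m A (House (n*m) (\<lambda>h. complex_of_real (\<chi> h)))
        (House (n*m) (\<lambda>h. complex_of_real (\<eta> h))) $ j))\<^sup>2)"

definition half_unit :: "nat \<Rightarrow> (nat \<Rightarrow> real) \<Rightarrow> bool" where
  "half_unit d \<chi> \<longleftrightarrow> sqn {..<d} (\<lambda>h. complex_of_real (\<chi> h)) = 1"

abbreviation "refl_state n m \<chi> \<equiv> oracle_state n m (House (n*m) (\<lambda>h. complex_of_real (\<chi> h)))"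

lemma solves_success:
  assumes "solves_TDE n m r \<epsilon> A" "half_unit (n*m) \<chi>" "half_unit (n*m) \<eta>"
    and "mat_rank n (refl_state n m \<chi>) = r" "mat_rank n (refl_state n m \<eta>) = r"
  shows "2 / 3 \<le> outcome_prob n m A {j. \<bar>outp A j - trace_dist (refl_state n m \<chi>) (refl_state n m \<eta>)\<bar> \<le> \<epsilon>} \<chi> \<eta>"
  using assms unfolding solves_TDE_def half_unit_def outcome_prob_def success_prob_def
  by (simp add: unitary_House)

lemma outcome_prob_total:
  assumes "solves_TDE n m r \<epsilon> A" "0 < n * m" "half_unit (n*m) \<chi>" "half_unit (n*m) \<eta>" "E \<inter> E' = {}"
  shows "outcome_prob n m A E \<chi> \<eta> + outcome_prob n m A E' \<chi> \<eta> \<le> 1"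
proof -
  let ?D = "wdim A * (n*m)"
  let ?f = "\<lambda>j. (cmod (final_state n m A (House (n*m) (\<lambda>h. complex_of_real (\<chi> h)))
        (House (n*m) (\<lambda>h. complex_of_real (\<eta> h))) $ j))\<^sup>2"
  have "outcome_prob n m A E \<chi> \<eta> + outcome_prob n m A E' \<chi> \<eta>
      = (\<Sum>j \<in> {j. j < ?D \<and> j \<in> E} \<union> {j. j < ?D \<and> j \<in> E'}. ?f j)"
    unfolding outcome_prob_def using assms(5) by (intro sum.union_disjoint[symmetric]) auto
  also have "\<dots> \<le> (\<Sum>j<?D. ?f j)"
    by (rule sum_mono2) auto
  also have "\<dots> = 1"
    using nrm_alg_state[of n m A "\<lambda>h. complex_of_real (\<chi> h)" "\<lambda>h. complex_of_real (\<eta> h)" "nq A"] assms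
    by (simp add: half_unit_def solves_TDE_def sqn_def final_state_def)
  finally show ?thesis .
qed

text \<open>Estimates within \<epsilon> of 0 and within \<epsilon> of a distance above 2 \<epsilon>
  are disjoint events, so success on the second leaves at most 1/3 for the first.\<close>

lemma solves_gap:
  assumes A: "solves_TDE n m r \<epsilon> A" and nm: "0 < n * m" and unit: "half_unit (n*m) \<chi>" "half_unit (n*m) \<eta>"
    and rank: "mat_rank n (refl_state n m \<chi>) = r" "mat_rank n (refl_state n m \<eta>) = r"
  shows "trace_dist (refl_state n m \<chi>) (refl_state n m \<eta>) = 0
      \<Longrightarrow> 2 / 3 \<le> outcome_prob n m A {j. \<bar>outp A j\<bar> \<le> \<epsilon>} \<chi> \<eta>"
    and "2 * \<epsilon> < trace_dist (refl_state n m \<chi>) (refl_state n m \<eta>)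
      \<Longrightarrow> outcome_prob n m A {j. \<bar>outp A j\<bar> \<le> \<epsilon>} \<chi> \<eta> \<le> 1 / 3"
proof -
  let ?t = "trace_dist (refl_state n m \<chi>) (refl_state n m \<eta>)"
  note s = solves_success[OF A unit rank]
  show "2 / 3 \<le> outcome_prob n m A {j. \<bar>outp A j\<bar> \<le> \<epsilon>} \<chi> \<eta>" if "?t = 0"
    using s that by simp
  show "outcome_prob n m A {j. \<bar>outp A j\<bar> \<le> \<epsilon>} \<chi> \<eta> \<le> 1 / 3" if "2 * \<epsilon> < ?t"
  proof -
    have "{j. \<bar>outp A j\<bar> \<le> \<epsilon>} \<inter> {j. \<bar>outp A j - ?t\<bar> \<le> \<epsilon>} = {}"
      using that by (auto simp: abs_le_iff)
    from outcome_prob_total[OF A nm unit this] s show ?thesis by simp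
  qed
qed

lemma outcome_prob_simulation:
  assumes A: "solves_TDE n m r \<epsilon> A" and nm: "0 < n * m" and unit: "half_unit (n*m) \<chi>" "half_unit (n*m) \<eta>"
  shows "\<bar>outcome_prob n m A E \<chi> \<eta> - sqn (joint (wdim A) (n*m) K)
      (sim_accept (n*m) K A (\<lambda>h. complex_of_real (\<eta> h)) E (\<lambda>y. \<Prod>l\<in>{1..K}. complex_of_real (\<chi> (y l))))\<bar>
    \<le> 4 * real (nq A) / sqrt (real (Suc K))"
  using query_simulation[of n m A "\<lambda>h. complex_of_real (\<chi> h)" "\<lambda>h. complex_of_real (\<eta> h)" E K] assms
  by (simp add: outcome_prob_def half_unit_def solves_TDE_def del: One_nat_def of_nat_Suc)

context purification
begin

lemma unit_tilted:
  assumes "\<omega> \<in> matchings h" "2 * h \<le> r" "x\<^sup>2 + y\<^sup>2 = 1"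
  shows "unit_family (tilted h x y \<omega>)"
  using tilted_unit[OF assms] by (simp add: unit_family_def)

lemma rho_tilted:
  assumes "\<omega> \<in> matchings h" "2 * h \<le> r" "x\<^sup>2 + y\<^sup>2 = 1" "a < r"
  shows "rho (tilted h x y \<omega>) a a' = (basis a a' + 2 * x * y * exch h \<omega> a a') / real r"
  by (simp add: rho_def tilted_gram[OF assms])

lemma rank_tilted:
  assumes \<omega>: "\<omega> \<in> matchings h" and h: "2 * h \<le> r" and xy: "x\<^sup>2 + y\<^sup>2 = 1" "\<bar>2 * x * y\<bar> < 1"
  shows "mat_rank n (embed_state n r (rho (tilted h x y \<omega>))) = r"
  by (rule mat_rank_embed[OF n], rule tilted_state_inverse[OF \<omega> h xy(2) r])
    (simp_all add: rho_tilted[OF \<omega> h xy(1)])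

text \<open>Up to the simulation error 4Q/sqrt(K+1), the untilted oracle is accepted with
  probability at least 2/3 and every tilted one with at most 1/3. After averaging the two differ by
  at most 1/10 + 2K/sqrt L, so the simulation errors must account for the rest of the gap
  1/3.\<close>

lemma query_lower_bound:
  assumes A: "solves_TDE n m r \<epsilon> A" and h: "2 * h \<le> r"
    and \<delta>: "0 < \<delta>" "\<delta> < 1" "2 * \<epsilon> < \<delta> * real h / real r"
    and K: "2 * real K * \<delta>\<^sup>2 / real r \<le> 1 / 20"
  shows "1 / 3 \<le> 8 * real (nq A) / sqrt (real (Suc K)) + 1 / 10 + 2 * (real K / sqrt (real L))"
proof -
  \<comment> \<open>Chosen so that 2xy = sin(2 \<theta>) = \<delta>.\<close>
  define \<theta> where "\<theta> = arcsin \<delta> / 2"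
  define x y where "x = cos \<theta>" and "y = sin \<theta>"
  have xy: "x\<^sup>2 + y\<^sup>2 = 1" by (simp add: x_def y_def)
  have xy\<delta>: "2 * x * y = \<delta>"
  proof -
    have "2 * x * y = sin (2 * \<theta>)" by (simp add: sin_double x_def y_def)
    then show ?thesis using \<delta> by (simp add: \<theta>_def)
  qed
  obtain \<omega>0 where \<omega>0: "\<omega>0 \<in> matchings h" using matchings_nonempty by blast
  let ?\<Omega> = "matchings h"
  \<comment> \<open>Without tilt the ensemble consists of basis vectors in some order, so any
    matching yields I/r.\<close>
  define v0 where "v0 = tilted h 1 0 \<omega>0"
  define v where "v = tilted h x y"
  \<comment> \<open>The second oracle can be a single fixed purification, here with all signs 1 and
    all shifts 0, because its queries are simulated exactly.\<close>
  define g0 where "g0 = (\<lambda>b\<in>{..<L*r}. 1 :: real)"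
  define \<eta> where "\<eta> = chi v0 g0 (\<lambda>_. 0)"
  define E where "E = {j. \<bar>outp A j\<bar> \<le> \<epsilon>}"
  define G where "G = sim_accept (n*m) K A (\<lambda>h. complex_of_real (\<eta> h)) E"
  let ?T = "joint (wdim A) (n*m) K" and ?N = "real (card ?\<Omega>)"
  let ?c = "4 * real (nq A) / sqrt (real (Suc K))"
  have nm: "0 < n * m" using n m0 by simp
  have g0: "g0 \<in> signs {..<L*r}" by (simp add: g0_def signs_def)
  have u0: "unit_family v0" unfolding v0_def by (rule unit_tilted[OF \<omega>0 h]) simp
  have uv: "unit_family (v \<omega>)" if "\<omega> \<in> ?\<Omega>" for \<omega>
    unfolding v_def by (rule unit_tilted[OF that h xy])
  have rho0: "rho v0 a a' = basis a a' / real r" if "a < r" for a a'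
    using rho_tilted[OF \<omega>0 h, of 1 0 a a'] that by (simp add: v0_def)
  have rhov: "rho (v \<omega>) a a' = (basis a a' + \<delta> * exch h \<omega> a a') / real r" if "\<omega> \<in> ?\<Omega>" "a < r" for \<omega> a a'
    using rho_tilted[OF that(1) h xy that(2), of a'] by (simp only: v_def xy\<delta>)
  have rank0: "mat_rank n (embed_state n r (rho v0)) = r"
    unfolding v0_def by (rule rank_tilted[OF \<omega>0 h]) simp_all
  have rankv: "mat_rank n (embed_state n r (rho (v \<omega>))) = r" if "\<omega> \<in> ?\<Omega>" for \<omega>
    unfolding v_def by (rule rank_tilted[OF that h xy]) (use xy\<delta> \<delta> in simp)
  have hu: "half_unit (n*m) (chi w g u)" if "unit_family w" "g \<in> signs {..<L*r}" for w g u
    unfolding half_unit_def by (rule sqn_chi[OF that])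
  have unit\<eta>: "half_unit (n*m) \<eta>" unfolding \<eta>_def by (rule hu[OF u0 g0])
  have state\<eta>: "refl_state n m \<eta> = embed_state n r (rho v0)"
    unfolding \<eta>_def by (rule oracle_state_chi[OF g0])
  have base: "2 / 3 - ?c \<le> sqn ?T (G (chi_copies v0 g u))" if g: "g \<in> signs {..<L*r}" for g u
  proof -
    have st: "refl_state n m (chi v0 g u) = embed_state n r (rho v0)" by (rule oracle_state_chi[OF g])
    have "2 / 3 \<le> outcome_prob n m A E (chi v0 g u) \<eta>"
      unfolding E_def
      by (rule solves_gap(1)[OF A nm hu[OF u0 g] unit\<eta>])
        (simp_all only: st state\<eta> rank0 trace_dist_self[OF n])
    then show ?thesis
      using outcome_prob_simulation[OF A nm hu[OF u0 g, of u] unit\<eta>, of E K] unfolding G_def by linarith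
  qed
  have far: "sqn ?T (G (chi_copies (v \<omega>) g u)) \<le> 1 / 3 + ?c" if \<omega>: "\<omega> \<in> ?\<Omega>" and g: "g \<in> signs {..<L*r}" for \<omega> g u
  proof -
    have st: "refl_state n m (chi (v \<omega>) g u) = embed_state n r (rho (v \<omega>))" by (rule oracle_state_chi[OF g])
    have td: "trace_dist (embed_state n r (rho (v \<omega>))) (embed_state n r (rho v0)) = \<delta> * real h / real r"
      by (rule tilted_trace_dist[OF \<omega> h \<delta>(1) r n]) (simp_all only: rhov[OF \<omega>] rho0)
    have "outcome_prob n m A E (chi (v \<omega>) g u) \<eta> \<le> 1 / 3"
      unfolding E_def
      by (rule solves_gap(2)[OF A nm hu[OF uv[OF \<omega>] g] unit\<eta>])
        (simp_all only: st state\<eta> rank0 rankv[OF \<omega>] td \<delta>(3))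
    then show ?thesis
      using outcome_prob_simulation[OF A nm hu[OF uv[OF \<omega>] g, of u] unit\<eta>, of E K] unfolding G_def by linarith
  qed
  have "2 / 3 - ?c \<le> Avg (\<lambda>g u. sqn ?T (G (chi_copies v0 g u)))"
    using Avg_mono[of "\<lambda>g u. 2 / 3 - ?c" "\<lambda>g u. sqn ?T (G (chi_copies v0 g u))"] base
    unfolding Avg_const by blast
  moreover have "(\<Sum>\<omega>\<in>?\<Omega>. Avg (\<lambda>g u. sqn ?T (G (chi_copies (v \<omega>) g u)))) / ?N \<le> 1 / 3 + ?c"
  proof -
    have "Avg (\<lambda>g u. sqn ?T (G (chi_copies (v \<omega>) g u))) \<le> 1 / 3 + ?c" if "\<omega> \<in> ?\<Omega>" for \<omega>
      using Avg_mono[of "\<lambda>g u. sqn ?T (G (chi_copies (v \<omega>) g u))" "\<lambda>g u. 1 / 3 + ?c"] far[OF that]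
      unfolding Avg_const by blast
    then have "(\<Sum>\<omega>\<in>?\<Omega>. Avg (\<lambda>g u. sqn ?T (G (chi_copies (v \<omega>) g u)))) \<le> ?N * (1 / 3 + ?c)"
      by (rule sum_bounded_above)
    moreover have "0 < ?N" using matchings_nonempty[of h] by (simp add: card_gt_0_iff)
    ultimately show ?thesis by (simp add: pos_divide_le_eq mult.commute)
  qed
  moreover have "\<bar>(\<Sum>\<omega>\<in>?\<Omega>. Avg (\<lambda>g u. sqn ?T (G (chi_copies (v \<omega>) g u)))) / ?N
      - Avg (\<lambda>g u. sqn ?T (G (chi_copies v0 g u)))\<bar> \<le> 1 / 10 + 2 * (real K / sqrt (real L))"
  proof (rule ensemble_indistinguishable)
    show "lin G" unfolding G_def by (rule lin_sim_accept)
    show "nrm ?T (G f) \<le> nrm (copies (n*m) K) f" for f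
      unfolding G_def using A nm unit\<eta> by (intro nrm_sim_accept) (auto simp: solves_TDE_def half_unit_def)
    fix J assume J: "J \<in> cells" "card J \<le> K"
    have "2 * real (card J) * \<delta>\<^sup>2 / real r \<le> 2 * real K * \<delta>\<^sup>2 / real r"
      using J(2) by (intro divide_right_mono mult_right_mono) auto
    then have \<mu>: "2 * real (card J) * \<delta>\<^sup>2 / real r \<le> 1 / 20" using K by linarith
    have "(\<Sum>\<alpha>\<in>labellings J. \<Sum>\<alpha>'\<in>labellings J.
        ((\<Sum>\<omega>\<in>?\<Omega>. \<Prod>b\<in>J. rho (v \<omega>) (\<alpha> b) (\<alpha>' b)) / ?N - (\<Prod>b\<in>J. rho v0 (\<alpha> b) (\<alpha>' b)))\<^sup>2)
      = (\<Sum>\<alpha>\<in>labellings J. \<Sum>\<alpha>'\<in>labellings J.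
        ((\<Sum>\<omega>\<in>?\<Omega>. \<Prod>b\<in>J. rho (v \<omega>) (\<alpha> b) (\<alpha>' b)) / ?N - (\<Prod>b\<in>J. basis (\<alpha> b) (\<alpha>' b) / real r))\<^sup>2)"
    proof (intro sum.cong refl)
      fix \<alpha> \<alpha>' assume "\<alpha> \<in> labellings J"
      then have "(\<Prod>b\<in>J. rho v0 (\<alpha> b) (\<alpha>' b)) = (\<Prod>b\<in>J. basis (\<alpha> b) (\<alpha>' b) / real r)"
        by (intro prod.cong refl rho0) (auto simp: labellings_def)
      then show "((\<Sum>\<omega>\<in>?\<Omega>. \<Prod>b\<in>J. rho (v \<omega>) (\<alpha> b) (\<alpha>' b)) / ?N - (\<Prod>b\<in>J. rho v0 (\<alpha> b) (\<alpha>' b)))\<^sup>2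
        = ((\<Sum>\<omega>\<in>?\<Omega>. \<Prod>b\<in>J. rho (v \<omega>) (\<alpha> b) (\<alpha>' b)) / ?N - (\<Prod>b\<in>J. basis (\<alpha> b) (\<alpha>' b) / real r))\<^sup>2"
        by (simp only:)
    qed
    \<comment> \<open>Here 2 (1/20)^2 = 1/200, which is below the required (1/10)^2.\<close>
    moreover have "real r ^ card J * (\<Sum>\<alpha>\<in>labellings J. \<Sum>\<alpha>'\<in>labellings J.
        ((\<Sum>\<omega>\<in>?\<Omega>. \<Prod>b\<in>J. rho (v \<omega>) (\<alpha> b) (\<alpha>' b)) / ?N - (\<Prod>b\<in>J. basis (\<alpha> b) (\<alpha>' b) / real r))\<^sup>2)
      \<le> 2 * (1 / 20)\<^sup>2"
      unfolding labellings_def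
      by (rule tilted_chi_square[OF r h _ _ cells_finite[OF J(1)] \<mu>]) (use \<delta> rhov in auto)
    ultimately show "real r ^ card J * (\<Sum>\<alpha>\<in>labellings J. \<Sum>\<alpha>'\<in>labellings J.
        ((\<Sum>\<omega>\<in>?\<Omega>. \<Prod>b\<in>J. rho (v \<omega>) (\<alpha> b) (\<alpha>' b)) / ?N - (\<Prod>b\<in>J. rho v0 (\<alpha> b) (\<alpha>' b)))\<^sup>2)
      \<le> (1 / 10)\<^sup>2"
      by (simp add: power2_eq_square)
  qed (use uv u0 matchings_nonempty in auto)
  moreover have "8 * real (nq A) / sqrt (real (Suc K)) = ?c + ?c" by (simp add: field_simps)
  ultimately show ?thesis unfolding abs_le_iff by argo
qed

end

text \<open>The choice of \<open>q\<close> gives 2 q \<delta>^2 / r = 1/20, and L > (60K)^2 gives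
  2K/sqrt L <= 1/30. From 1/3 - 1/10 - 1/30 = 1/5 follows 40 Q >= sqrt(K+1) for Q queries. Finally q
  = r/(1960 \<epsilon>^2) with 1960 <= 45^2, and 40 * 45 = 1800. The bound \<open>N\<close> makes
  room for the \<open>L * r\<close> labels in B and the extra index in A.\<close>

lemma lower_bound_rank_ge_2:
  assumes r: "2 \<le> r" and \<epsilon>: "0 < \<epsilon>" "\<epsilon> < 1 / 14"
  shows "\<exists>N. \<forall>n m A. N \<le> n \<and> N \<le> m \<and> solves_TDE n m r \<epsilon> A \<longrightarrow> sqrt (real r) / (1800 * \<epsilon>) \<le> real (nq A)"
proof -
  define \<delta> where "\<delta> = 7 * \<epsilon>"
  define q where "q = real r / (40 * \<delta>\<^sup>2)"
  define K where "K = nat \<lfloor>q\<rfloor>"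
  define L where "L = (60 * K)\<^sup>2 + 1"
  have q0: "0 \<le> q" by (simp add: q_def)
  \<comment> \<open>Equality holds at r = 3. The distance \<delta> h / r with h = r div 2 is
    therefore at least \<delta>/3, and the factor 7 in \<delta> is the first integer that lifts this
    above 2 \<epsilon>.\<close>
  have "r \<le> 3 * (r div 2)" using r by presburger
  then have h3: "real r \<le> 3 * real (r div 2)" by linarith
  have h0: "0 < real (r div 2)" using r by simp
  have Kq: "real K \<le> q" "q \<le> real (Suc K)"
    using q0 by (simp_all add: K_def) linarith
  have "sqrt (real r) / (1800 * \<epsilon>) \<le> real (nq A)"
    if n: "Suc r \<le> n" and m: "L * r \<le> m" and A: "solves_TDE n m r \<epsilon> A" for n m A
  proof -
    interpret purification n m r L K
      using n m r by unfold_locales (auto simp: L_def)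
    have h: "2 * (r div 2) \<le> r" by simp
    have \<delta>: "0 < \<delta>" "\<delta> < 1" using \<epsilon> by (simp_all add: \<delta>_def)
    have far: "2 * \<epsilon> < \<delta> * real (r div 2) / real r"
    proof -
      have "2 * \<epsilon> * real r \<le> 2 * \<epsilon> * (3 * real (r div 2))" using h3 \<epsilon> by (intro mult_left_mono) auto
      also have "\<dots> < 7 * \<epsilon> * real (r div 2)" using mult_pos_pos[OF \<epsilon>(1) h0] by simp
      finally show ?thesis using r by (simp add: \<delta>_def pos_less_divide_eq)
    qed
    have "2 * real K * \<delta>\<^sup>2 / real r \<le> 2 * q * \<delta>\<^sup>2 / real r"
      using Kq by (intro divide_right_mono mult_right_mono) auto
    also have "\<dots> = 1 / 20" using \<delta> r by (simp add: q_def)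
    finally have "1 / 3 \<le> 8 * real (nq A) / sqrt (real (Suc K)) + 1 / 10 + 2 * (real K / sqrt (real L))"
      by (rule query_lower_bound[OF A h \<delta> far])
    moreover have "real K / sqrt (real L) \<le> 1 / 60"
    proof -
      have "60 * real K \<le> sqrt (real L)" by (rule real_le_rsqrt) (simp add: L_def power_mult_distrib)
      moreover have "0 < sqrt (real L)" using L by simp
      ultimately show ?thesis by (simp add: pos_divide_le_eq)
    qed
    ultimately have "1 / 5 \<le> 8 * real (nq A) / sqrt (real (Suc K))" by argo
    then have "sqrt (real (Suc K)) \<le> 40 * real (nq A)"
      by (simp add: pos_le_divide_eq)
    moreover have "sqrt (real r) / (45 * \<epsilon>) \<le> sqrt (real (Suc K))"
    proof (rule real_le_rsqrt)
      have "(sqrt (real r) / (45 * \<epsilon>))\<^sup>2 = real r / (2025 * \<epsilon>\<^sup>2)"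
        by (simp add: power_divide power_mult_distrib)
      also have "\<dots> \<le> real r / (1960 * \<epsilon>\<^sup>2)" using \<epsilon> by (intro divide_left_mono) auto
      also have "\<dots> = q" by (simp add: q_def \<delta>_def power_mult_distrib)
      finally show "(sqrt (real r) / (45 * \<epsilon>))\<^sup>2 \<le> real (Suc K)" using Kq by linarith
    qed
    ultimately have "sqrt (real r) / (45 * \<epsilon>) \<le> 40 * real (nq A)" by linarith
    then show ?thesis using \<epsilon> by (simp add: field_simps)
  qed
  then show ?thesis by (intro exI[of _ "max (Suc r) (L * r)"]) auto
qed

section \<open>Rank one: two pure states\<close>

text \<open>The vector \<chi> for the purification (w_0 |1> + w_1 |2>)|0>, whose basis indices are
  \<open>m\<close> and \<open>2 * m\<close>. A separate family is used because with r = 1 there is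
  no pair of indices to exchange.\<close>

definition pure :: "nat \<Rightarrow> (nat \<Rightarrow> real) \<Rightarrow> nat \<Rightarrow> real" where
  "pure m w h = (if h = 0 then 1 / sqrt 2 else if h = m then - w 0 / sqrt 2
     else if h = 2 * m then - w 1 / sqrt 2 else 0)"

lemma lessThan_2: "{..<2::nat} = {0, 1}" by auto

lemma ip_pure:
  assumes n: "2 < n" and m: "0 < m"
  shows "ip {..<n*m} (\<lambda>h. complex_of_real (pure m w h)) (\<lambda>h. complex_of_real (pure m w' h))
    = complex_of_real ((1 + w 0 * w' 0 + w 1 * w' 1) / 2)"
proof -
  have sub: "{0, m, 2 * m} \<subseteq> {..<n*m}"
    using n m by auto
  have "(\<Sum>h<n*m. pure m w h * pure m w' h) = (\<Sum>h\<in>{0, m, 2*m}. pure m w h * pure m w' h)"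
    using sub by (intro sum.mono_neutral_right) (auto simp: pure_def)
  also have "\<dots> = (1 + w 0 * w' 0 + w 1 * w' 1) / 2"
    using m by (simp add: pure_def add_divide_distrib)
  finally have "complex_of_real (\<Sum>h<n*m. pure m w h * pure m w' h) = complex_of_real ((1 + w 0 * w' 0 + w 1 * w' 1) / 2)"
    by (rule arg_cong)
  then show ?thesis by (simp add: ip_def)
qed

lemma half_unit_pure:
  assumes "2 < n" "0 < m" "(w 0)\<^sup>2 + (w 1)\<^sup>2 = 1"
  shows "half_unit (n*m) (pure m w)"
proof -
  have "complex_of_real (sqn {..<n*m} (\<lambda>h. complex_of_real (pure m w h)))
      = complex_of_real ((1 + ((w 0)\<^sup>2 + (w 1)\<^sup>2)) / 2)"
    unfolding ip_self[symmetric] ip_pure[OF assms(1,2)] by (simp add: power2_eq_square add.assoc)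
  then show ?thesis unfolding half_unit_def assms(3) of_real_eq_iff by simp
qed

lemma refl_state_pure:
  assumes n: "2 < n" and m: "0 < m"
  shows "refl_state n m (pure m w) = embed_state n 2 (\<lambda>a b. w a * w b)"
proof (rule eq_matI)
  let ?U = "House (n*m) (\<lambda>h. complex_of_real (pure m w h))"
  fix i i' assume "i < dim_row (embed_state n 2 (\<lambda>a b. w a * w b))" "i' < dim_col (embed_state n 2 (\<lambda>a b. w a * w b))"
  then have i: "i < n" "i' < n" by (auto simp: embed_state_def)
  have col: "?U $$ (i*m+j, 0) = (if j = 0 then if i \<in> {1..2} then complex_of_real (w (i - 1)) else 0 else 0)"
    if "i < n" "j < m" for i j
  proof -
    have less: "i*m+j < n*m" by (rule pair_index_less[OF that])
    have dm: "(i*m+j) div m = i" "(i*m+j) mod m = j" using that by auto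
    have c: "?U $$ (i*m+j, 0) = complex_of_real (if i*m+j = 0 then 0 else - sqrt 2 * pure m w (i*m+j))"
      by (rule House_column_0[OF less]) (simp add: pure_def)
    show ?thesis
    proof (cases "j = 0 \<and> i \<in> {1..2}")
      case True
      then have "i = 1 \<or> i = 2" by auto
      then show ?thesis unfolding c using True m by (auto simp: pure_def)
    next
      case False
      have "i*m+j \<noteq> m" using False dm by (metis atLeastAtMost_iff div_self m less_numeral_extra(3) mod_self one_le_numeral order_refl)
      moreover have "i*m+j \<noteq> 2 * m"
        using False dm by (metis atLeastAtMost_iff mod_mult_self2_is_0 nonzero_mult_div_cancel_right m less_numeral_extra(3) one_le_numeral order_refl)
      ultimately show ?thesis unfolding c using False by (auto simp: pure_def)
    qed
  qed
  have "refl_state n m (pure m w) $$ (i, i') = (\<Sum>j<m. ?U $$ (i*m+j, 0) * cnj (?U $$ (i'*m+j, 0)))"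
    by (rule oracle_state_index) (use i in auto)
  also have "\<dots> = (\<Sum>j<m. if j = 0 then embed_state n 2 (\<lambda>a b. w a * w b) $$ (i, i') else 0)"
    using i by (intro sum.cong refl) (auto simp: col embed_index)
  finally show "refl_state n m (pure m w) $$ (i, i') = embed_state n 2 (\<lambda>a b. w a * w b) $$ (i, i')"
    using m by simp
qed (auto simp: embed_state_def oracle_state_def partial_trace_B_def)

lemma mat_rank_pure:
  assumes n: "2 < n" and w: "w 0 \<noteq> 0"
  shows "mat_rank n (embed_state n 2 (\<lambda>a b. w a * w b)) = 1"
proof -
  interpret vec_space "TYPE(complex)" n .
  let ?A = "embed_state n 2 (\<lambda>a b. w a * w b)"
  let ?f = "\<lambda>i. if i \<in> {1..2} then complex_of_real (w (i - 1)) else 0"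
  have "rank ?A \<le> 1"
    by (rule rank_le_1_product_entries[of _ n ?f ?f]) (auto simp: embed_state_def)
  moreover have "card (col ?A ` {1}) \<le> rank ?A"
  proof (rule rank_ge_card_indpt[OF embed_carrier])
    have "set (cols ?A) = col ?A ` {0..<n}"
      using carrier_matD(2)[OF embed_carrier, of n 2 "\<lambda>a b. w a * w b"] by (simp add: cols_def)
    then show "col ?A ` {1} \<subseteq> set (cols ?A)" using n by auto
    show "lin_indpt (col ?A ` {1})"
    proof (rule columns_lin_indpt(2)[where nc = n])
      fix c assume c: "\<And>i. i < n \<Longrightarrow> (\<Sum>j\<in>{1}. c j * ?A $$ (i, j)) = 0"
      show "\<forall>j\<in>{1}. c j = 0" using c[of 1] n w by (auto simp: embed_index)
    qed (use n in auto)
  qed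
  ultimately show ?thesis by (simp add: mat_rank_def)
qed

text \<open>The difference of the projections onto two lines at an angle with sine \<open>y\<close>
  squares to y^2 times the identity of their plane, so \<open>trace_dist_embed\<close> applies with
  both coordinates in its set.\<close>

lemma trace_dist_pure:
  assumes n: "2 < n" and xy: "x\<^sup>2 + y\<^sup>2 = 1" "0 < y"
    and w: "w 0 = x" "w 1 = y" and w': "w' 0 = 1" "w' 1 = 0"
  shows "trace_dist (embed_state n 2 (\<lambda>a b. w a * w b)) (embed_state n 2 (\<lambda>a b. w' a * w' b)) = y"
proof -
  have xx: "x * x = 1 - y * y" using xy(1) by (simp add: power2_eq_square)
  have "trace_dist (embed_state n 2 (\<lambda>a b. w a * w b)) (embed_state n 2 (\<lambda>a b. w' a * w' b)) = y * real (card {..<2::nat}) / 2"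
  proof (rule trace_dist_embed[OF n _ xy(2)])
    fix a e :: nat assume "a < 2" "e < 2"
    then consider "a = 0" "e = 0" | "a = 0" "e = 1" | "a = 1" "e = 0" | "a = 1" "e = 1" by linarith
    then show "(\<Sum>b<2. (w a * w b - w' a * w' b) * (w b * w e - w' b * w' e))
        = (if a = e \<and> a \<in> {..<2} then y\<^sup>2 else 0)"
    proof cases
      case 1
      have "(x * x - 1) * (x * x - 1) + x * y * (y * x) = (x * x - 1) * (x * x - 1) + (x * x) * (y * y)"
        by (simp add: mult_ac)
      also have "\<dots> = y * y" unfolding xx by (simp add: algebra_simps)
      finally show ?thesis using 1 w w' by (simp add: lessThan_2 power2_eq_square)
    next
      case 2
      have "(x * x - 1) * (x * y) + x * y * (y * y) = x * y * (x * x - 1 + y * y)"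
        by (simp add: algebra_simps)
      also have "\<dots> = 0" unfolding xx by simp
      finally show ?thesis using 2 w w' by (simp add: lessThan_2)
    next
      case 3
      have "y * x * (x * x - 1) + y * y * (y * x) = x * y * (x * x - 1 + y * y)"
        by (simp add: algebra_simps)
      also have "\<dots> = 0" unfolding xx by simp
      finally show ?thesis using 3 w w' by (simp add: lessThan_2)
    next
      case 4
      have "y * x * (x * y) + y * y * (y * y) = (x * x + y * y) * (y * y)"
        by (simp add: algebra_simps)
      also have "\<dots> = y * y" unfolding xx by simp
      finally show ?thesis using 4 w w' by (simp add: lessThan_2 power2_eq_square)
    qed
  qed (auto simp: mult.commute)
  then show ?thesis by simp
qed

lemma ip_copies_prod:
  "ip (copies d K) (\<lambda>y. \<Prod>l\<in>{1..K}. \<chi> (y l)) (\<lambda>y. \<Prod>l\<in>{1..K}. \<chi>' (y l)) = (ip {..<d} \<chi> \<chi>') ^ K"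
proof -
  have "ip (copies d K) (\<lambda>y. \<Prod>l\<in>{1..K}. \<chi> (y l)) (\<lambda>y. \<Prod>l\<in>{1..K}. \<chi>' (y l))
      = (\<Sum>y\<in>PiE {1..K} (\<lambda>_. {..<d}). \<Prod>l\<in>{1..K}. cnj (\<chi> (y l)) * \<chi>' (y l))"
    by (simp add: ip_def copies_def prod.distrib)
  also have "\<dots> = (\<Prod>l\<in>{1..K}. ip {..<d} \<chi> \<chi>')"
    unfolding ip_def by (rule prod_sum_PiE[symmetric]) auto
  finally show ?thesis by simp
qed

text \<open>No averaging is required, as the K-fold products are themselves close. Two of the
  vectors \<chi> have overlap (1+x)/2, and Bernoulli's inequality bounds the squared distance of the
  products by K(1-x) <= K y^2.\<close>

lemma lower_bound_rank_1:
  assumes \<epsilon>: "0 < \<epsilon>" "\<epsilon> < 1 / 14" and n: "2 < n" and m: "0 < m" and A: "solves_TDE n m 1 \<epsilon> A"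
  shows "1 / (2304 * \<epsilon>) \<le> real (nq A)"
proof -
  \<comment> \<open>The sine of the angle is the trace distance; any multiple above 2 \<epsilon>
    would separate the two cases.\<close>
  define y where "y = 3 * \<epsilon>"
  define x where "x = sqrt (1 - y\<^sup>2)"
  \<comment> \<open>Makes q y^2 = (1/24)^2. The acceptance probabilities then differ by at most
    1/12, the simulation errors must cover 1/3 - 1/12 = 1/4, and 72 * 32 = 2304.\<close>
  define q where "q = (1 / (72 * \<epsilon>))\<^sup>2"
  define K where "K = nat \<lfloor>q\<rfloor>"
  have y: "0 < y" "y < 1" using \<epsilon> by (simp_all add: y_def)
  then have y2: "y\<^sup>2 < 1" by (simp add: power_less_one_iff)
  then have x: "0 < x" "x\<^sup>2 = 1 - y\<^sup>2" by (simp_all add: x_def)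
  then have x1: "x \<le> 1" by (simp add: x_def)
  have xy: "x\<^sup>2 + y\<^sup>2 = 1" using x by simp
  define w w' where "w a = (if a = 0 then x else y)" and "w' a = (if a = 0 then 1 else 0 :: real)" for a :: nat
  have Kq: "real K \<le> q" "q \<le> real (Suc K)" by (simp_all add: K_def q_def) linarith
  define E where "E = {j. \<bar>outp A j\<bar> \<le> \<epsilon>}"
  define G where "G = sim_accept (n*m) K A (\<lambda>h. complex_of_real (pure m w' h)) E"
  define C where "C w = (\<lambda>y. \<Prod>l\<in>{1..K}. complex_of_real (pure m w (y l)))" for w
  let ?T = "joint (wdim A) (n*m) K" and ?Y = "copies (n*m) K"
  let ?c = "4 * real (nq A) / sqrt (real (Suc K))"
  have nm: "0 < n * m" using n m by simp
  have u: "half_unit (n*m) (pure m w)" and u': "half_unit (n*m) (pure m w')"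
    by (rule half_unit_pure[OF n m], use xy in \<open>simp add: w_def w'_def\<close>)+
  note st = refl_state_pure[OF n m]
  have rk: "mat_rank n (refl_state n m (pure m w)) = 1" "mat_rank n (refl_state n m (pure m w')) = 1"
    unfolding st by (rule mat_rank_pure[OF n], use x in \<open>simp add: w_def w'_def\<close>)+
  have td: "trace_dist (refl_state n m (pure m w)) (refl_state n m (pure m w')) = y"
    unfolding st by (rule trace_dist_pure[OF n xy y(1)]) (simp_all add: w_def w'_def)
  have "2 / 3 \<le> outcome_prob n m A E (pure m w') (pure m w')"
    unfolding E_def by (rule solves_gap(1)[OF A nm u' u' rk(2) rk(2)]) (simp add: st trace_dist_self[OF n])
  then have base: "2 / 3 - ?c \<le> sqn ?T (G (C w'))"
    using outcome_prob_simulation[OF A nm u' u', of E K] unfolding G_def C_def by linarith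
  have "outcome_prob n m A E (pure m w) (pure m w') \<le> 1 / 3"
    unfolding E_def by (rule solves_gap(2)[OF A nm u u' rk]) (use \<epsilon> in \<open>simp add: td y_def\<close>)
  then have far: "sqn ?T (G (C w)) \<le> 1 / 3 + ?c"
    using outcome_prob_simulation[OF A nm u u', of E K] unfolding G_def C_def by linarith
  have contract: "nrm ?T (G f) \<le> nrm ?Y f" for f
    unfolding G_def using A nm u' by (intro nrm_sim_accept) (auto simp: solves_TDE_def half_unit_def)
  have ipC: "ip ?Y (C a) (C b) = complex_of_real (((1 + a 0 * b 0 + a 1 * b 1) / 2) ^ K)" for a b
    using ip_copies_prod[of "n*m" K "\<lambda>h. complex_of_real (pure m a h)" "\<lambda>h. complex_of_real (pure m b h)"]
    unfolding C_def ip_pure[OF n m] by simp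
  have self: "ip ?Y (C w) (C w) = 1" "ip ?Y (C w') (C w') = 1"
    unfolding ipC using xy by (simp_all add: w_def w'_def power2_eq_square add.assoc)
  then have "sqn ?Y (C w) = 1" "sqn ?Y (C w') = 1"
    by (simp_all add: ip_self)
  then have n1: "nrm ?T (G (C w)) \<le> 1" "nrm ?T (G (C w')) \<le> 1"
    using contract[of "C w"] contract[of "C w'"] by (simp_all add: nrm_def[of ?Y])
  have "sqn ?Y (\<lambda>f. C w' f - C w f) \<le> real K * y\<^sup>2"
  proof -
    have "complex_of_real (sqn ?Y (\<lambda>f. C w' f - C w f)) = complex_of_real (2 - 2 * ((1 + x) / 2) ^ K)"
      unfolding sqn_diff_expand self unfolding ipC by (simp add: w_def w'_def)
    then have "sqn ?Y (\<lambda>f. C w' f - C w f) = 2 - 2 * ((1 + x) / 2) ^ K" by (simp only: of_real_eq_iff)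
    moreover have "1 + real K * ((x - 1) / 2) \<le> (1 + (x - 1) / 2) ^ K"
      by (rule Bernoulli_inequality) (use x in simp)
    moreover have "1 + (x - 1) / 2 = (1 + x) / 2" by (simp add: field_simps)
    moreover have "real K * (1 - x) \<le> real K * y\<^sup>2"
    proof (rule mult_left_mono)
      have "x * x \<le> x * 1" using x x1 by (intro mult_left_mono) auto
      then show "1 - x \<le> y\<^sup>2" using xy by (simp add: power2_eq_square)
    qed simp
    moreover have "real K * ((x - 1) / 2) = - (real K * (1 - x) / 2)" by (simp add: field_simps)
    ultimately show ?thesis by argo
  qed
  also have "\<dots> \<le> q * y\<^sup>2" using Kq by (intro mult_right_mono) auto
  also have "\<dots> = (1 / 24)\<^sup>2" using \<epsilon> by (simp add: q_def y_def power_divide power_mult_distrib)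
  finally have "nrm ?Y (\<lambda>f. C w' f - C w f) \<le> 1 / 24"
    unfolding nrm_def by (intro real_le_lsqrt) simp_all
  moreover have "G (\<lambda>f. C w' f - C w f) = (\<lambda>s. G (C w') s - G (C w) s)"
    by (rule lin_diff[of G "C w'" "C w"]) (simp add: G_def lin_sim_accept)
  ultimately have "nrm ?T (\<lambda>s. G (C w') s - G (C w) s) \<le> 1 / 24"
    using contract[of "\<lambda>f. C w' f - C w f"] by simp
  then have "\<bar>sqn ?T (G (C w')) - sqn ?T (G (C w))\<bar> \<le> 1 / 12"
    using sqn_diff_le[OF n1(2) n1(1)] by simp
  moreover have "8 * real (nq A) / sqrt (real (Suc K)) = ?c + ?c" by (simp add: field_simps)
  ultimately have "1 / 4 \<le> 8 * real (nq A) / sqrt (real (Suc K))"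
    using base far unfolding abs_le_iff by argo
  then have "sqrt (real (Suc K)) \<le> 32 * real (nq A)" by (simp add: pos_le_divide_eq)
  moreover have "1 / (72 * \<epsilon>) \<le> sqrt (real (Suc K))"
    by (rule real_le_rsqrt) (use Kq in \<open>simp add: q_def\<close>)
  ultimately have "1 / (72 * \<epsilon>) \<le> 32 * real (nq A)" by linarith
  then show ?thesis using \<epsilon> by (simp add: field_simps)
qed

theorem theorem2p40:
  shows "\<exists>c > 0. \<exists>\<epsilon>0 > 0. \<forall>r::nat. \<forall>\<epsilon>::real. 1 \<le> r \<and> 0 < \<epsilon> \<and> \<epsilon> < \<epsilon>0 \<longrightarrow>
           (\<exists>N::nat. \<forall>n m A. N \<le> n \<and> N \<le> m \<and> solves_TDE n m r \<epsilon> A \<longrightarrow>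
              real (nq A) \<ge> c * sqrt (real r) / \<epsilon>)"
proof (rule exI[of _ "1 / 2400"], rule conjI, simp, rule exI[of _ "1 / 14"], rule conjI, simp, intro allI impI)
  fix r :: nat and \<epsilon> :: real
  assume "1 \<le> r \<and> 0 < \<epsilon> \<and> \<epsilon> < 1 / 14"
  then have r: "1 \<le> r" and \<epsilon>: "0 < \<epsilon>" "\<epsilon> < 1 / 14" by auto
  show "\<exists>N::nat. \<forall>n m A. N \<le> n \<and> N \<le> m \<and> solves_TDE n m r \<epsilon> A \<longrightarrow>
      real (nq A) \<ge> 1 / 2400 * sqrt (real r) / \<epsilon>"
  proof (cases "r = 1")
    case True
    \<comment> \<open>2400 dominates both 2304, from rank one, and 1800, from the higher
      ranks.\<close>
    have "1 / 2400 * sqrt (real r) / \<epsilon> \<le> 1 / (2304 * \<epsilon>)" using True \<epsilon> by (simp add: field_simps)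
    then have "1 / 2400 * sqrt (real r) / \<epsilon> \<le> real (nq A)" if "3 \<le> n" "3 \<le> m" "solves_TDE n m r \<epsilon> A" for n m A
      using lower_bound_rank_1[OF \<epsilon>, of n m A] that True by simp
    then show ?thesis by blast
  next
    case False
    then obtain N where N: "\<forall>n m A. N \<le> n \<and> N \<le> m \<and> solves_TDE n m r \<epsilon> A \<longrightarrow> sqrt (real r) / (1800 * \<epsilon>) \<le> real (nq A)"
      using lower_bound_rank_ge_2[OF _ \<epsilon>, of r] r by auto
    have "1 / 2400 * sqrt (real r) / \<epsilon> \<le> sqrt (real r) / (1800 * \<epsilon>)" using \<epsilon> by (simp add: field_simps)
    then show ?thesis using N by (meson order_trans)
  qed
qed

end
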